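(* (Family $\mathtt{ExpRK6s16}$.) Let $c_2,\ldots,c_{16}>0$ be nodes such that $c_3\ne c_4$; $c_5,c_6,c_7$ are pairwise distinct; $c_8,\ldots,c_{11}$ are pairwise distinct; and $c_{12},\ldots,c_{16}$ are pairwise distinct. Consider the 16-stage explicit exponential Runge--Kutta method with, writing $\varphi_{r,i}(z)=\varphi_r(c_iz)$, - $a_{i2}(z)=\frac{c_i^2}{c_2}\varphi_{2,i}(z)$ for $i=3,4$; - $a_{ij}(z)=\frac{-c_i^2c_k\varphi_{2,i}(z)+2c_i^3\varphi_{3,i}(z)}{c_j(c_j-c_k)}$ for $i=5,6,7$ and $\{j,k\}=\{3,4\}$; - $a_{ij}(z)=\frac{c_i^2c_kc_l\varphi_{2,i}(z)-2c_i^3(c_k+c_l)\varphi_{3,i}(z)+6c_i^4\varphi_{4,i}(z)}{c_j(c_j-c_k)(c_j-c_l)}$ for $i=8,\ldots,11$ and $\{j,k,l\}=\{5,6,7\}$; - $a_{ij}(z)=\frac{-c_i^2c_dc_kc_l\varphi_{2,i}(z)+2c_i^3(c_dc_k+c_dc_l+c_kc_l)\varphi_{3,i}(z)-6c_i^4(c_d+c_k+c_l)\varphi_{4,i}(z)+24c_i^5\varphi_{5,i}(z)}{c_j(c_j-c_d)(c_j-c_k)(c_j-c_l)}$ for $i=12,\ldots,16$ and $\{j,d,k,l\}=\{8,9,10,11\}$; - $b_i(z)=\sum_{r=2}^{6}\theta_{ri}\varphi_r(z)$ for $i=12,\ldots,16$, where, with $\{i,j,d,k,l\}=\{12,\ldots,16\}$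 and $\Delta_i=c_i(c_i-c_j)(c_i-c_d)(c_i-c_k)(c_i-c_l)$, $$\theta_{2i}=\frac{c_jc_dc_kc_l}{\Delta_i},\qquad \theta_{3i}=\frac{-2(c_jc_kc_d+c_jc_kc_l+c_kc_dc_l+c_dc_lc_j)}{\Delta_i},$$ $$\theta_{4i}=\frac{6(c_jc_k+c_jc_d+c_jc_l+c_kc_d+c_kc_l+c_dc_l)}{\Delta_i},\qquad \theta_{5i}=\frac{-24(c_j+c_k+c_l+c_d)}{\Delta_i},\qquad \theta_{6i}=\frac{120}{\Delta_i};$$ and all other $a_{ij}$ and $b_i$ equal to zero. Then this method satisfies all of the 36 stiff order conditions listed in the context in the strong sense. The method is of sixth order: whenever $A$ generates an analytic semigroup on a Banach space $X$, $g\colon X\to X$ is sufficiently often Fr\'echet differentiable in a strip along the exact solution $u\colon[t_0,t_{\mathrm{end}}]\to X$ of $u'=Au+g(u)$, $u(t_0)=u_0$, and $u$ is sufficiently smooth with derivatives in $X$ (all occurring derivatives uniformly bounded), the numerical solution satisfies $\|u_n-u(t_n)\|\le Ch^6$ uniformly on $t_0\le t_n=t_0+nh\le t_{\mathrm{end}}$ with $C$ independent of $n$ and $h$. Moreover, within each of the groups $\{U_{nj}\}_{j=3,4}$, $\{U_{nj}\}_{j=5,6,7}$, $\{U_{nj}\}_{j=8,\ldots,11}$, $\{U_{nj}\}_{j=12,\ldots,16}$ the stages are independent of each other.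
   Context: **Functions.** $\varphi_k(z)=\int_0^1 \mathrm{e}^{(1-\theta)z}\frac{\theta^{k-1}}{(k-1)!}\,d\theta$ for $k\ge1$; $\varphi_k(chA)$ ($c\ge0$, $h>0$) is defined by the same integral using the semigroup. **Method.** The explicit $s$-stage exponential Runge--Kutta method with nodes $c_i$ and coefficient functions $a_{ij}(z)$, $b_i(z)$, applied to $u'=F(u)=Au+g(u)$ with constant step size $h$, is $$U_{ni}=u_n+c_ih\,\varphi_1(c_ihA)F(u_n)+h\sum_{j=2}^{i-1}a_{ij}(hA)D_{nj},\quad 2\le i\le s,$$ $$u_{n+1}=u_n+h\,\varphi_1(hA)F(u_n)+h\sum_{i=2}^{s}b_i(hA)D_{ni},\qquad D_{ni}=g(U_{ni})-g(u_n).$$ A group of stages is independent of each other if $a_{ij}=0$ whenever $i,j$ both belong to the group. **The functions $\psi_{q,i}$.** $\psi_{q,i}(Z)=\sum_{k=2}^{i-1}a_{ik}(Z)\frac{c_k^{q-1}}{(q-1)!}-c_i^q\varphi_q(c_iZ)$. **The 36 stiff order conditions.** Below, $a_{ij}=a_{ij}(Z)$, $b_i=b_i(Z)$, $\varphi_q=\varphi_q(Z)$, $\psi_{q,i}=\psi_{q,i}(Z)$; $\sum_i$ runs over $2\le i\le s$, $\sum_j$ over $2\le j\le i-1$, $\sum_k$ over $2\le k\le j-1$, $\sum_l$ over $2\le l\le k-1$. Each condition (strong sense) is to hold for arbitrary square matrices $Z,J,K,L$ and arbitrary bilinear maps $B$ of appropriate dimensions (likewise with $Z=hA$, bounded operators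 $J,K,L$ and bounded bilinear $B$ on a Banach space); $B(P,Q)$ with operators $P,Q$ stands for $(v,w)\mapsto B(Pv,Qw)$. Order 2: $\sum_i b_ic_i=\varphi_2$. Order 3: $\sum_i b_i\frac{c_i^2}{2!}=\varphi_3$; $\sum_i b_iJ\psi_{2,i}=0$. Order 4: $\sum_i b_i\frac{c_i^3}{3!}=\varphi_4$; $\sum_i b_iJ\psi_{3,i}=0$; $\sum_i b_iJ\sum_j a_{ij}J\psi_{2,j}=0$; $\sum_i b_ic_iK\psi_{2,i}=0$. Order 5: $\sum_i b_i\frac{c_i^4}{4!}=\varphi_5$; $\sum_i b_iJ\psi_{4,i}=0$; $\sum_i b_iJ\sum_j a_{ij}J\psi_{3,j}=0$; $\sum_i b_iJ\sum_j a_{ij}J\sum_k a_{jk}J\psi_{2,k}=0$; $\sum_i b_iJ\sum_j a_{ij}c_jK\psi_{2,j}=0$; $\sum_i b_ic_iK\psi_{3,i}=0$; $\sum_i b_ic_iK\sum_j a_{ij}J\psi_{2,j}=0$; $\sum_i b_iB(\psi_{2,i},\psi_{2,i})=0$; $\sum_i b_ic_i^2L\psi_{2,i}=0$. Order 6: $\sum_i b_i\frac{c_i^5}{5!}=\varphi_6$; $\sum_i b_iJ\psi_{5,i}=0$; $\sum_i b_iJ\sum_j a_{ij}J\psi_{4,j}=0$; $\sum_i b_iJ\sum_j a_{ij}J\sum_k a_{jk}J\psi_{3,k}=0$; $\sum_i b_iJ\sum_j a_{ij}J\sum_k a_{jk}J\sum_l a_{kl}J\psi_{2,l}=0$; $\sum_i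 b_iJ\sum_j a_{ij}J\sum_k a_{jk}c_kK\psi_{2,k}=0$; $\sum_i b_iJ\sum_j a_{ij}c_jK\psi_{3,j}=0$; $\sum_i b_iJ\sum_j a_{ij}c_jK\sum_k a_{jk}J\psi_{2,k}=0$; $\sum_i b_iJ\sum_j a_{ij}B(\psi_{2,j},\psi_{2,j})=0$; $\sum_i b_iJ\sum_j a_{ij}c_j^2L\psi_{2,j}=0$; $\sum_i b_ic_iK\psi_{4,i}=0$; $\sum_i b_ic_iK\sum_j a_{ij}J\psi_{3,j}=0$; $\sum_i b_ic_iK\sum_j a_{ij}J\sum_k a_{jk}J\psi_{2,k}=0$; $\sum_i b_ic_iK\sum_j a_{ij}c_jK\psi_{2,j}=0$; $\sum_i b_iB(\psi_{2,i},\psi_{3,i})=0$; $\sum_i b_iB\big(\psi_{2,i},\sum_j a_{ij}J\psi_{2,j}\big)=0$; $\sum_i b_ic_i^2L\psi_{3,i}=0$; $\sum_i b_ic_i^2L\sum_j a_{ij}J\psi_{2,j}=0$; $\sum_i b_ic_iB(\psi_{2,i},\psi_{2,i})=0$; $\sum_i b_ic_i^3L\psi_{2,i}=0$.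
   Formalization: The error bound ‖u_n−u(t_n)‖ ≤ Ch^6 is proved for step sizes 0 < h ≤ h_0 with h_0 depending on the problem; for arbitrary coarse steps it can fail, since g is uncontrolled outside the strip. *)

theory Defs
  imports "HOL-Analysis.Analysis"
begin

section \<open>Analytic semigroups on a Banach space\<close>

definition C0_semigroup :: "(real \<Rightarrow> 'a::banach \<Rightarrow>\<^sub>L 'a) \<Rightarrow> bool" where
  "C0_semigroup T \<longleftrightarrow>
     T 0 = id_blinfun \<and>
     (\<forall>s\<ge>0. \<forall>t\<ge>0. T (s + t) = T s o\<^sub>L T t) \<and>
     (\<forall>x. ((\<lambda>t. blinfun_apply (T t) x) \<longlongrightarrow> x) (at_right 0))"

text \<open>
  The Banach space \<open>'a\<close> is real; its complexification is \<open>'a \<times> 'a\<close>, the pair \<open>(x, y)\<close> standing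
  for \<open>x + i y\<close>.  The product norm is equivalent to every norm that makes it a complex Banach
  space, so limits and derivatives are the right ones.  A complex Banach space is covered by
  regarding it as a real one: a complex-linear semigroup is then analytic in the sense below
  iff it is analytic in the usual sense.
\<close>

definition cscale :: "complex \<Rightarrow> 'a::real_vector \<times> 'a \<Rightarrow> 'a \<times> 'a" where
  "cscale w p = (Re w *\<^sub>R fst p - Im w *\<^sub>R snd p, Re w *\<^sub>R snd p + Im w *\<^sub>R fst p)"

definition sector :: "real \<Rightarrow> complex set" where
  "sector \<delta> = {z. z \<noteq> 0 \<and> \<bar>Arg z\<bar> < \<delta>}"

text \<open>
  The complexified semigroup extends to an analytic semigroup \<open>S\<close> of complex-linear operators
  on a sector around the positive half-line.  Complex differentiability is required strongly
  (orbit by orbit), which is equivalent to analyticity in the operator norm.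
\<close>

definition analytic_semigroup :: "(real \<Rightarrow> 'a::banach \<Rightarrow>\<^sub>L 'a) \<Rightarrow> bool" where
  "analytic_semigroup T \<longleftrightarrow> C0_semigroup T \<and>
     (\<exists>\<delta> (S :: complex \<Rightarrow> ('a \<times> 'a) \<Rightarrow>\<^sub>L ('a \<times> 'a)). 0 < \<delta> \<and> \<delta> \<le> pi / 2 \<and>
        (\<forall>t\<ge>0. \<forall>x y. blinfun_apply (S (complex_of_real t)) (x, y)
                        = (blinfun_apply (T t) x, blinfun_apply (T t) y)) \<and>
        (\<forall>z\<in>sector \<delta>. \<forall>w p.
            blinfun_apply (S z) (cscale w p) = cscale w (blinfun_apply (S z) p)) \<and>
        (\<forall>z\<in>sector \<delta>. \<forall>z'\<in>sector \<delta>. S (z + z') = S z o\<^sub>L S z') \<and>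
        (\<forall>z\<in>sector \<delta>. \<forall>p. \<exists>d.
            ((\<lambda>z. blinfun_apply (S z) p) has_derivative (\<lambda>w. cscale w d)) (at z)) \<and>
        (\<forall>p. ((\<lambda>z. blinfun_apply (S z) p) \<longlongrightarrow> p) (at 0 within sector \<delta>)))"

text \<open>An unbounded operator is a domain \<open>D\<close> together with a map \<open>A\<close> that matters only on \<open>D\<close>.\<close>

definition generator :: "'a set \<Rightarrow> ('a \<Rightarrow> 'a) \<Rightarrow> (real \<Rightarrow> 'a::banach \<Rightarrow>\<^sub>L 'a) \<Rightarrow> bool" where
  "generator D A T \<longleftrightarrow>
     D = {x. \<exists>y. ((\<lambda>t. (blinfun_apply (T t) x - x) /\<^sub>R t) \<longlongrightarrow> y) (at_right 0)} \<and>
     (\<forall>x\<in>D. ((\<lambda>t. (blinfun_apply (T t) x - x) /\<^sub>R t) \<longlongrightarrow> A x) (at_right 0))"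

definition generates_analytic_semigroup ::
    "'a set \<Rightarrow> ('a \<Rightarrow> 'a) \<Rightarrow> (real \<Rightarrow> 'a::banach \<Rightarrow>\<^sub>L 'a) \<Rightarrow> bool" where
  "generates_analytic_semigroup D A T \<longleftrightarrow> analytic_semigroup T \<and> generator D A T"


section \<open>The \<open>\<phi>\<close>-functions of scalars, matrices and generators\<close>

text \<open>Here \<open>E \<sigma>\<close> plays the role of \<open>exp (\<sigma> z)\<close>, and \<open>k \<ge> 1\<close>.\<close>

definition phi_integral :: "nat \<Rightarrow> (real \<Rightarrow> 'v::real_normed_vector) \<Rightarrow> 'v" where
  "phi_integral k E = integral {0..1} (\<lambda>\<theta>. (\<theta> ^ (k - 1) / fact (k - 1)) *\<^sub>R E (1 - \<theta>))"

definition phi_scalar :: "nat \<Rightarrow> complex \<Rightarrow> complex" where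
  "phi_scalar k z = phi_integral k (\<lambda>\<sigma>. exp (complex_of_real \<sigma> * z))"

primrec matrix_power :: "'f::semiring_1 ^ 'n ^ 'n \<Rightarrow> nat \<Rightarrow> 'f ^ 'n ^ 'n" where
  "matrix_power Z 0 = mat 1"
| "matrix_power Z (Suc m) = Z ** matrix_power Z m"

definition matrix_exp :: "'f::{real_normed_field,banach} ^ 'n ^ 'n \<Rightarrow> 'f ^ 'n ^ 'n" where
  "matrix_exp Z = (\<Sum>m. matrix_power Z m /\<^sub>R fact m)"

definition phi_matrix :: "nat \<Rightarrow> 'f::{real_normed_field,banach} ^ 'n ^ 'n \<Rightarrow> 'f ^ 'n ^ 'n" where
  "phi_matrix k Z = phi_integral k (\<lambda>\<sigma>. matrix_exp (\<sigma> *\<^sub>R Z))"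

text \<open>
  \<open>phi_semigroup T k \<tau>\<close> is \<open>\<phi>\<^sub>k(\<tau>A)\<close> for the generator \<open>A\<close> of \<open>T\<close>.  The integral is taken
  strongly, because \<open>t \<mapsto> T t\<close> need not be norm-continuous at \<open>0\<close>.  For a \<open>C\<^sub>0\<close>-semigroup and
  \<open>\<tau> \<ge> 0\<close> the integrand is continuous and the map is bounded linear, so \<^const>\<open>Blinfun\<close> is harmless.
\<close>

definition phi_semigroup :: "(real \<Rightarrow> 'a::banach \<Rightarrow>\<^sub>L 'a) \<Rightarrow> nat \<Rightarrow> real \<Rightarrow> 'a \<Rightarrow>\<^sub>L 'a" where
  "phi_semigroup T k \<tau> = Blinfun (\<lambda>v. phi_integral k (\<lambda>\<sigma>. blinfun_apply (T (\<sigma> * \<tau>)) v))"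


section \<open>Explicit exponential Runge--Kutta methods\<close>

text \<open>
  \<open>a i j\<close> and \<open>b i\<close> are the operators \<open>a\<^sub>i\<^sub>j(hA)\<close> and \<open>b\<^sub>i(hA)\<close>, \<open>\<phi>1 t\<close> is \<open>\<phi>\<^sub>1(thA)\<close>, and \<open>U n i\<close> is
  the stage \<open>U\<^sub>n\<^sub>i\<close>.
\<close>

definition exp_RK_sequence ::
    "nat \<Rightarrow> (nat \<Rightarrow> real) \<Rightarrow> (real \<Rightarrow> 'a::banach \<Rightarrow>\<^sub>L 'a) \<Rightarrow> (nat \<Rightarrow> nat \<Rightarrow> 'a \<Rightarrow>\<^sub>L 'a) \<Rightarrow>
     (nat \<Rightarrow> 'a \<Rightarrow>\<^sub>L 'a) \<Rightarrow> ('a \<Rightarrow> 'a) \<Rightarrow> ('a \<Rightarrow> 'a) \<Rightarrow> real \<Rightarrow>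
     (nat \<Rightarrow> 'a) \<Rightarrow> (nat \<Rightarrow> nat \<Rightarrow> 'a) \<Rightarrow> bool" where
  "exp_RK_sequence s c \<phi>1 a b A g h u U \<longleftrightarrow>
     (\<forall>n. (\<forall>i\<in>{2..s}.
             U n i = u n + (c i * h) *\<^sub>R blinfun_apply (\<phi>1 (c i)) (A (u n) + g (u n))
                     + h *\<^sub>R (\<Sum>j=2..<i. blinfun_apply (a i j) (g (U n j) - g (u n)))) \<and>
          u (Suc n) = u n + h *\<^sub>R blinfun_apply (\<phi>1 1) (A (u n) + g (u n))
                      + h *\<^sub>R (\<Sum>i=2..s. blinfun_apply (b i) (g (U n i) - g (u n))))"

definition independent_stages :: "(nat \<Rightarrow> nat \<Rightarrow> 'v::zero) \<Rightarrow> nat set \<Rightarrow> bool" where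
  "independent_stages a G \<longleftrightarrow> (\<forall>i\<in>G. \<forall>j\<in>G. a i j = 0)"


section \<open>The stiff order conditions up to order six\<close>

text \<open>
  All operators are given by their action on vectors: \<open>\<phi> q t\<close> is \<open>\<phi>\<^sub>q(tZ)\<close>, \<open>a i j\<close> is \<open>a\<^sub>i\<^sub>j(Z)\<close>,
  \<open>b i\<close> is \<open>b\<^sub>i(Z)\<close>.
\<close>

definition psi ::
    "(nat \<Rightarrow> real) \<Rightarrow> (nat \<Rightarrow> real \<Rightarrow> 'x \<Rightarrow> 'x) \<Rightarrow> (nat \<Rightarrow> nat \<Rightarrow> 'x \<Rightarrow> 'x) \<Rightarrow>
     nat \<Rightarrow> nat \<Rightarrow> 'x::real_vector \<Rightarrow> 'x" where
  "psi c \<phi> a q i v =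
     (\<Sum>k=2..<i. (c k ^ (q - 1) / fact (q - 1)) *\<^sub>R a i k v) - (c i ^ q) *\<^sub>R \<phi> q (c i) v"

definition stiff_order_2 where
  "stiff_order_2 s c \<phi> b \<longleftrightarrow>
     (\<forall>v::'x::real_vector. (\<Sum>i=2..s. (c i::real) *\<^sub>R b i v) = (\<phi> (2::nat) (1::real) v :: 'x))"

definition stiff_order_3 where
  "stiff_order_3 s c \<phi> a b J \<longleftrightarrow> (let \<psi> = psi c \<phi> a in
     (\<forall>v::'x::real_vector. (\<Sum>i=2..s. (c i ^ 2 / fact 2) *\<^sub>R b i v) = (\<phi> 3 1 v :: 'x)) \<and>
     (\<forall>v. (\<Sum>i=2..s. b i (J (\<psi> 2 i v))) = 0))"

definition stiff_order_4 where
  "stiff_order_4 s c \<phi> a b J K \<longleftrightarrow> (let \<psi> = psi c \<phi> a in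
     (\<forall>v::'x::real_vector. (\<Sum>i=2..s. (c i ^ 3 / fact 3) *\<^sub>R b i v) = (\<phi> 4 1 v :: 'x)) \<and>
     (\<forall>v. (\<Sum>i=2..s. b i (J (\<psi> 3 i v))) = 0) \<and>
     (\<forall>v. (\<Sum>i=2..s. b i (J (\<Sum>j=2..<i. a i j (J (\<psi> 2 j v))))) = 0) \<and>
     (\<forall>v. (\<Sum>i=2..s. c i *\<^sub>R b i (K (\<psi> 2 i v))) = 0))"

definition stiff_order_5 where
  "stiff_order_5 s c \<phi> a b J K L B \<longleftrightarrow> (let \<psi> = psi c \<phi> a in
     (\<forall>v::'x::real_vector. (\<Sum>i=2..s. (c i ^ 4 / fact 4) *\<^sub>R b i v) = (\<phi> 5 1 v :: 'x)) \<and>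
     (\<forall>v. (\<Sum>i=2..s. b i (J (\<psi> 4 i v))) = 0) \<and>
     (\<forall>v. (\<Sum>i=2..s. b i (J (\<Sum>j=2..<i. a i j (J (\<psi> 3 j v))))) = 0) \<and>
     (\<forall>v. (\<Sum>i=2..s. b i (J (\<Sum>j=2..<i. a i j (J (\<Sum>k=2..<j. a j k (J (\<psi> 2 k v))))))) = 0) \<and>
     (\<forall>v. (\<Sum>i=2..s. b i (J (\<Sum>j=2..<i. c j *\<^sub>R a i j (K (\<psi> 2 j v))))) = 0) \<and>
     (\<forall>v. (\<Sum>i=2..s. c i *\<^sub>R b i (K (\<psi> 3 i v))) = 0) \<and>
     (\<forall>v. (\<Sum>i=2..s. c i *\<^sub>R b i (K (\<Sum>j=2..<i. a i j (J (\<psi> 2 j v))))) = 0) \<and>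
     (\<forall>v w. (\<Sum>i=2..s. b i (B (\<psi> 2 i v) (\<psi> 2 i w))) = 0) \<and>
     (\<forall>v. (\<Sum>i=2..s. (c i ^ 2) *\<^sub>R b i (L (\<psi> 2 i v))) = 0))"

definition stiff_order_6 where
  "stiff_order_6 s c \<phi> a b J K L B \<longleftrightarrow> (let \<psi> = psi c \<phi> a in
     (\<forall>v::'x::real_vector. (\<Sum>i=2..s. (c i ^ 5 / fact 5) *\<^sub>R b i v) = (\<phi> 6 1 v :: 'x)) \<and>
     (\<forall>v. (\<Sum>i=2..s. b i (J (\<psi> 5 i v))) = 0) \<and>
     (\<forall>v. (\<Sum>i=2..s. b i (J (\<Sum>j=2..<i. a i j (J (\<psi> 4 j v))))) = 0) \<and>
     (\<forall>v. (\<Sum>i=2..s. b i (J (\<Sum>j=2..<i. a i j (J (\<Sum>k=2..<j. a j k (J (\<psi> 3 k v))))))) = 0) \<and>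
     (\<forall>v. (\<Sum>i=2..s. b i (J (\<Sum>j=2..<i. a i j (J (\<Sum>k=2..<j. a j k (J
             (\<Sum>l=2..<k. a k l (J (\<psi> 2 l v))))))))) = 0) \<and>
     (\<forall>v. (\<Sum>i=2..s. b i (J (\<Sum>j=2..<i. a i j (J
             (\<Sum>k=2..<j. c k *\<^sub>R a j k (K (\<psi> 2 k v))))))) = 0) \<and>
     (\<forall>v. (\<Sum>i=2..s. b i (J (\<Sum>j=2..<i. c j *\<^sub>R a i j (K (\<psi> 3 j v))))) = 0) \<and>
     (\<forall>v. (\<Sum>i=2..s. b i (J (\<Sum>j=2..<i. c j *\<^sub>R a i j (K
             (\<Sum>k=2..<j. a j k (J (\<psi> 2 k v))))))) = 0) \<and>
     (\<forall>v w. (\<Sum>i=2..s. b i (J (\<Sum>j=2..<i. a i j (B (\<psi> 2 j v) (\<psi> 2 j w))))) = 0) \<and>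
     (\<forall>v. (\<Sum>i=2..s. b i (J (\<Sum>j=2..<i. (c j ^ 2) *\<^sub>R a i j (L (\<psi> 2 j v))))) = 0) \<and>
     (\<forall>v. (\<Sum>i=2..s. c i *\<^sub>R b i (K (\<psi> 4 i v))) = 0) \<and>
     (\<forall>v. (\<Sum>i=2..s. c i *\<^sub>R b i (K (\<Sum>j=2..<i. a i j (J (\<psi> 3 j v))))) = 0) \<and>
     (\<forall>v. (\<Sum>i=2..s. c i *\<^sub>R b i (K (\<Sum>j=2..<i. a i j (J
             (\<Sum>k=2..<j. a j k (J (\<psi> 2 k v))))))) = 0) \<and>
     (\<forall>v. (\<Sum>i=2..s. c i *\<^sub>R b i (K (\<Sum>j=2..<i. c j *\<^sub>R a i j (K (\<psi> 2 j v))))) = 0) \<and>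
     (\<forall>v w. (\<Sum>i=2..s. b i (B (\<psi> 2 i v) (\<psi> 3 i w))) = 0) \<and>
     (\<forall>v w. (\<Sum>i=2..s. b i (B (\<psi> 2 i v) (\<Sum>j=2..<i. a i j (J (\<psi> 2 j w))))) = 0) \<and>
     (\<forall>v. (\<Sum>i=2..s. (c i ^ 2) *\<^sub>R b i (L (\<psi> 3 i v))) = 0) \<and>
     (\<forall>v. (\<Sum>i=2..s. (c i ^ 2) *\<^sub>R b i (L (\<Sum>j=2..<i. a i j (J (\<psi> 2 j v))))) = 0) \<and>
     (\<forall>v w. (\<Sum>i=2..s. c i *\<^sub>R b i (B (\<psi> 2 i v) (\<psi> 2 i w))) = 0) \<and>
     (\<forall>v. (\<Sum>i=2..s. (c i ^ 3) *\<^sub>R b i (L (\<psi> 2 i v))) = 0))"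

definition stiff_order_conditions ::
    "nat \<Rightarrow> (nat \<Rightarrow> real) \<Rightarrow> (nat \<Rightarrow> real \<Rightarrow> 'x \<Rightarrow> 'x) \<Rightarrow> (nat \<Rightarrow> nat \<Rightarrow> 'x \<Rightarrow> 'x) \<Rightarrow>
     (nat \<Rightarrow> 'x \<Rightarrow> 'x) \<Rightarrow> ('x \<Rightarrow> 'x) \<Rightarrow> ('x \<Rightarrow> 'x) \<Rightarrow> ('x \<Rightarrow> 'x) \<Rightarrow>
     ('x \<Rightarrow> 'x \<Rightarrow> 'x::real_vector) \<Rightarrow> bool" where
  "stiff_order_conditions s c \<phi> a b J K L B \<longleftrightarrow>
     stiff_order_2 s c \<phi> b \<and> stiff_order_3 s c \<phi> a b J \<and> stiff_order_4 s c \<phi> a b J K \<and>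
     stiff_order_5 s c \<phi> a b J K L B \<and> stiff_order_6 s c \<phi> a b J K L B"


section \<open>The coefficients of \<open>ExpRK6s16\<close>\<close>

text \<open>
  Every coefficient is a real linear combination of functions \<open>z \<mapsto> \<phi>\<^sub>r(tz)\<close>.  The value \<open>\<phi> r t\<close>
  of such a function lives in a real vector space \<open>'v\<close>, which is instantiated with numbers,
  matrices and bounded operators.  The factor \<open>\<phi>\<^sub>r\<^sub>,\<^sub>i\<close> is \<open>\<phi> r (c i)\<close>.
\<close>

definition a_two where
  "a_two c \<phi> i j k =
     ((- ((c i)^2 * c k)) *\<^sub>R \<phi> 2 (c i) + (2 * (c i)^3) *\<^sub>R \<phi> 3 (c i))
     /\<^sub>R (c j * (c j - c k))"

definition a_three where
  "a_three c \<phi> i j k l =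
     (((c i)^2 * c k * c l) *\<^sub>R \<phi> 2 (c i) - (2 * (c i)^3 * (c k + c l)) *\<^sub>R \<phi> 3 (c i)
      + (6 * (c i)^4) *\<^sub>R \<phi> 4 (c i))
     /\<^sub>R (c j * (c j - c k) * (c j - c l))"

definition a_four where
  "a_four c \<phi> i j d k l =
     ((- ((c i)^2 * c d * c k * c l)) *\<^sub>R \<phi> 2 (c i)
      + (2 * (c i)^3 * (c d * c k + c d * c l + c k * c l)) *\<^sub>R \<phi> 3 (c i)
      - (6 * (c i)^4 * (c d + c k + c l)) *\<^sub>R \<phi> 4 (c i)
      + (24 * (c i)^5) *\<^sub>R \<phi> 5 (c i))
     /\<^sub>R (c j * (c j - c d) * (c j - c k) * (c j - c l))"

definition ExpRK6s16_a ::
    "(nat \<Rightarrow> real) \<Rightarrow> (nat \<Rightarrow> real \<Rightarrow> 'v::real_vector) \<Rightarrow> nat \<Rightarrow> nat \<Rightarrow> 'v" where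
  "ExpRK6s16_a c \<phi> i j =
     (if i \<in> {3, 4} \<and> j = 2 then ((c i)^2 / c 2) *\<^sub>R \<phi> 2 (c i)
      else if i \<in> {5, 6, 7} then
        (if j = 3 then a_two c \<phi> i 3 4
         else if j = 4 then a_two c \<phi> i 4 3
         else 0)
      else if i \<in> {8..11} then
        (if j = 5 then a_three c \<phi> i 5 6 7
         else if j = 6 then a_three c \<phi> i 6 5 7
         else if j = 7 then a_three c \<phi> i 7 5 6
         else 0)
      else if i \<in> {12..16} then
        (if j = 8 then a_four c \<phi> i 8 9 10 11
         else if j = 9 then a_four c \<phi> i 9 8 10 11
         else if j = 10 then a_four c \<phi> i 10 8 9 11
         else if j = 11 then a_four c \<phi> i 11 8 9 10
         else 0)
      else 0)"

definition theta :: "(nat \<Rightarrow> real) \<Rightarrow> nat \<Rightarrow> nat \<Rightarrow> nat \<Rightarrow> nat \<Rightarrow> nat \<Rightarrow> nat \<Rightarrow> real" where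
  "theta c r i j d k l =
     (if r = 2 then c j * c d * c k * c l
      else if r = 3 then - 2 * (c j * c k * c d + c j * c k * c l + c k * c d * c l + c d * c l * c j)
      else if r = 4 then 6 * (c j * c k + c j * c d + c j * c l + c k * c d + c k * c l + c d * c l)
      else if r = 5 then - 24 * (c j + c k + c l + c d)
      else if r = 6 then 120
      else 0)
     / (c i * (c i - c j) * (c i - c d) * (c i - c k) * (c i - c l))"

definition b_five where
  "b_five c \<phi> i j d k l = (\<Sum>r=2..6. theta c r i j d k l *\<^sub>R \<phi> r (1::real))"

definition ExpRK6s16_b ::
    "(nat \<Rightarrow> real) \<Rightarrow> (nat \<Rightarrow> real \<Rightarrow> 'v::real_vector) \<Rightarrow> nat \<Rightarrow> 'v" where
  "ExpRK6s16_b c \<phi> i =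
     (if i = 12 then b_five c \<phi> 12 13 14 15 16
      else if i = 13 then b_five c \<phi> 13 12 14 15 16
      else if i = 14 then b_five c \<phi> 14 12 13 15 16
      else if i = 15 then b_five c \<phi> 15 12 13 14 16
      else if i = 16 then b_five c \<phi> 16 12 13 14 15
      else 0)"


section \<open>Smoothness assumptions\<close>

definition strip :: "(real \<Rightarrow> 'a::metric_space) \<Rightarrow> real \<Rightarrow> real \<Rightarrow> real \<Rightarrow> 'a set" where
  "strip u t0 t1 \<rho> = (\<Union>t\<in>{t0..t1}. ball (u t) \<rho>)"

text \<open>
  Six Frechet derivatives, all bounded on \<open>S\<close>; the \<open>k\<close>-th one takes values in the iterated
  operator space, so that differentiability refers to the operator norm.
\<close>

definition six_times_differentiable_bounded ::
    "('a::real_normed_vector \<Rightarrow> 'a) \<Rightarrow> 'a set \<Rightarrow> bool" where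
  "six_times_differentiable_bounded g S \<longleftrightarrow>
     (\<exists>(g1 :: 'a \<Rightarrow> 'a \<Rightarrow>\<^sub>L 'a)
       (g2 :: 'a \<Rightarrow> 'a \<Rightarrow>\<^sub>L 'a \<Rightarrow>\<^sub>L 'a)
       (g3 :: 'a \<Rightarrow> 'a \<Rightarrow>\<^sub>L 'a \<Rightarrow>\<^sub>L 'a \<Rightarrow>\<^sub>L 'a)
       (g4 :: 'a \<Rightarrow> 'a \<Rightarrow>\<^sub>L 'a \<Rightarrow>\<^sub>L 'a \<Rightarrow>\<^sub>L 'a \<Rightarrow>\<^sub>L 'a)
       (g5 :: 'a \<Rightarrow> 'a \<Rightarrow>\<^sub>L 'a \<Rightarrow>\<^sub>L 'a \<Rightarrow>\<^sub>L 'a \<Rightarrow>\<^sub>L 'a \<Rightarrow>\<^sub>L 'a)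
       (g6 :: 'a \<Rightarrow> 'a \<Rightarrow>\<^sub>L 'a \<Rightarrow>\<^sub>L 'a \<Rightarrow>\<^sub>L 'a \<Rightarrow>\<^sub>L 'a \<Rightarrow>\<^sub>L 'a \<Rightarrow>\<^sub>L 'a) M.
       \<forall>x\<in>S.
         (g has_derivative blinfun_apply (g1 x)) (at x) \<and> norm (g1 x) \<le> M \<and>
         (g1 has_derivative blinfun_apply (g2 x)) (at x) \<and> norm (g2 x) \<le> M \<and>
         (g2 has_derivative blinfun_apply (g3 x)) (at x) \<and> norm (g3 x) \<le> M \<and>
         (g3 has_derivative blinfun_apply (g4 x)) (at x) \<and> norm (g4 x) \<le> M \<and>
         (g4 has_derivative blinfun_apply (g5 x)) (at x) \<and> norm (g5 x) \<le> M \<and>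
         (g5 has_derivative blinfun_apply (g6 x)) (at x) \<and> norm (g6 x) \<le> M)"

definition smooth_bounded_curve ::
    "nat \<Rightarrow> (real \<Rightarrow> 'a::real_normed_vector) \<Rightarrow> real \<Rightarrow> real \<Rightarrow> bool" where
  "smooth_bounded_curve m u t0 t1 \<longleftrightarrow>
     (\<exists>(du :: nat \<Rightarrow> real \<Rightarrow> 'a) M. du 0 = u \<and>
        (\<forall>k<m. \<forall>t\<in>{t0..t1}. (du k has_vector_derivative du (Suc k) t) (at t within {t0..t1})) \<and>
        (\<forall>k\<in>{1..m}. \<forall>t\<in>{t0..t1}. norm (du k t) \<le> M))"

definition solves ::
    "'a set \<Rightarrow> ('a \<Rightarrow> 'a) \<Rightarrow> ('a \<Rightarrow> 'a) \<Rightarrow> (real \<Rightarrow> 'a::real_normed_vector) \<Rightarrow> real \<Rightarrow> real \<Rightarrow> bool" where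
  "solves D A g u t0 t1 \<longleftrightarrow>
     (\<forall>t\<in>{t0..t1}. u t \<in> D \<and>
        (u has_vector_derivative (A (u t) + g (u t))) (at t within {t0..t1}))"

end

theory Submission
  imports Defs
begin

text \<open>
  The stages of \<open>ExpRK6s16\<close> come in layers: stage 2, then \<open>{3, 4}\<close>, \<open>{5, 6, 7}\<close>, \<open>{8..11}\<close> and
  \<open>{12..16}\<close>, followed by the update.  Each layer uses only the values of \<open>g\<close> at the layer just
  before it, and its coefficients are those of a collocation scheme: with Lagrange polynomials
  \<open>\<ell>\<^sub>j\<close> for the node \<open>0\<close> together with the \<open>p\<close> nodes of the previous layer, replacing each
  monomial \<open>x ^ q\<close> in \<open>\<ell>\<^sub>j\<close> by \<open>q! \<phi>\<^sub>q\<^sub>+\<^sub>1\<close> (times a power of \<open>c\<^sub>i\<close>) yields \<open>a\<^sub>i\<^sub>j\<close> or \<open>b\<^sub>j\<close>.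
  Since interpolation reproduces polynomials of degree at most \<open>p\<close> vanishing at \<open>0\<close>, the moments
  \<open>\<Sum>\<^sub>j a\<^sub>i\<^sub>j c\<^sub>j ^ q / q!\<close> equal \<open>c\<^sub>i ^ (q + 1) \<phi>\<^sub>q\<^sub>+\<^sub>1(c\<^sub>i Z)\<close> for \<open>1 \<le> q \<le> p\<close>
  (\<open>sum_a_order\<close>, \<open>sum_b_order\<close>).

  This is linear algebra over formal symbols \<open>\<phi>\<^sub>r\<close>.  It makes \<open>\<psi>\<^sub>q\<^sub>,\<^sub>i\<close> vanish for \<open>2 \<le> q \<le> p + 1\<close>.
  Five of the 36 conditions are moments of the weights \<open>b\<^sub>i\<close>; in each of the others the layered
  sparsity pattern leaves only summands whose innermost factor is such a vanishing \<open>\<psi>\<^sub>q\<^sub>,\<^sub>i\<close> (\<open>stiff_order_conditions_ExpRK6s16\<close>).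

  The same moments give convergence directly, with no expansion into elementary differentials.
  Put \<open>f = g \<circ> u\<close>.  If the values used by a layer are accurate to \<open>O(h ^ m)\<close>, then the layer
  integrates the Taylor polynomial of \<open>f\<close> of degree \<open>m - 1\<close> exactly against the semigroup, and the
  prefactor \<open>h\<close> makes its own values accurate to \<open>O(h ^ (m + 1))\<close> (\<open>stage_step\<close>).  Five layers turn
  the trivial accuracy into \<open>O(h ^ 6)\<close>, and the update has local error \<open>O(h ^ 7)\<close> (\<open>step_defect\<close>).
  All these estimates are carried out with the perturbed value \<open>u\<^sub>n\<close> in place of \<open>u(t\<^sub>n)\<close>, so that
  they contain the stability estimate, and a discrete Gronwall argument finishes the proof
  (\<open>discrete_gronwall\<close>, \<open>sixth_order_convergence\<close>).

  Two points require care.  Nodes may exceed \<open>1\<close>, so that a stage near the end of the interval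
  approximates a point beyond it.  The solution is therefore continued past \<open>t_end\<close> by its Taylor
  polynomial (\<open>extended_solution\<close>).  This continuation need not solve the differential equation,
  but the stage estimate only involves derivatives at \<open>t\<^sub>n\<close>, through the telescoping identity
  \<open>taylor_telescope\<close>.  Moreover \<open>A\<close> is unbounded: the scheme is brought into a form free of \<open>A\<close> by
  showing that all \<open>u\<^sub>n\<close> stay in its domain (\<open>ExpRK6s16_semigroup_form\<close>).
\<close>

section \<open>Lagrange interpolation and the moments of the coefficients\<close>

text \<open>
  Both sides have degree below \<open>card S\<close> and agree at the \<open>card S\<close> nodes.
\<close>

lemma lagrange_interpolation_poly:
  fixes c :: "'i \<Rightarrow> real"
  assumes "finite S" "inj_on c S" "degree p < card S"
  shows "p = (\<Sum>j\<in>S. smult (poly p (c j) / (\<Prod>k\<in>S-{j}. c j - c k)) (\<Prod>k\<in>S-{j}. [:- c k, 1:]))"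
    (is "p = ?q")
proof (rule poly_eqI_degree[where A = "c ` S"])
  show "poly p x = poly ?q x" if x: "x \<in> c ` S" for x
  proof -
    obtain i where i: "i \<in> S" "x = c i" using x by auto
    have nz: "(\<Prod>k\<in>S-{i}. c i - c k) \<noteq> 0"
      using assms i by (auto simp: inj_on_def)
    have "poly ?q x = (\<Sum>j\<in>S. if j = i then poly p x else 0)"
      unfolding poly_sum poly_smult poly_prod
    proof (rule sum.cong[OF refl], goal_cases)
      case (1 j)
      show ?case
      proof (cases "j = i")
        case False
        then have "(\<Prod>k\<in>S-{j}. poly [:- c k, 1:] x) = 0"
          using i assms(1) by (intro prod_zero) auto
        then show ?thesis using False by simp
      qed (use nz i in simp)
    qed
    then show ?thesis using i assms(1) by simp
  qed
  have card: "card (c ` S) = card S" using assms card_image by blast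
  show "degree p < card (c ` S)" using assms card by simp
  have "degree ?q \<le> card S - 1"
  proof (rule degree_sum_le)
    show "degree (smult (poly p (c j) / (\<Prod>k\<in>S-{j}. c j - c k)) (\<Prod>k\<in>S-{j}. [:- c k, 1:]))
           \<le> card S - 1" if "j \<in> S" for j
    proof -
      have "degree (\<Prod>k\<in>S-{j}. [:- c k, 1:]) \<le> (\<Sum>k\<in>S-{j}. degree [:- c k, 1:])"
        using assms(1) degree_prod_sum_le by (metis comp_apply finite_Diff sum.cong)
      also have "\<dots> = card S - 1" using that assms(1) by simp
      finally show ?thesis using degree_smult_le order_trans by blast
    qed
  qed (use assms in auto)
  then show "degree ?q < card (c ` S)" using card assms(3) by linarith
qed

text \<open>
  The coefficient of \<open>x ^ (r + 1)\<close> in the Lagrange basis polynomial that belongs to node \<open>c j\<close> when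
  \<open>0\<close> is added to the nodes \<open>c ` S\<close>; every such polynomial is divisible by \<open>x\<close>, which is cancelled
  here.
\<close>

definition lagrange_weight :: "('i \<Rightarrow> real) \<Rightarrow> 'i set \<Rightarrow> 'i \<Rightarrow> nat \<Rightarrow> real" where
  "lagrange_weight c S j r =
     coeff (\<Prod>k\<in>S-{j}. [:- c k, 1:]) r / (c j * (\<Prod>k\<in>S-{j}. c j - c k))"

text \<open>
  Interpolation reproduces the monomial \<open>x ^ (m + 1)\<close>; this compares coefficients.
\<close>

lemma sum_lagrange_weight:
  assumes "finite S" "inj_on c S" "\<And>j. j \<in> S \<Longrightarrow> c j \<noteq> 0" "m < card S"
  shows "(\<Sum>j\<in>S. c j ^ Suc m * lagrange_weight c S j r) = (if r = m then 1 else 0)"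
proof -
  have "monom (1::real) m = (\<Sum>j\<in>S. smult (poly (monom 1 m) (c j) / (\<Prod>k\<in>S-{j}. c j - c k))
      (\<Prod>k\<in>S-{j}. [:- c k, 1:]))"
    by (rule lagrange_interpolation_poly) (use assms in \<open>auto simp: degree_monom_eq\<close>)
  then have "coeff (monom (1::real) m) r = coeff (\<Sum>j\<in>S. smult (poly (monom 1 m) (c j) / (\<Prod>k\<in>S-{j}. c j - c k))
      (\<Prod>k\<in>S-{j}. [:- c k, 1:])) r" by simp
  also have "\<dots> = (\<Sum>j\<in>S. c j ^ Suc m * lagrange_weight c S j r)"
    using assms(3) by (auto simp: coeff_sum poly_monom lagrange_weight_def intro!: sum.cong)
  finally show ?thesis by (auto simp: coeff_monom)
qed

text \<open>
  The moment identity behind all order conditions: a combination of vectors \<open>x\<close> with Lagrange weights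
  and factorials as coefficients isolates one of the vectors when weighted with powers of the nodes.
  The shift by 2 fits \<open>x r = \<phi> r\<close>, since \<open>\<phi>\<^sub>2\<close> is the first function in the coefficients.
\<close>

lemma sum_lagrange_combination:
  fixes x :: "nat \<Rightarrow> 'v::real_vector"
  assumes "finite S" "inj_on c S" "\<And>j. j \<in> S \<Longrightarrow> c j \<noteq> 0" "1 \<le> q" "q \<le> card S"
  shows "(\<Sum>j\<in>S. (c j ^ q / fact q) *\<^sub>R (\<Sum>r<card S. (fact (Suc r) * lagrange_weight c S j r) *\<^sub>R x (r + 2)))
         = x (Suc q)"
proof -
  obtain m where q: "q = Suc m" using assms(4) not0_implies_Suc by force
  have "(\<Sum>j\<in>S. (c j ^ q / fact q) *\<^sub>R (\<Sum>r<card S. (fact (Suc r) * lagrange_weight c S j r) *\<^sub>R x (r + 2)))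
      = (\<Sum>r<card S. \<Sum>j\<in>S. (c j ^ q / fact q) *\<^sub>R (fact (Suc r) * lagrange_weight c S j r) *\<^sub>R x (r + 2))"
    by (simp add: scaleR_sum_right sum.swap[of _ S] del: fact_Suc scaleR_scaleR)
  also have "\<dots> = (\<Sum>r<card S. ((fact (Suc r) / fact q) * (\<Sum>j\<in>S. c j ^ Suc m * lagrange_weight c S j r)) *\<^sub>R x (r + 2))"
    by (simp add: scaleR_sum_left sum_distrib_left q mult_ac del: fact_Suc)
  also have "\<dots> = (\<Sum>r<card S. if r = m then x (Suc q) else 0)"
    using assms q by (intro sum.cong refl) (simp add: sum_lagrange_weight del: fact_Suc power_Suc)
  also have "\<dots> = x (Suc q)" using assms q by simp
  finally show ?thesis .
qed


lemma lagrange_weight_insert: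
  assumes "finite S" "j \<notin> S"
  shows "lagrange_weight c (insert j S) j r =
     coeff (\<Prod>k\<in>S. [:- c k, 1:]) r / (c j * (\<Prod>k\<in>S. c j - c k))"
  using assms by (simp add: lagrange_weight_def)


text \<open>
  Viete's formulas for the products \<open>\<Prod>(x - c\<^sub>k)\<close> turn the explicit symmetric functions in the
  definitions of the coefficients into Lagrange weights.
\<close>

lemma a_two_eq_lagrange:
  fixes \<phi> :: "nat \<Rightarrow> real \<Rightarrow> 'v::real_vector"
  assumes "distinct [j, k]"
  shows "a_two c \<phi> i j k = (\<Sum>r<2. (fact (Suc r) * lagrange_weight c {j,k} j r) *\<^sub>R
           (c i ^ (r + 2) *\<^sub>R \<phi> (r + 2) (c i)))"
    (is "_ = sum ?g _")
proof -
  define d where "d = c j * (c j - c k)"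
  have W: "lagrange_weight c {j,k} j 0 = (- c k) / d" "lagrange_weight c {j,k} j 1 = 1 / d"
    using assms by (simp_all add: lagrange_weight_insert d_def eval_nat_numeral algebra_simps)
  have g: "?g 0 = (1 * ((- c k) / d)) *\<^sub>R (c i ^ 2 *\<^sub>R \<phi> 2 (c i))"
    "?g 1 = (2 * (1 / d)) *\<^sub>R (c i ^ 3 *\<^sub>R \<phi> 3 (c i))"
    unfolding W by (simp_all add: eval_nat_numeral)
  have "sum ?g {..<2} = ?g 0 + ?g 1"
    by (simp add: eval_nat_numeral)
  also have "\<dots> = a_two c \<phi> i j k"
    unfolding g a_two_def d_def[symmetric] by (simp add: algebra_simps divide_inverse)
  finally show ?thesis by simp
qed

lemma a_three_eq_lagrange:
  fixes \<phi> :: "nat \<Rightarrow> real \<Rightarrow> 'v::real_vector"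
  assumes "distinct [j, k, l]"
  shows "a_three c \<phi> i j k l = (\<Sum>r<3. (fact (Suc r) * lagrange_weight c {j,k,l} j r) *\<^sub>R
           (c i ^ (r + 2) *\<^sub>R \<phi> (r + 2) (c i)))"
    (is "_ = sum ?g _")
proof -
  define d where "d = c j * (c j - c k) * (c j - c l)"
  have W: "lagrange_weight c {j,k,l} j 0 = (c k * c l) / d" "lagrange_weight c {j,k,l} j 1 = (- (c k + c l)) / d" "lagrange_weight c {j,k,l} j 2 = 1 / d"
    using assms by (simp_all add: lagrange_weight_insert d_def eval_nat_numeral algebra_simps)
  have g: "?g 0 = (1 * ((c k * c l) / d)) *\<^sub>R (c i ^ 2 *\<^sub>R \<phi> 2 (c i))"
    "?g 1 = (2 * ((- (c k + c l)) / d)) *\<^sub>R (c i ^ 3 *\<^sub>R \<phi> 3 (c i))"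
    "?g 2 = (6 * (1 / d)) *\<^sub>R (c i ^ 4 *\<^sub>R \<phi> 4 (c i))"
    unfolding W by (simp_all add: eval_nat_numeral)
  have "sum ?g {..<3} = ?g 0 + ?g 1 + ?g 2"
    by (simp add: eval_nat_numeral)
  also have "\<dots> = a_three c \<phi> i j k l"
    unfolding g a_three_def d_def[symmetric] by (simp add: algebra_simps divide_inverse)
  finally show ?thesis by simp
qed

lemma a_four_eq_lagrange:
  fixes \<phi> :: "nat \<Rightarrow> real \<Rightarrow> 'v::real_vector"
  assumes "distinct [j, d', k, l]"
  shows "a_four c \<phi> i j d' k l = (\<Sum>r<4. (fact (Suc r) * lagrange_weight c {j,d',k,l} j r) *\<^sub>R
           (c i ^ (r + 2) *\<^sub>R \<phi> (r + 2) (c i)))"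
    (is "_ = sum ?g _")
proof -
  define d where "d = c j * (c j - c d') * (c j - c k) * (c j - c l)"
  have W: "lagrange_weight c {j,d',k,l} j 0 = (- (c d' * c k * c l)) / d" "lagrange_weight c {j,d',k,l} j 1 = (c d' * c k + c d' * c l + c k * c l) / d" "lagrange_weight c {j,d',k,l} j 2 = (- (c d' + c k + c l)) / d" "lagrange_weight c {j,d',k,l} j 3 = 1 / d"
    using assms by (simp_all add: lagrange_weight_insert d_def eval_nat_numeral algebra_simps)
  have g: "?g 0 = (1 * ((- (c d' * c k * c l)) / d)) *\<^sub>R (c i ^ 2 *\<^sub>R \<phi> 2 (c i))"
    "?g 1 = (2 * ((c d' * c k + c d' * c l + c k * c l) / d)) *\<^sub>R (c i ^ 3 *\<^sub>R \<phi> 3 (c i))"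
    "?g 2 = (6 * ((- (c d' + c k + c l)) / d)) *\<^sub>R (c i ^ 4 *\<^sub>R \<phi> 4 (c i))"
    "?g 3 = (24 * (1 / d)) *\<^sub>R (c i ^ 5 *\<^sub>R \<phi> 5 (c i))"
    unfolding W by (simp_all add: eval_nat_numeral)
  have "sum ?g {..<4} = ?g 0 + ?g 1 + ?g 2 + ?g 3"
    by (simp add: eval_nat_numeral)
  also have "\<dots> = a_four c \<phi> i j d' k l"
    unfolding g a_four_def d_def[symmetric] by (simp add: algebra_simps divide_inverse)
  finally show ?thesis by simp
qed

lemma b_five_eq_lagrange:
  fixes \<phi> :: "nat \<Rightarrow> real \<Rightarrow> 'v::real_vector"
  assumes "distinct [i, j, d', k, l]"
  shows "b_five c \<phi> i j d' k l =
           (\<Sum>r<5. (fact (Suc r) * lagrange_weight c {i,j,d',k,l} i r) *\<^sub>R \<phi> (r + 2) 1)"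
proof -
  define d where "d = c i * (c i - c j) * (c i - c d') * (c i - c k) * (c i - c l)"
  have W: "lagrange_weight c {i,j,d',k,l} i 0 = c j * c d' * c k * c l / d"
    "lagrange_weight c {i,j,d',k,l} i 1 =
       - (c j * c k * c d' + c j * c k * c l + c k * c d' * c l + c d' * c l * c j) / d"
    "lagrange_weight c {i,j,d',k,l} i 2 =
       (c j * c k + c j * c d' + c j * c l + c k * c d' + c k * c l + c d' * c l) / d"
    "lagrange_weight c {i,j,d',k,l} i 3 = - (c j + c k + c l + c d') / d"
    "lagrange_weight c {i,j,d',k,l} i 4 = 1 / d"
    using assms by (simp_all add: lagrange_weight_insert d_def eval_nat_numeral algebra_simps)
  have "theta c (r + 2) i j d' k l = fact (Suc r) * lagrange_weight c {i,j,d',k,l} i r"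
    if "r < 5" for r
  proof -
    have "r \<in> {0, 1, 2, 3, 4}" using that by auto
    then show ?thesis
      by (elim insertE emptyE; simp only: theta_def W d_def[symmetric]; simp add: fact_numeral)
  qed
  moreover have "b_five c \<phi> i j d' k l = (\<Sum>r<5. theta c (r + 2) i j d' k l *\<^sub>R \<phi> (r + 2) 1)"
    unfolding b_five_def
    by (rule sum.reindex_bij_witness[where i = "\<lambda>r. r + 2" and j = "\<lambda>r. r - 2"])
       (auto simp del: add_2_eq_Suc')
  ultimately show ?thesis by simp
qed


text \<open>
  The layer on which stage \<open>i\<close> depends.
\<close>

definition sources :: "nat \<Rightarrow> nat set" where
  "sources i = (if i \<in> {3, 4} then {2} else if i \<in> {5, 6, 7} then {3, 4}
     else if i \<in> {8..11} then {5, 6, 7} else if i \<in> {12..16} then {8..11} else {})"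

lemma sources_cases:
  assumes "i \<in> {3..16}"
  obtains "i \<in> {3, 4}" "sources i = {2}" "card (sources i) = 1"
  | "i \<in> {5, 6, 7}" "sources i = {3, 4}" "card (sources i) = 2"
  | "i \<in> {8..11}" "sources i = {5, 6, 7}" "card (sources i) = 3"
  | "i \<in> {12..16}" "sources i = {8..11}" "card (sources i) = 4"
proof -
  consider "i \<in> {3, 4}" | "i \<in> {5, 6, 7}" | "i \<in> {8..11}" | "i \<in> {12..16}"
    using assms by fastforce
  then show ?thesis
    by cases (use that in \<open>auto simp: sources_def\<close>)
qed

lemma ExpRK6s16_a_eq_0: "j \<notin> sources i \<Longrightarrow> ExpRK6s16_a c \<phi> i j = 0"
  by (auto simp: ExpRK6s16_a_def sources_def)

lemma sources_subset: "sources i \<subseteq> {2..<i}"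
  by (auto simp: sources_def)

lemma ExpRK6s16_a_eq_lagrange:
  fixes \<phi> :: "nat \<Rightarrow> real \<Rightarrow> 'v::real_vector"
  assumes "i \<in> {3..16}" "j \<in> sources i"
  shows "ExpRK6s16_a c \<phi> i j = (\<Sum>r<card (sources i).
           (fact (Suc r) * lagrange_weight c (sources i) j r) *\<^sub>R (c i ^ (r + 2) *\<^sub>R \<phi> (r + 2) (c i)))"
  using assms(1)
proof (cases i rule: sources_cases)
  case 1
  then show ?thesis using assms(2)
    by (auto simp: ExpRK6s16_a_def lagrange_weight_def divide_inverse mult.commute numeral_2_eq_2)
next
  case 2
  note [simp] = a_two_eq_lagrange[of 3 4] a_two_eq_lagrange[of 4 3]
  have "j \<in> {3, 4}" using 2 assms(2) by simp
  then show ?thesis using 2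
    by (elim insertE emptyE) (simp_all add: ExpRK6s16_a_def insert_commute numeral_2_eq_2 del: fact_Suc sum.lessThan_Suc)
next
  case 3
  note [simp] = a_three_eq_lagrange[of 5 6 7] a_three_eq_lagrange[of 6 5 7] a_three_eq_lagrange[of 7 5 6]
  have "j \<in> {5, 6, 7}" using 3 assms(2) by simp
  then show ?thesis using 3
    by (elim insertE emptyE) (auto simp: ExpRK6s16_a_def insert_commute numeral_3_eq_3 simp del: fact_Suc sum.lessThan_Suc)
next
  case 4
  note [simp] = a_four_eq_lagrange[of 8 9 10 11] a_four_eq_lagrange[of 9 8 10 11]
    a_four_eq_lagrange[of 10 8 9 11] a_four_eq_lagrange[of 11 8 9 10]
  have N: "(4::nat) = Suc (Suc (Suc (Suc 0)))" by simp
  have S: "{8..11} = {8, 9, 10, 11::nat}" by auto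
  have "j \<in> {8, 9, 10, 11}" using 4 assms(2) S by simp
  then show ?thesis using 4 unfolding S
    by (elim insertE emptyE) (auto simp: ExpRK6s16_a_def insert_commute N simp del: fact_Suc sum.lessThan_Suc)
qed

lemma ExpRK6s16_b_eq_0: "i \<notin> {12..16} \<Longrightarrow> ExpRK6s16_b c \<phi> i = 0"
  by (auto simp: ExpRK6s16_b_def)

lemma ExpRK6s16_b_eq_lagrange:
  fixes \<phi> :: "nat \<Rightarrow> real \<Rightarrow> 'v::real_vector"
  assumes "i \<in> {12..16}"
  shows "ExpRK6s16_b c \<phi> i =
    (\<Sum>r<5. (fact (Suc r) * lagrange_weight c {12..16} i r) *\<^sub>R \<phi> (r + 2) 1)"
proof -
  note [simp] = b_five_eq_lagrange[of 12 13 14 15 16] b_five_eq_lagrange[of 13 12 14 15 16]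
    b_five_eq_lagrange[of 14 12 13 15 16] b_five_eq_lagrange[of 15 12 13 14 16]
    b_five_eq_lagrange[of 16 12 13 14 15]
  have S: "{12..16} = {12, 13, 14, 15, 16::nat}" by auto
  have "i \<in> {12, 13, 14, 15, 16}" using assms S by simp
  then show ?thesis unfolding S
    by (elim insertE emptyE) (auto simp: ExpRK6s16_b_def insert_commute simp del: fact_Suc sum.lessThan_Suc)
qed

locale ExpRK6s16_nodes =
  fixes c :: "nat \<Rightarrow> real"
  assumes pos: "\<And>i. i \<in> {2..16} \<Longrightarrow> 0 < c i"
    and inj: "c 3 \<noteq> c 4" "inj_on c {5, 6, 7}" "inj_on c {8..11}" "inj_on c {12..16}"
begin

lemma inj_on_sources: "inj_on c (sources i)"
  using inj by (auto simp: sources_def)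

lemma sum_a_order:
  fixes \<phi> :: "nat \<Rightarrow> real \<Rightarrow> 'v::real_vector"
  assumes i: "i \<in> {3..16}" and q: "1 \<le> q" "q \<le> card (sources i)"
  shows "(\<Sum>j\<in>sources i. (c j ^ q / fact q) *\<^sub>R ExpRK6s16_a c \<phi> i j) = c i ^ Suc q *\<^sub>R \<phi> (Suc q) (c i)"
proof -
  have nz: "c j \<noteq> 0" if "j \<in> sources i" for j
    using that pos[of j] sources_subset[of i] i by fastforce
  have fin: "finite (sources i)" using sources_subset finite_subset by blast
  show ?thesis
    using sum_lagrange_combination[OF fin inj_on_sources nz q, of "\<lambda>r. c i ^ r *\<^sub>R \<phi> r (c i)"] i
    by (simp add: ExpRK6s16_a_eq_lagrange del: fact_Suc cong: sum.cong)
qed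

lemma sum_b_order:
  fixes \<phi> :: "nat \<Rightarrow> real \<Rightarrow> 'v::real_vector"
  assumes q: "1 \<le> q" "q \<le> 5"
  shows "(\<Sum>i=12..16. (c i ^ q / fact q) *\<^sub>R ExpRK6s16_b c \<phi> i) = \<phi> (Suc q) 1"
proof -
  have nz: "c j \<noteq> 0" if "j \<in> {12..16}" for j
    using that pos[of j] by fastforce
  show ?thesis
    using sum_lagrange_combination[OF _ inj(4) nz q(1), of "\<lambda>r. \<phi> r 1"] q(2)
    by (simp add: ExpRK6s16_b_eq_lagrange del: fact_Suc atLeastAtMost_iff cong: sum.cong_simp)
qed

section \<open>The stiff order conditions\<close>

text \<open>
  Matrices and bounded operators are treated together: \<open>app\<close> is the bilinear action of a
  coefficient on vectors.
\<close>

context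
  fixes app :: "'v::real_vector \<Rightarrow> 'x::real_vector \<Rightarrow> 'x" and \<phi> :: "nat \<Rightarrow> real \<Rightarrow> 'v"
  assumes bil: "bilinear app"
begin

lemma app_0 [simp]: "app 0 v = 0" "app V 0 = 0"
  using bil linear_0[of "\<lambda>V. app V v"] by (auto simp: bilinear_def linear_0)

lemma app_sum_scaleR: "app (\<Sum>j\<in>S. r j *\<^sub>R V j) v = (\<Sum>j\<in>S. r j *\<^sub>R app (V j) v)"
proof -
  have "linear (\<lambda>V. app V v)" using bil by (simp add: bilinear_def)
  from linear_sum[OF this, of "\<lambda>j. r j *\<^sub>R V j" S] show ?thesis
    by (simp add: linear_scale[OF \<open>linear (\<lambda>V. app V v)\<close>])
qed

lemma psi_ExpRK6s16_eq_0:
  assumes "i \<in> {3..16}" "2 \<le> q" "q \<le> Suc (card (sources i))"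
  shows "psi c (\<lambda>q t. app (\<phi> q t)) (\<lambda>i j. app (ExpRK6s16_a c \<phi> i j)) q i v = 0"
proof -
  obtain p where p: "q = Suc p" "1 \<le> p" "p \<le> card (sources i)"
    using assms by (cases q) auto
  have "(\<Sum>k=2..<i. (c k ^ p / fact p) *\<^sub>R app (ExpRK6s16_a c \<phi> i k) v)
      = (\<Sum>k\<in>sources i. (c k ^ p / fact p) *\<^sub>R app (ExpRK6s16_a c \<phi> i k) v)"
    using sources_subset by (intro sum.mono_neutral_right) (auto simp: ExpRK6s16_a_eq_0)
  also have "\<dots> = app (c i ^ q *\<^sub>R \<phi> q (c i)) v"
    using sum_a_order[OF assms(1) p(2,3), of \<phi>] by (simp add: app_sum_scaleR[symmetric] p(1))
  also have "\<dots> = c i ^ q *\<^sub>R app (\<phi> q (c i)) v"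
    using app_sum_scaleR[of "\<lambda>_. c i ^ q" "\<lambda>_. \<phi> q (c i)" "{()}"] by simp
  finally show ?thesis by (simp add: psi_def p(1))
qed

lemma sum_b_order_app:
  assumes "1 \<le> q" "q \<le> 5"
  shows "(\<Sum>i=2..16. (c i ^ q / fact q) *\<^sub>R app (ExpRK6s16_b c \<phi> i) v) = app (\<phi> (Suc q) 1) v"
proof -
  have "(\<Sum>i=2..16. (c i ^ q / fact q) *\<^sub>R app (ExpRK6s16_b c \<phi> i) v)
      = (\<Sum>i=12..16. (c i ^ q / fact q) *\<^sub>R app (ExpRK6s16_b c \<phi> i) v)"
    by (intro sum.mono_neutral_right) (auto simp: ExpRK6s16_b_eq_0)
  then show ?thesis using sum_b_order[OF assms, of \<phi>] by (simp add: app_sum_scaleR[symmetric])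
qed

text \<open>
  From the outermost sum inwards, the stage index lies in \<open>{12..16}\<close>, then \<open>{8..11}\<close>, \<open>{5, 6, 7}\<close>,
  \<open>{3, 4}\<close>, and a condition with \<open>p\<close> nested sums ends in \<open>\<psi>\<^sub>q\<^sub>,\<^sub>i\<close> with \<open>q + p \<le> 6\<close>, which vanishes on the
  layer reached.  The facts \<open>A2\<close>, \<open>A3\<close> and \<open>A4\<close> collect the inner sums by the depth of the layer on
  which they vanish.
\<close>

lemma stiff_order_conditions_ExpRK6s16:
  assumes JKL: "J 0 = 0" "K 0 = 0" "L 0 = 0" and B: "\<And>v. B 0 v = 0" "\<And>v. B v 0 = 0"
  shows "stiff_order_conditions 16 c (\<lambda>q t. app (\<phi> q t)) (\<lambda>i j. app (ExpRK6s16_a c \<phi> i j))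
           (\<lambda>i. app (ExpRK6s16_b c \<phi> i)) J K L B"
proof -
  let ?a = "\<lambda>i j. app (ExpRK6s16_a c \<phi> i j)" and ?b = "\<lambda>i. app (ExpRK6s16_b c \<phi> i)"
  define \<psi> where "\<psi> = psi c (\<lambda>q t. app (\<phi> q t)) ?a"
  have \<psi>: "3 \<le> i \<Longrightarrow> i \<le> 16 \<Longrightarrow> \<psi> 2 i v = 0" "5 \<le> i \<Longrightarrow> i \<le> 16 \<Longrightarrow> \<psi> 3 i v = 0"
    "8 \<le> i \<Longrightarrow> i \<le> 16 \<Longrightarrow> \<psi> 4 i v = 0" "12 \<le> i \<Longrightarrow> i \<le> 16 \<Longrightarrow> \<psi> 5 i v = 0" for i v
    unfolding \<psi>_def by (intro psi_ExpRK6s16_eq_0; force simp: sources_def)+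
  have b: "(\<Sum>i=2..16. r i *\<^sub>R ?b i (w i)) = 0" if "\<And>i. 12 \<le> i \<Longrightarrow> i \<le> 16 \<Longrightarrow> w i = 0" for r w
    using that by (intro sum.neutral ballI) (metis ExpRK6s16_b_eq_0 app_0 atLeastAtMost_iff scaleR_zero_right)
  have a: "(\<Sum>j=2..<i. r j *\<^sub>R ?a i j (w j)) = 0"
    if "\<And>j. j \<in> sources i \<Longrightarrow> w j = 0" for r w i
    using that by (intro sum.neutral ballI) (metis ExpRK6s16_a_eq_0 app_0 scaleR_zero_right)
  note b1 = b[where r = "\<lambda>_. 1", simplified] and a1 = a[where r = "\<lambda>_. 1", simplified]
  have A2: "(\<Sum>j=2..<i. ?a i j (J (\<psi> 2 j v))) = 0"
    "(\<Sum>j=2..<i. c j *\<^sub>R ?a i j (K (\<psi> 2 j v))) = 0"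
    "(\<Sum>j=2..<i. (c j)\<^sup>2 *\<^sub>R ?a i j (L (\<psi> 2 j v))) = 0"
    "(\<Sum>j=2..<i. ?a i j (B (\<psi> 2 j v) (\<psi> 2 j w))) = 0" if "5 \<le> i" "i \<le> 16" for i v w
    by (intro a a1; use that in \<open>force simp: \<psi> JKL B sources_def split: if_splits\<close>)+
  have A3: "(\<Sum>j=2..<i. ?a i j (J (\<psi> 3 j v))) = 0"
    "(\<Sum>j=2..<i. c j *\<^sub>R ?a i j (K (\<psi> 3 j v))) = 0"
    "(\<Sum>j=2..<i. ?a i j (J (\<Sum>k=2..<j. ?a j k (J (\<psi> 2 k v))))) = 0"
    "(\<Sum>j=2..<i. ?a i j (J (\<Sum>k=2..<j. c k *\<^sub>R ?a j k (K (\<psi> 2 k v))))) = 0"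
    "(\<Sum>j=2..<i. c j *\<^sub>R ?a i j (K (\<Sum>k=2..<j. ?a j k (J (\<psi> 2 k v))))) = 0"
    if "8 \<le> i" "i \<le> 16" for i v
    by (intro a a1; use that in \<open>force simp: \<psi> A2 JKL B sources_def split: if_splits\<close>)+
  have A4: "(\<Sum>j=2..<i. ?a i j (J (\<psi> 4 j v))) = 0"
    "(\<Sum>j=2..<i. ?a i j (J (\<Sum>k=2..<j. ?a j k (J (\<psi> 3 k v))))) = 0"
    "(\<Sum>j=2..<i. ?a i j (J (\<Sum>k=2..<j. ?a j k (J (\<Sum>l=2..<k. ?a k l (J (\<psi> 2 l v))))))) = 0"
    if "12 \<le> i" "i \<le> 16" for i v
    by (intro a a1; use that in \<open>force simp: \<psi> A3 JKL B sources_def split: if_splits\<close>)+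
  note zero = \<psi> A2 A3 A4 JKL B
  have q2: "(\<Sum>i=2..16. c i *\<^sub>R ?b i v) = app (\<phi> 2 1) v" for v
    using sum_b_order_app[of 1] by (simp add: numeral_2_eq_2)
  note q = sum_b_order_app[of 2] sum_b_order_app[of 3] sum_b_order_app[of 4] sum_b_order_app[of 5]
  show ?thesis
    unfolding stiff_order_conditions_def stiff_order_2_def stiff_order_3_def stiff_order_4_def
      stiff_order_5_def stiff_order_6_def Let_def \<psi>_def[symmetric]
    apply (intro conjI allI)
    using q q2 apply (simp_all del: fact_numeral)
    apply ((intro b b1; simp add: zero)+)
    done
qed

end

end

lemma bilinear_matrix_vector_mult:
  "bilinear ((*v) :: 'f::real_normed_field ^ 'n ^ 'n \<Rightarrow> 'f ^ 'n \<Rightarrow> 'f ^ 'n)"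
  unfolding bilinear_def
proof (intro conjI allI linearI)
  fix x :: "'f ^ 'n ^ 'n" and y z :: "'f ^ 'n" and r :: real
  show "x *v (y + z) = x *v y + x *v z" by (rule matrix_vector_right_distrib)
  show "x *v (r *\<^sub>R y) = r *\<^sub>R (x *v y)"
    by (simp add: vec_eq_iff matrix_vector_mult_def scaleR_sum_right)
next
  fix x w :: "'f ^ 'n ^ 'n" and y :: "'f ^ 'n" and r :: real
  show "(x + w) *v y = x *v y + w *v y" by (rule matrix_vector_mult_add_rdistrib)
  show "(r *\<^sub>R x) *v y = r *\<^sub>R (x *v y)"
    by (simp add: vec_eq_iff matrix_vector_mult_def scaleR_sum_right)
qed

lemma bilinear_blinfun_apply:
  "bilinear (blinfun_apply :: ('x::real_normed_vector \<Rightarrow>\<^sub>L 'y::real_normed_vector) \<Rightarrow> 'x \<Rightarrow> 'y)"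
  unfolding bilinear_def
  by (auto intro!: linearI simp: blinfun.bilinear_simps)


section \<open>Strongly continuous semigroups and their \<open>\<phi>\<close>-operators\<close>

text \<open>
  The Banach--Steinhaus theorem.  By Baire's theorem one of the closed sets \<open>A n\<close>, on which the whole
  family is bounded by \<open>n\<close>, contains a ball, and linearity moves the ball to the origin.
\<close>

lemma uniform_boundedness:
  fixes F :: "('a::banach \<Rightarrow>\<^sub>L 'b::real_normed_vector) set"
  assumes "\<And>x. bounded ((\<lambda>f. blinfun_apply f x) ` F)"
  shows "bounded F"
proof -
  define A where "A n = {x. \<forall>f\<in>F. norm (blinfun_apply f x) \<le> real n}" for n
  have closed: "closed (A n)" for n
  proof -
    have "A n = (\<Inter>f\<in>F. {x. norm (blinfun_apply f x) \<le> real n})" by (auto simp: A_def)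
    then show ?thesis by (auto intro!: closed_INT closed_Collect_le continuous_intros)
  qed
  have UN: "(\<Union>n. A n) = UNIV"
  proof (rule set_eqI, simp)
    fix x
    obtain b where "\<forall>f\<in>F. norm (blinfun_apply f x) \<le> b" using assms[of x] by (auto simp: bounded_iff)
    moreover obtain n where "b \<le> real n" using real_arch_simple by blast
    ultimately have "x \<in> A n" by (force simp: A_def)
    then show "\<exists>n. x \<in> A n" ..
  qed
  have "\<exists>n. interior (A n) \<noteq> {}"
  proof (rule ccontr)
    assume contra: "\<not> ?thesis"
    have "Met_TC.mtopology interior_of \<Union>(range A) = {}"
    proof (rule Met_TC.metric_Baire_category_alt)
      show "Met_TC.mcomplete TYPE('a)" by (simp add: complete_UNIV)
      show "closedin Met_TC.mtopology X \<and> Met_TC.mtopology interior_of X = {}" if "X \<in> range A" for X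
        using that closed contra by auto
    qed auto
    then show False using UN by simp
  qed
  then obtain n x r where r: "r > 0" "cball x r \<subseteq> A n"
    by (metis all_not_in_conv mem_interior_cball)
  have "norm f \<le> 2 * real n / r" if f: "f \<in> F" for f
  proof (rule norm_blinfun_bound)
    show "norm (blinfun_apply f y) \<le> 2 * real n / r * norm y" for y
    proof (cases "y = 0")
      case False
      define z where "z = (r / norm y) *\<^sub>R y"
      have "norm z = r" using False r by (simp add: z_def)
      then have "x + z \<in> A n" "x \<in> A n" using r by (auto simp: dist_norm)
      then have "norm (blinfun_apply f (x + z)) \<le> n" "norm (blinfun_apply f x) \<le> n"
        using f by (auto simp: A_def)
      then have "norm (blinfun_apply f z) \<le> 2 * real n"
        using norm_triangle_ineq4[of "blinfun_apply f (x + z)" "blinfun_apply f x"]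
        by (simp add: blinfun.add_right)
      then show ?thesis using False r by (simp add: z_def blinfun.scaleR_right field_simps)
    qed simp
  qed (use r in simp)
  then show ?thesis unfolding bounded_iff by blast
qed

lemma has_vector_derivative_iff_quotient:
  "(f has_vector_derivative D) (at x within A) \<longleftrightarrow>
     ((\<lambda>y. (f y - f x) /\<^sub>R (y - x)) \<longlongrightarrow> D) (at x within A)"
proof -
  have "(f has_vector_derivative D) (at x within A) \<longleftrightarrow>
      ((\<lambda>y. norm ((f y - f x) - (y - x) *\<^sub>R D) / norm (y - x)) \<longlongrightarrow> 0) (at x within A)"
    by (simp add: has_vector_derivative_def has_derivative_iff_norm bounded_linear_scaleR_left)
  also have "\<dots> \<longleftrightarrow> ((\<lambda>y. norm ((f y - f x) /\<^sub>R (y - x) - D)) \<longlongrightarrow> 0) (at x within A)"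
  proof (rule tendsto_cong)
    show "\<forall>\<^sub>F y in at x within A. norm ((f y - f x) - (y - x) *\<^sub>R D) / norm (y - x)
        = norm ((f y - f x) /\<^sub>R (y - x) - D)"
      unfolding eventually_at_filter
    proof (intro always_eventually allI impI)
      fix y assume "y \<noteq> x"
      then have "(f y - f x) /\<^sub>R (y - x) - D = ((f y - f x) - (y - x) *\<^sub>R D) /\<^sub>R (y - x)"
        by (simp add: scaleR_diff_right)
      then show "norm ((f y - f x) - (y - x) *\<^sub>R D) / norm (y - x) = norm ((f y - f x) /\<^sub>R (y - x) - D)"
        by (simp add: divide_inverse)
    qed
  qed
  also have "\<dots> \<longleftrightarrow> ((\<lambda>y. (f y - f x) /\<^sub>R (y - x)) \<longlongrightarrow> D) (at x within A)"
    by (simp add: tendsto_norm_zero_iff LIM_zero_iff)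
  finally show ?thesis .
qed

lemma bounded_linear_integral:
  fixes f :: "real \<Rightarrow> 'b::real_normed_vector \<Rightarrow> 'c::banach"
  assumes lin: "\<And>t. t \<in> {a..b} \<Longrightarrow> bounded_linear (f t)"
    and bd: "\<And>t v. t \<in> {a..b} \<Longrightarrow> norm (f t v) \<le> M * norm v" "0 \<le> M"
    and int: "\<And>v. (\<lambda>t. f t v) integrable_on {a..b}"
  shows "bounded_linear (\<lambda>v. integral {a..b} (\<lambda>t. f t v))"
proof (rule bounded_linear_intro)
  show "integral {a..b} (\<lambda>t. f t (x + y)) = integral {a..b} (\<lambda>t. f t x) + integral {a..b} (\<lambda>t. f t y)" for x y
    unfolding integral_add[OF int int, symmetric]
    by (intro integral_cong) (simp add: linear_simps[OF lin])
  show "integral {a..b} (\<lambda>t. f t (r *\<^sub>R x)) = r *\<^sub>R integral {a..b} (\<lambda>t. f t x)" for r x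
    unfolding integral_cmul[symmetric]
    by (intro integral_cong) (simp add: linear_simps[OF lin])
  show "norm (integral {a..b} (\<lambda>t. f t x)) \<le> norm x * (M * measure lborel {a..b})" for x
    using has_integral_bound_real[of "M * norm x" "{}" "\<lambda>t. f t x", OF _ _ integrable_integral[OF int]]
      bd by (simp add: mult_ac)
qed

locale strongly_continuous_semigroup =
  fixes T :: "real \<Rightarrow> 'a::banach \<Rightarrow>\<^sub>L 'a"
  assumes C0: "C0_semigroup T"
begin

abbreviation S :: "real \<Rightarrow> 'a \<Rightarrow> 'a" where "S t x \<equiv> blinfun_apply (T t) x"

lemma S_0 [simp]: "S 0 x = x"
  using C0 by (simp add: C0_semigroup_def)

lemma T_add: "0 \<le> s \<Longrightarrow> 0 \<le> t \<Longrightarrow> T (s + t) = T s o\<^sub>L T t"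
  using C0 by (simp add: C0_semigroup_def)

lemma S_add: "0 \<le> s \<Longrightarrow> 0 \<le> t \<Longrightarrow> S (s + t) x = S s (S t x)"
  by (simp add: T_add)

lemma S_commute: "0 \<le> s \<Longrightarrow> 0 \<le> t \<Longrightarrow> S s (S t x) = S t (S s x)"
  by (metis S_add add.commute)

lemma S_tendsto_at_0: "((\<lambda>t. S t x) \<longlongrightarrow> x) (at_right 0)"
  using C0 by (simp add: C0_semigroup_def)

text \<open>
  Otherwise there are times \<open>\<tau> n\<close> tending to \<open>0\<close> along which the operator norms are unbounded, while
  all orbits converge; this contradicts uniform boundedness.
\<close>

lemma bounded_near_0: "\<exists>d>0. \<exists>M\<ge>1. \<forall>t\<in>{0..d}. norm (T t) \<le> M"
proof (rule ccontr)
  assume contra: "\<not> ?thesis"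
  have "\<exists>t. 0 < t \<and> t \<le> 1 / Suc n \<and> real (Suc n) < norm (T t)" for n
  proof -
    obtain t where t: "t \<in> {0..1 / Suc n}" "\<not> norm (T t) \<le> real (Suc n)"
      using contra
      by (metis of_nat_0_less_iff of_nat_1 of_nat_mono plus_1_eq_Suc le_add1 zero_less_Suc zero_less_divide_1_iff)
    moreover have "t \<noteq> 0"
    proof
      assume "t = 0"
      then have "norm (T t) \<le> 1" using C0 by (simp add: C0_semigroup_def norm_blinfun_id_le)
      then show False using t by simp
    qed
    ultimately show ?thesis by (intro exI[of _ t]) auto
  qed
  then obtain \<tau> where \<tau>: "\<And>n. 0 < \<tau> n" "\<And>n. \<tau> n \<le> 1 / Suc n" "\<And>n. real (Suc n) < norm (T (\<tau> n))"
    by metis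
  have "\<tau> \<longlonglongrightarrow> 0"
  proof (rule tendsto_sandwich[of "\<lambda>_. 0" _ _ "\<lambda>n. 1 / real (Suc n)"])
    show "(\<lambda>n. 1 / real (Suc n)) \<longlonglongrightarrow> 0" by (rule LIMSEQ_Suc[OF lim_1_over_n])
  qed (use \<tau> in \<open>auto intro!: always_eventually less_imp_le[OF \<tau>(1)] simp del: of_nat_Suc\<close>)
  then have lim: "filterlim \<tau> (at_right 0) sequentially"
    by (simp add: filterlim_at \<tau>(1) always_eventually less_imp_neq[OF \<tau>(1), symmetric])
  have "bounded (range (\<lambda>n. T (\<tau> n)))"
  proof (rule uniform_boundedness)
    fix x
    have "(\<lambda>n. S (\<tau> n) x) \<longlonglongrightarrow> x"
      by (rule filterlim_compose[OF S_tendsto_at_0 lim])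
    then have "bounded (range (\<lambda>n. S (\<tau> n) x))"
      using convergent_imp_bounded by blast
    then show "bounded ((\<lambda>f. blinfun_apply f x) ` range (\<lambda>n. T (\<tau> n)))"
      by (simp add: image_image)
  qed
  then obtain B where "\<And>n. norm (T (\<tau> n)) \<le> B" by (auto simp: bounded_iff)
  moreover obtain n where "B < real n" using reals_Archimedean2 by blast
  ultimately show False using \<tau>(3)[of n] by (smt (verit) of_nat_Suc)
qed

lemma bounded_on_interval: "\<exists>M\<ge>1. \<forall>t\<in>{0..R}. norm (T t) \<le> M"
proof -
  obtain d M where d: "d > 0" and M: "M \<ge> 1" "\<And>t. t \<in> {0..d} \<Longrightarrow> norm (T t) \<le> M"
    using bounded_near_0 by blast
  \<comment> \<open>The bound on \<open>[0, d]\<close> is extended step by step with the semigroup law.\<close>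
  have *: "\<forall>t\<in>{0..real n * d}. norm (T t) \<le> M ^ Suc n" for n
  proof (induction n)
    case 0
    then show ?case using M(2)[of 0] d by auto
  next
    case (Suc n)
    show ?case
    proof
      fix t assume t: "t \<in> {0..real (Suc n) * d}"
      show "norm (T t) \<le> M ^ Suc (Suc n)"
      proof (cases "t \<le> d")
        case True
        then have "norm (T t) \<le> M ^ 1" using M t by simp
        also have "\<dots> \<le> M ^ Suc (Suc n)" using M(1) by (intro power_increasing) auto
        finally show ?thesis .
      next
        case False
        then have "norm (T t) \<le> norm (T d) * norm (T (t - d))"
          using T_add[of d "t - d"] d norm_blinfun_compose[of "T d" "T (t - d)"] by simp
        also have "\<dots> \<le> M * M ^ Suc n"
          using M t d False Suc by (intro mult_mono) (auto simp: algebra_simps)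
        finally show ?thesis by simp
      qed
    qed
  qed
  obtain n where "R < real n * d" using d reals_Archimedean3 by blast
  then have "\<forall>t\<in>{0..R}. norm (T t) \<le> M ^ Suc n" using *[of n] by auto
  moreover have "M ^ Suc n \<ge> 1" using M(1) one_le_power by blast
  ultimately show ?thesis by blast
qed

lemma continuous_on_orbit: "continuous_on {0..} (\<lambda>t. S t x)"
proof -
      have "((\<lambda>t. S t x) \<longlongrightarrow> S t x) (at t within {0..})" if t: "0 \<le> t" for t
  proof -
    obtain M where M: "M \<ge> 1" "\<And>t'. t' \<in> {0..t + 1} \<Longrightarrow> norm (T t') \<le> M"
      using bounded_on_interval[of "t + 1"] by auto
    have small: "((\<lambda>s. S s x - x) \<longlongrightarrow> 0) (at 0 within {0..})"
      using S_tendsto_at_0[of x] LIM_zero at_within_Ici_at_right by metis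
    have abs: "filterlim (\<lambda>t'. \<bar>t' - t\<bar>) (at 0 within {0..}) (at t within {0..})"
      by (auto simp: filterlim_at eventually_at_filter intro!: tendsto_eq_intros)
    have "((\<lambda>t'. M * norm (S \<bar>t' - t\<bar> x - x)) \<longlongrightarrow> 0) (at t within {0..})"
      using tendsto_mult_right_zero[OF tendsto_norm_zero[OF filterlim_compose[OF small abs]]] .
    moreover have "\<forall>\<^sub>F t' in at t within {0..}. norm (S t' x - S t x) \<le> M * norm (S \<bar>t' - t\<bar> x - x)"
    proof -
      have "norm (S t' x - S t x) \<le> M * norm (S \<bar>t' - t\<bar> x - x)" if "0 \<le> t'" "t' < t + 1" for t'
      proof -
        define m where "m = min t t'"
        have m: "0 \<le> m" "m \<le> t + 1" using that t by (auto simp: m_def)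
        have "norm (S t' x - S t x) = norm (S m (S \<bar>t' - t\<bar> x - x))"
        proof (cases "t \<le> t'")
          case True
          then have "S t' x = S m (S \<bar>t' - t\<bar> x)" using t by (simp add: m_def S_add[symmetric])
          then show ?thesis using True by (simp add: m_def blinfun.diff_right)
        next
          case False
          then have "S t x = S m (S \<bar>t' - t\<bar> x)" using that by (simp add: m_def S_add[symmetric])
          then show ?thesis using False by (simp add: m_def blinfun.diff_right norm_minus_commute)
        qed
        also have "\<dots> \<le> norm (T m) * norm (S \<bar>t' - t\<bar> x - x)" by (rule norm_blinfun)
        also have "\<dots> \<le> M * norm (S \<bar>t' - t\<bar> x - x)" using M m by (intro mult_right_mono) auto
        finally show ?thesis .
      qed
      then show ?thesis unfolding eventually_at by (intro exI[of _ 1]) (auto simp: dist_real_def)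
    qed
    ultimately have "((\<lambda>t'. S t' x - S t x) \<longlongrightarrow> 0) (at t within {0..})"
      by (rule Lim_null_comparison[rotated])
    then show ?thesis using Lim_null by blast
  qed
  then show ?thesis by (auto simp: continuous_on_def)
qed

text \<open>
  Joint continuity of \<open>(t, x) \<mapsto> T t x\<close>, from strong continuity and local boundedness.
\<close>

lemma tendsto_S:
  assumes f: "(f \<longlongrightarrow> l) F" "\<forall>\<^sub>F a in F. 0 \<le> f a" "0 \<le> l" and g: "(g \<longlongrightarrow> m) F"
  shows "((\<lambda>a. S (f a) (g a)) \<longlongrightarrow> S l m) F"
proof -
  obtain M where M: "\<And>t. t \<in> {0..l + 1} \<Longrightarrow> norm (T t) \<le> M"
    using bounded_on_interval[of "l + 1"] by meson
  have 1: "((\<lambda>a. S (f a) m) \<longlongrightarrow> S l m) F"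
    using continuous_on_tendsto_compose[OF continuous_on_orbit f(1)] f by auto
  have "\<forall>\<^sub>F a in F. f a < l + 1"
    using f(1) by (rule order_tendstoD) simp
  with f(2) have "\<forall>\<^sub>F a in F. norm (S (f a) (g a - m)) \<le> M * norm (g a - m)"
  proof eventually_elim
    case (elim a)
    then have "norm (T (f a)) \<le> M" by (intro M) auto
    then show ?case by (meson mult_right_mono norm_blinfun norm_ge_zero order_trans)
  qed
  moreover have "((\<lambda>a. M * norm (g a - m)) \<longlongrightarrow> 0) F"
    using g by (auto intro!: tendsto_eq_intros)
  ultimately have 2: "((\<lambda>a. S (f a) (g a - m)) \<longlongrightarrow> 0) F"
    by (rule Lim_null_comparison)
  show ?thesis using tendsto_add[OF 1 2] by (simp add: blinfun.diff_right)
qed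

lemma continuous_on_S [continuous_intros]:
  assumes "continuous_on A f" "continuous_on A g" "\<And>a. a \<in> A \<Longrightarrow> 0 \<le> f a"
  shows "continuous_on A (\<lambda>a. S (f a) (g a))"
  using assms unfolding continuous_on_def
  by (auto intro!: tendsto_S simp: eventually_at_filter)

text \<open>
  The integrated semigroup.  Its bounded operators encode the generator by
  \<open>T s x - x = G s (A x)\<close>, a form that passes to limits and derivatives in \<open>x\<close>.
\<close>

definition G :: "real \<Rightarrow> 'a \<Rightarrow> 'a" where
  "G s v = integral {0..s} (\<lambda>r. S r v)"

lemma S_integrable: "0 \<le> a \<Longrightarrow> (\<lambda>r. S r v) integrable_on {a..b}"
  by (intro integrable_continuous_real continuous_intros) auto

lemma blinfun_integral_S:
  assumes "0 \<le> a"
  shows "blinfun_apply L (integral {a..b} (\<lambda>r. S r v)) = integral {a..b} (\<lambda>r. blinfun_apply L (S r v))"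
proof -
  have "integral {a..b} (blinfun_apply L \<circ> (\<lambda>r. S r v)) = blinfun_apply L (integral {a..b} (\<lambda>r. S r v))"
    by (rule integral_linear[OF S_integrable[OF assms] blinfun.bounded_linear_right])
  then show ?thesis by (simp add: o_def)
qed

lemma bounded_linear_G: "bounded_linear (G s)"
proof -
  obtain M where M: "M \<ge> 1" "\<And>t. t \<in> {0..s} \<Longrightarrow> norm (T t) \<le> M"
    using bounded_on_interval by blast
  show ?thesis unfolding G_def
  proof (rule bounded_linear_integral)
    show "norm (S t v) \<le> M * norm v" if "t \<in> {0..s}" for t v
      using M(2)[OF that] by (meson mult_right_mono norm_blinfun norm_ge_zero order_trans)
  qed (use M in \<open>auto intro: S_integrable blinfun.bounded_linear_right\<close>)
qed

lemma G_S_commute: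
  assumes "0 \<le> s"
  shows "G r (S s v) = S s (G r v)"
proof -
  have "G r (S s v) = integral {0..r} (\<lambda>t. S s (S t v))"
    unfolding G_def using assms by (intro integral_cong) (simp add: S_commute)
  then show ?thesis by (simp add: G_def blinfun_integral_S)
qed

text \<open>
  Both sides are \<open>\<integral>\<close> of the orbit of \<open>v\<close> over \<open>[r, r + s]\<close> minus that over \<open>[0, s]\<close>.  The identity
  says that \<open>G s v\<close> lies in the domain of the generator and is mapped to \<open>T s v - v\<close>.
\<close>

lemma S_G:
  assumes "0 \<le> r" "0 \<le> s"
  shows "S r (G s v) - G s v = G r (S s v - v)"
proof -
  have shift: "S a (G b v) = G (a + b) v - G a v" if "0 \<le> a" "0 \<le> b" for a b
  proof -
    have "S a (G b v) = integral {0..b} (\<lambda>t. S a (S t v))"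
      unfolding G_def by (simp add: blinfun_integral_S)
    also have "\<dots> = integral {0..b} (\<lambda>t. S (t + a) v)"
      using that by (intro integral_cong) (auto simp: S_add[symmetric] add.commute)
    also have "\<dots> = integral {a..a + b} (\<lambda>t. S t v)"
      using integral_shift_real_ivl[of a a "a + b" "\<lambda>t. S t v"] by simp
    also have "\<dots> = G (a + b) v - G a v"
      using Henstock_Kurzweil_Integration.integral_combine[where a = 0 and c = a and b = "a + b" and f = "\<lambda>t. S t v"] S_integrable[where a = 0 and b = "a + b" and v = v] that
      by (simp add: G_def algebra_simps)
    finally show ?thesis .
  qed
  show ?thesis
    using shift[OF assms] shift[OF assms(2,1)] G_S_commute[OF assms(2), of r v]
    unfolding linear_simps(2)[OF bounded_linear_G]
    by (simp add: algebra_simps)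
qed

lemma G_has_vector_derivative:
  assumes "t \<in> {0..R}"
  shows "((\<lambda>s. G s v) has_vector_derivative S t v) (at t within {0..R})"
  unfolding G_def
  by (rule integral_has_vector_derivative)
     (use assms in \<open>auto intro!: continuous_on_S continuous_on_id continuous_on_const\<close>)

lemma G_tendsto: "((\<lambda>s. G s v /\<^sub>R s) \<longlongrightarrow> v) (at_right 0)"
proof -
  have "((\<lambda>s. G s v) has_vector_derivative v) (at 0 within {0..1})"
    using G_has_vector_derivative[of 0 1 v] by simp
  moreover have "G 0 v = 0" by (simp add: G_def)
  ultimately show ?thesis
    by (simp add: has_vector_derivative_iff_quotient at_within_Icc_at_right)
qed

text \<open>
  The graph of the generator in integrated form, see \<open>generator_imp_in_graph\<close> and
  \<open>in_graph_imp_generator\<close>.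
\<close>

definition in_graph :: "'a \<Rightarrow> 'a \<Rightarrow> bool" where
  "in_graph x y \<longleftrightarrow> (\<forall>s\<ge>0. S s x - x = G s y)"

lemma in_graph_G: "0 \<le> s \<Longrightarrow> in_graph (G s v) (S s v - v)"
  by (simp add: in_graph_def S_G)

text \<open>
  The quotient \<open>G t (T s x - x) / t\<close> is computed in two ways as \<open>t \<rightarrow> 0\<close>: it tends to \<open>T s x - x\<close>, and
  it equals \<open>G s ((T t x - x) / t)\<close>, which tends to \<open>G s (A x)\<close> because \<open>G s\<close> is bounded.
\<close>

lemma generator_imp_in_graph:
  assumes "generator D A T" "x \<in> D"
  shows "in_graph x (A x)"
  unfolding in_graph_def
proof (intro allI impI)
  fix s :: real assume s: "0 \<le> s"
  have lim: "((\<lambda>t. (S t x - x) /\<^sub>R t) \<longlongrightarrow> A x) (at_right 0)"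
    using assms by (simp add: generator_def)
  have "((\<lambda>t. G s ((S t x - x) /\<^sub>R t)) \<longlongrightarrow> G s (A x)) (at_right 0)"
    by (rule bounded_linear.tendsto[OF bounded_linear_G lim])
  moreover have "\<forall>\<^sub>F t in at_right 0. G s ((S t x - x) /\<^sub>R t) = G t (S s x - x) /\<^sub>R t"
    unfolding eventually_at_filter
  proof (intro always_eventually allI impI)
    fix t :: real assume "t \<in> {0<..}"
    then have "G s (S t x - x) = G t (S s x - x)"
      using S_G[of t s x] G_S_commute[of t s x] s linear_simps(2)[OF bounded_linear_G] by simp
    then show "G s ((S t x - x) /\<^sub>R t) = G t (S s x - x) /\<^sub>R t"
      by (simp add: linear_simps[OF bounded_linear_G])
  qed
  ultimately have "((\<lambda>t. G t (S s x - x) /\<^sub>R t) \<longlongrightarrow> G s (A x)) (at_right 0)"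
    by (rule Lim_transform_eventually)
  then show "S s x - x = G s (A x)"
    using G_tendsto tendsto_unique[OF trivial_limit_at_right_real] by blast
qed

lemma in_graph_imp_generator:
  assumes "generator D A T" "in_graph x y"
  shows "x \<in> D \<and> A x = y"
proof -
  have "\<forall>\<^sub>F t in at_right 0. G t y /\<^sub>R t = (S t x - x) /\<^sub>R t"
    using assms(2) by (auto simp: eventually_at_filter in_graph_def)
  then have lim: "((\<lambda>t. (S t x - x) /\<^sub>R t) \<longlongrightarrow> y) (at_right 0)"
    by (rule Lim_transform_eventually[OF G_tendsto])
  then have "x \<in> D" using assms(1) by (auto simp: generator_def)
  moreover from this have "((\<lambda>t. (S t x - x) /\<^sub>R t) \<longlongrightarrow> A x) (at_right 0)"
    using assms(1) by (auto simp: generator_def)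
  ultimately show ?thesis using lim tendsto_unique[OF trivial_limit_at_right_real] by blast
qed

lemma in_graph_add: "in_graph x y \<Longrightarrow> in_graph x' y' \<Longrightarrow> in_graph (x + x') (y + y')"
  by (auto simp: in_graph_def blinfun.add_right linear_simps[OF bounded_linear_G] algebra_simps)

lemma in_graph_scaleR: "in_graph x y \<Longrightarrow> in_graph (r *\<^sub>R x) (r *\<^sub>R y)"
  by (auto simp: in_graph_def blinfun.scaleR_right linear_simps[OF bounded_linear_G] scaleR_diff_right[symmetric])

lemma in_graph_S: "0 \<le> r \<Longrightarrow> in_graph x y \<Longrightarrow> in_graph (S r x) (S r y)"
  by (auto simp: in_graph_def G_S_commute S_commute[of _ r] blinfun.diff_right[symmetric])

lemma in_graph_0: "in_graph 0 0"
  by (simp add: in_graph_def linear_simps[OF bounded_linear_G])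

lemma in_graph_orbit_derivative:
  assumes "in_graph x y" "t \<in> {0..R}"
  shows "((\<lambda>s. S s x) has_vector_derivative S t y) (at t within {0..R})"
proof (rule has_vector_derivative_transform[OF assms(2)])
  show "((\<lambda>s. x + G s y) has_vector_derivative S t y) (at t within {0..R})"
    using has_vector_derivative_add[OF has_vector_derivative_const G_has_vector_derivative[OF assms(2)]]
    by simp
qed (use assms(1) in \<open>auto simp: in_graph_def algebra_simps\<close>)

abbreviation phi :: "nat \<Rightarrow> real \<Rightarrow> 'a \<Rightarrow>\<^sub>L 'a" where "phi \<equiv> phi_semigroup T"

lemma phi_integrand_integrable:
  assumes "0 \<le> \<tau>"
  shows "(\<lambda>\<theta>. (\<theta> ^ k / fact k) *\<^sub>R S ((1 - \<theta>) * \<tau>) v) integrable_on {0..1::real}"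
  by (intro integrable_continuous_real continuous_intros) (use assms in auto)

lemma phi_integrand_bound:
  assumes "\<And>t. t \<in> {0..R} \<Longrightarrow> norm (T t) \<le> M" "\<tau> \<in> {0..R}" "\<theta> \<in> {0..1}"
  shows "norm ((\<theta> ^ k / fact k) *\<^sub>R S ((1 - \<theta>) * \<tau>) v) \<le> M * norm v"
proof -
  have "(1 - \<theta>) * \<tau> \<le> 1 * \<tau>" using assms by (intro mult_right_mono) auto
  then have "norm (T ((1 - \<theta>) * \<tau>)) \<le> M" using assms by (intro assms(1)) auto
  then have 1: "norm (S ((1 - \<theta>) * \<tau>) v) \<le> M * norm v"
    by (meson mult_right_mono norm_blinfun norm_ge_zero order_trans)
  have "\<theta> ^ k \<le> 1" using assms by (simp add: power_le_one)
  moreover have "(1::real) \<le> fact k" by (rule fact_ge_1)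
  ultimately have "\<theta> ^ k \<le> fact k" by (rule order_trans)
  then have "\<theta> ^ k / fact k \<le> 1" by (simp add: divide_le_eq)
  then show ?thesis
    using 1 assms(3) mult_mono[of "\<theta> ^ k / fact k" 1 "norm (S ((1 - \<theta>) * \<tau>) v)" "M * norm v"]
    by (simp add: abs_mult)
qed

lemma phi_apply:
  assumes "0 \<le> \<tau>"
  shows "blinfun_apply (phi (Suc k) \<tau>) v = integral {0..1} (\<lambda>\<theta>. (\<theta> ^ k / fact k) *\<^sub>R S ((1 - \<theta>) * \<tau>) v)"
proof -
  obtain M where M: "M \<ge> 1" "\<And>t. t \<in> {0..\<tau>} \<Longrightarrow> norm (T t) \<le> M"
    using bounded_on_interval by meson
  have "bounded_linear (\<lambda>v. integral {0..1} (\<lambda>\<theta>. (\<theta> ^ k / fact k) *\<^sub>R S ((1 - \<theta>) * \<tau>) v))"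
  proof (rule bounded_linear_integral)
    show "norm ((\<theta> ^ k / fact k) *\<^sub>R S ((1 - \<theta>) * \<tau>) v) \<le> M * norm v" if "\<theta> \<in> {0..1}" for \<theta> v
      using phi_integrand_bound[of \<tau> M \<tau>] M(2) assms that by auto
    show "bounded_linear (\<lambda>v. (\<theta> ^ k / fact k) *\<^sub>R S ((1 - \<theta>) * \<tau>) v)" for \<theta> :: real
      by (intro bounded_linear_scaleR_right bounded_linear_compose[OF bounded_linear_scaleR_right] blinfun.bounded_linear_right)
  qed (use M(1) phi_integrand_integrable[OF assms] in auto)
  then show ?thesis
    by (simp add: phi_semigroup_def phi_integral_def bounded_linear_Blinfun_apply)
qed

lemma norm_phi:
  assumes "\<And>t. t \<in> {0..R} \<Longrightarrow> norm (T t) \<le> M" "\<tau> \<in> {0..R}"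
  shows "norm (phi (Suc k) \<tau>) \<le> M"
proof (rule norm_blinfun_bound)
  have "norm (T \<tau>) \<le> M" using assms by simp
  then show M: "0 \<le> M" using norm_ge_zero order_trans by blast
  show "norm (blinfun_apply (phi (Suc k) \<tau>) v) \<le> M * norm v" for v
    using has_integral_bound_real[of "M * norm v" "{}", OF _ _ integrable_integral[OF phi_integrand_integrable]]
      phi_integrand_bound[OF assms] M assms(2) by (simp add: phi_apply)
qed

text \<open>
  The family \<open>\<phi>\<^sub>k(\<tau>A)\<close> completed by \<open>\<phi>\<^sub>0 = exp\<close>, for which the recursion of the \<open>\<phi>\<close>-functions holds
  from \<open>k = 0\<close> on.
\<close>

definition phi0 :: "nat \<Rightarrow> real \<Rightarrow> 'a \<Rightarrow>\<^sub>L 'a" where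
  "phi0 k \<tau> = (if k = 0 then T \<tau> else phi k \<tau>)"

text \<open>
  The recursion \<open>z \<phi>\<^sub>k\<^sub>+\<^sub>1(z) = \<phi>\<^sub>k(z) - 1 / k!\<close> on the domain of the generator: integration by parts of
  \<open>\<theta> ^ k / k!\<close> against the differentiable orbit of \<open>x\<close>.
\<close>

lemma phi_recursion:
  assumes "in_graph x y" "0 \<le> \<tau>"
  shows "\<tau> *\<^sub>R blinfun_apply (phi (Suc k) \<tau>) y = blinfun_apply (phi0 k \<tau>) x - x /\<^sub>R fact k"
proof -
  let ?p = "\<lambda>k \<theta>. \<theta> ^ k / fact k :: real"
  define p' where "p' = (\<lambda>\<theta>::real. if k = 0 then 0 else ?p (k - 1) \<theta>)"
  have p: "(?p k has_real_derivative p' \<theta>) (at \<theta> within {0..1})" for \<theta>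
  proof -
    have "((\<lambda>\<theta>. \<theta> ^ k / fact k) has_real_derivative (real k * \<theta> ^ (k - Suc 0)) / fact k) (at \<theta> within {0..1})"
      by (intro DERIV_cdivide DERIV_pow)
    moreover have "(real k * \<theta> ^ (k - Suc 0)) / fact k = p' \<theta>"
      by (cases k) (simp_all add: p'_def del: of_nat_Suc)
    ultimately show ?thesis by simp
  qed
  have deriv: "((\<lambda>\<theta>. ?p k \<theta> *\<^sub>R S ((1 - \<theta>) * \<tau>) x) has_vector_derivative
      p' \<theta> *\<^sub>R S ((1 - \<theta>) * \<tau>) x - \<tau> *\<^sub>R ?p k \<theta> *\<^sub>R S ((1 - \<theta>) * \<tau>) y) (at \<theta> within {0..1})"
    if \<theta>: "\<theta> \<in> {0..1}" for \<theta>
  proof -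
    have "((\<lambda>s. S s x) \<circ> (\<lambda>\<theta>. (1 - \<theta>) * \<tau>) has_vector_derivative (- \<tau>) *\<^sub>R S ((1 - \<theta>) * \<tau>) y) (at \<theta> within {0..1})"
    proof (rule vector_diff_chain_within)
      show "((\<lambda>\<theta>. (1 - \<theta>) * \<tau>) has_vector_derivative - \<tau>) (at \<theta> within {0..1})"
        by (auto intro!: derivative_eq_intros simp: has_real_derivative_iff_has_vector_derivative[symmetric])
      have "(\<lambda>\<theta>. (1 - \<theta>) * \<tau>) ` {0..1} \<subseteq> {0..\<tau>}"
        using assms(2) by (auto simp: mult_left_le_one_le)
      moreover have "(1 - \<theta>) * \<tau> \<in> {0..\<tau>}" using \<theta> calculation by blast
      ultimately show "((\<lambda>s. S s x) has_vector_derivative S ((1 - \<theta>) * \<tau>) y)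
          (at ((1 - \<theta>) * \<tau>) within (\<lambda>\<theta>. (1 - \<theta>) * \<tau>) ` {0..1})"
        using in_graph_orbit_derivative[OF assms(1)] has_vector_derivative_within_subset by blast
    qed
    from has_vector_derivative_scaleR[OF p[of \<theta>] this] show ?thesis
      by (simp add: o_def algebra_simps)
  qed
  have "((\<lambda>\<theta>. p' \<theta> *\<^sub>R S ((1 - \<theta>) * \<tau>) x - \<tau> *\<^sub>R ?p k \<theta> *\<^sub>R S ((1 - \<theta>) * \<tau>) y)
      has_integral (?p k 1 *\<^sub>R S ((1 - 1) * \<tau>) x - ?p k 0 *\<^sub>R S ((1 - 0) * \<tau>) x)) {0..1}"
    by (rule fundamental_theorem_of_calculus[OF _ deriv]) auto
  moreover have "((\<lambda>\<theta>. p' \<theta> *\<^sub>R S ((1 - \<theta>) * \<tau>) x) has_integral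
      (if k = 0 then 0 else blinfun_apply (phi k \<tau>) x)) {0..1}"
    using integrable_integral[OF phi_integrand_integrable[OF assms(2)], of "k - 1" x] phi_apply[OF assms(2), of "k - 1" x]
    by (auto simp: p'_def)
  moreover have "((\<lambda>\<theta>. \<tau> *\<^sub>R ?p k \<theta> *\<^sub>R S ((1 - \<theta>) * \<tau>) y) has_integral \<tau> *\<^sub>R blinfun_apply (phi (Suc k) \<tau>) y) {0..1}"
    unfolding phi_apply[OF assms(2)]
    by (intro has_integral_cmul integrable_integral phi_integrand_integrable assms)
  ultimately have "?p k 1 *\<^sub>R S ((1 - 1) * \<tau>) x - ?p k 0 *\<^sub>R S ((1 - 0) * \<tau>) x
      = (if k = 0 then 0 else blinfun_apply (phi k \<tau>) x) - \<tau> *\<^sub>R blinfun_apply (phi (Suc k) \<tau>) y"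
    using has_integral_diff has_integral_unique by blast
  then show ?thesis
    by (auto simp: phi0_def divide_inverse power_0_left algebra_simps split: if_splits)
qed

lemma phi0_G_commute:
  assumes "0 \<le> \<tau>"
  shows "blinfun_apply (phi0 k \<tau>) (G s v) = G s (blinfun_apply (phi0 k \<tau>) v)"
proof (cases k)
  case 0
  then show ?thesis using assms by (simp add: phi0_def G_S_commute)
next
  case (Suc m)
  have "G s (integral {0..1} (\<lambda>\<theta>. (\<theta> ^ m / fact m) *\<^sub>R S ((1 - \<theta>) * \<tau>) v))
    = integral {0..1} (\<lambda>\<theta>. (\<theta> ^ m / fact m) *\<^sub>R S ((1 - \<theta>) * \<tau>) (G s v))"
    unfolding integral_linear[OF phi_integrand_integrable[OF assms] bounded_linear_G, symmetric]
    by (intro integral_cong) (use assms in \<open>auto simp: linear_simps[OF bounded_linear_G] G_S_commute\<close>)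
  then show ?thesis using Suc assms by (simp add: phi0_def phi_apply)
qed

lemma phi_S_commute:
  assumes "0 \<le> \<tau>" "0 \<le> s"
  shows "S s (blinfun_apply (phi (Suc k) \<tau>) v) = blinfun_apply (phi (Suc k) \<tau>) (S s v)"
proof -
  have "S s (integral {0..1} (\<lambda>\<theta>. (\<theta> ^ k / fact k) *\<^sub>R S ((1 - \<theta>) * \<tau>) v))
    = integral {0..1} (\<lambda>\<theta>. (\<theta> ^ k / fact k) *\<^sub>R S ((1 - \<theta>) * \<tau>) (S s v))"
    unfolding integral_linear[OF phi_integrand_integrable[OF assms(1)] blinfun.bounded_linear_right, symmetric]
    by (intro integral_cong) (use assms in \<open>auto simp: blinfun.scaleR_right S_commute\<close>)
  then show ?thesis using assms by (simp add: phi_apply)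
qed

text \<open>
  The operators \<open>\<phi>\<^sub>k\<close> with \<open>k \<ge> 1\<close> map into the domain: \<open>T s - 1\<close> commutes with \<open>\<phi>\<^sub>k\<^sub>+\<^sub>1\<close>, and the
  recursion applies to \<open>G s v\<close>, which lies in the domain for every \<open>v\<close>.
\<close>

lemma in_graph_phi:
  assumes "0 < \<tau>"
  shows "in_graph (blinfun_apply (phi (Suc k) \<tau>) v) ((blinfun_apply (phi0 k \<tau>) v - v /\<^sub>R fact k) /\<^sub>R \<tau>)"
  unfolding in_graph_def
proof (intro allI impI)
  fix s :: real assume s: "0 \<le> s"
  have "\<tau> *\<^sub>R (S s (blinfun_apply (phi (Suc k) \<tau>) v) - blinfun_apply (phi (Suc k) \<tau>) v)
      = \<tau> *\<^sub>R blinfun_apply (phi (Suc k) \<tau>) (S s v - v)"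
    using assms s by (simp add: phi_S_commute blinfun.diff_right)
  also have "\<dots> = blinfun_apply (phi0 k \<tau>) (G s v) - G s v /\<^sub>R fact k"
    using phi_recursion[OF in_graph_G[OF s]] assms by simp
  also have "\<dots> = G s (blinfun_apply (phi0 k \<tau>) v - v /\<^sub>R fact k)"
    using assms by (simp add: phi0_G_commute linear_simps[OF bounded_linear_G])
  finally have "(\<tau> *\<^sub>R (S s (blinfun_apply (phi (Suc k) \<tau>) v) - blinfun_apply (phi (Suc k) \<tau>) v)) /\<^sub>R \<tau>
     = G s (blinfun_apply (phi0 k \<tau>) v - v /\<^sub>R fact k) /\<^sub>R \<tau>" by simp
  then show "S s (blinfun_apply (phi (Suc k) \<tau>) v) - blinfun_apply (phi (Suc k) \<tau>) v
      = G s ((blinfun_apply (phi0 k \<tau>) v - v /\<^sub>R fact k) /\<^sub>R \<tau>)"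
    using assms by (simp add: linear_simps[OF bounded_linear_G])
qed

text \<open>
  Duhamel's formula, with the integration variable scaled to \<open>[0, 1]\<close> to match the \<open>\<phi>\<close>-functions: the
  derivative of \<open>T ((1 - \<theta>) h) (u (t + \<theta> h))\<close> loses its two terms containing the generator.
\<close>

lemma variation_of_constants:
  assumes h: "0 \<le> h"
    and graph: "\<And>s. s \<in> {t..t + h} \<Longrightarrow> in_graph (u s) (y s)"
    and u: "\<And>s. s \<in> {t..t + h} \<Longrightarrow> (u has_vector_derivative y s + f s) (at s within {t..t + h})"
  shows "((\<lambda>\<theta>. h *\<^sub>R S ((1 - \<theta>) * h) (f (t + \<theta> * h))) has_integral u (t + h) - S h (u t)) {0..1}"
proof -
  have deriv: "((\<lambda>\<theta>. S ((1 - \<theta>) * h) (u (t + \<theta> * h))) has_vector_derivative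
      h *\<^sub>R S ((1 - \<theta>) * h) (f (t + \<theta> * h))) (at \<theta> within {0..1})" if \<theta>: "\<theta> \<in> {0..1}" for \<theta>
  proof -
    define s where "s = t + \<theta> * h"
    have img: "(\<lambda>\<theta>. t + \<theta> * h) ` {0..1} \<subseteq> {t..t + h}"
      using h by (auto simp: mult_left_le_one_le)
    have s: "s \<in> {t..t + h}" using \<theta> h by (simp add: s_def mult_left_le_one_le)
    have "(u \<circ> (\<lambda>\<theta>. t + \<theta> * h) has_vector_derivative h *\<^sub>R (y s + f s)) (at \<theta> within {0..1})"
    proof (rule vector_diff_chain_within)
      show "((\<lambda>\<theta>. t + \<theta> * h) has_vector_derivative h) (at \<theta> within {0..1})"
        by (auto intro!: derivative_eq_intros simp: has_real_derivative_iff_has_vector_derivative[symmetric])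
      show "(u has_vector_derivative y s + f s) (at (t + \<theta> * h) within (\<lambda>\<theta>. t + \<theta> * h) ` {0..1})"
        using has_vector_derivative_within_subset[OF u[OF s] img] by (simp add: s_def)
    qed
    then have w: "((\<lambda>\<theta>'. (u (t + \<theta>' * h) - u s) /\<^sub>R (\<theta>' - \<theta>)) \<longlongrightarrow> h *\<^sub>R (y s + f s)) (at \<theta> within {0..1})"
      by (simp add: has_vector_derivative_iff_quotient o_def s_def)
    have "((\<lambda>\<theta>'. (1 - \<theta>') * h) \<longlongrightarrow> (1 - \<theta>) * h) (at \<theta> within {0..1})"
      by (intro tendsto_intros)
    then have 1: "((\<lambda>\<theta>'. S ((1 - \<theta>') * h) ((u (t + \<theta>' * h) - u s) /\<^sub>R (\<theta>' - \<theta>))) \<longlongrightarrow>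
        S ((1 - \<theta>) * h) (h *\<^sub>R (y s + f s))) (at \<theta> within {0..1})"
      using w \<theta> h by (intro tendsto_S) (auto simp: eventually_at_filter)
    have "((\<lambda>s. S s (u s')) \<circ> (\<lambda>\<theta>. (1 - \<theta>) * h) has_vector_derivative (- h) *\<^sub>R S ((1 - \<theta>) * h) (y s')) (at \<theta> within {0..1})"
      if "s' \<in> {t..t+h}" for s'
    proof (rule vector_diff_chain_within)
      show "((\<lambda>\<theta>. (1 - \<theta>) * h) has_vector_derivative - h) (at \<theta> within {0..1})"
        by (auto intro!: derivative_eq_intros simp: has_real_derivative_iff_has_vector_derivative[symmetric])
      have "(\<lambda>\<theta>. (1 - \<theta>) * h) ` {0..1} \<subseteq> {0..h}"
        using h by (auto simp: mult_left_le_one_le)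
      moreover have "(1 - \<theta>) * h \<in> {0..h}" using \<theta> calculation by blast
      ultimately show "((\<lambda>s. S s (u s')) has_vector_derivative S ((1 - \<theta>) * h) (y s'))
          (at ((1 - \<theta>) * h) within (\<lambda>\<theta>. (1 - \<theta>) * h) ` {0..1})"
        using in_graph_orbit_derivative[OF graph[OF that]] has_vector_derivative_within_subset by blast
    qed
    from this[OF s] have 2: "((\<lambda>\<theta>'. (S ((1 - \<theta>') * h) (u s) - S ((1 - \<theta>) * h) (u s)) /\<^sub>R (\<theta>' - \<theta>)) \<longlongrightarrow>
        (- h) *\<^sub>R S ((1 - \<theta>) * h) (y s)) (at \<theta> within {0..1})"
      by (simp only: has_vector_derivative_iff_quotient o_def)
    have "S ((1 - \<theta>) * h) (h *\<^sub>R (y s + f s)) + (- h) *\<^sub>R S ((1 - \<theta>) * h) (y s) = h *\<^sub>R S ((1 - \<theta>) * h) (f s)"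
      by (simp add: blinfun.add_right blinfun.scaleR_right scaleR_add_right)
    moreover have "S ((1 - \<theta>') * h) ((u (t + \<theta>' * h) - u s) /\<^sub>R (\<theta>' - \<theta>))
        + (S ((1 - \<theta>') * h) (u s) - S ((1 - \<theta>) * h) (u s)) /\<^sub>R (\<theta>' - \<theta>)
        = (S ((1 - \<theta>') * h) (u (t + \<theta>' * h)) - S ((1 - \<theta>) * h) (u s)) /\<^sub>R (\<theta>' - \<theta>)" for \<theta>'
      by (simp add: blinfun.diff_right blinfun.scaleR_right scaleR_diff_right)
    ultimately show ?thesis
      using tendsto_add[OF 1 2] by (simp only: has_vector_derivative_iff_quotient s_def)
  qed
  show ?thesis
    using fundamental_theorem_of_calculus[OF _ deriv] by simp
qed

end


section \<open>Smooth curves, Taylor expansion and extension\<close>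

lemma continuous_on_of_vector_derivative:
  assumes "\<And>t. t \<in> I \<Longrightarrow> (F has_vector_derivative F' t) (at t within I)"
  shows "continuous_on I F"
  using has_vector_derivative_continuous[OF assms] by (simp add: continuous_on_eq_continuous_within)

text \<open>
  Differentiability of order \<open>m\<close> with bounded derivatives, as a recursive predicate that hides the
  derivatives.  In this form the product and chain rules are proved by induction, without any
  formula for the higher derivatives of a composition.
\<close>

primrec bounded_smooth :: "nat \<Rightarrow> (real \<Rightarrow> 'b::real_normed_vector) \<Rightarrow> real set \<Rightarrow> bool" where
  "bounded_smooth 0 F I \<longleftrightarrow> bounded (F ` I)"
| "bounded_smooth (Suc m) F I \<longleftrightarrow> bounded (F ` I) \<and>
     (\<exists>F'. (\<forall>t\<in>I. (F has_vector_derivative F' t) (at t within I)) \<and> bounded_smooth m F' I)"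

lemma bounded_smooth_Suc_imp: "bounded_smooth (Suc m) F I \<Longrightarrow> bounded_smooth m F I"
proof (induction m arbitrary: F)
  case 0
  then show ?case by simp
next
  case (Suc m)
  then obtain F' where "bounded (F ` I)" "\<forall>t\<in>I. (F has_vector_derivative F' t) (at t within I)"
      "bounded_smooth (Suc m) F' I"
    unfolding bounded_smooth.simps(2)[of "Suc m"] by blast
  then show ?case using Suc.IH[of F'] unfolding bounded_smooth.simps(2)[of m F] by blast
qed

lemma bounded_smooth_add:
  "bounded_smooth m F I \<Longrightarrow> bounded_smooth m G I \<Longrightarrow> bounded_smooth m (\<lambda>t. F t + G t) I"
proof (induction m arbitrary: F G)
  case 0
  then show ?case by (simp add: bounded_plus_comp)
next
  case (Suc m)
  from Suc.prems obtain F' G' where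
    "\<forall>t\<in>I. (F has_vector_derivative F' t) (at t within I)" "bounded_smooth m F' I"
    "\<forall>t\<in>I. (G has_vector_derivative G' t) (at t within I)" "bounded_smooth m G' I" by auto
  then show ?case using Suc
    by (auto intro!: exI[of _ "\<lambda>t. F' t + G' t"] has_vector_derivative_add bounded_plus_comp)
qed

lemma bounded_smooth_bilinear:
  assumes "bounded_bilinear p"
  shows "bounded_smooth m F I \<Longrightarrow> bounded_smooth m G I \<Longrightarrow> bounded_smooth m (\<lambda>t. p (F t) (G t)) I"
proof (induction m arbitrary: F G)
  have bd: "bounded ((\<lambda>t. p (F t) (G t)) ` I)" if FG: "bounded (F ` I)" "bounded (G ` I)" for F G
  proof -
    obtain K where K: "\<And>a b. norm (p a b) \<le> norm a * norm b * K" "K \<ge> 0"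
      using bounded_bilinear.nonneg_bounded[OF assms] by blast
    obtain a b where ab: "\<And>t. t \<in> I \<Longrightarrow> norm (F t) \<le> a" "\<And>t. t \<in> I \<Longrightarrow> norm (G t) \<le> b" "0 < a" "0 < b"
      using FG by (auto simp: bounded_pos)
    have "norm (p (F t) (G t)) \<le> a * b * K" if "t \<in> I" for t
      using K(1)[of "F t" "G t"] mult_mono[OF ab(1,2)[OF that]] K(2) ab(3,4)
      by (smt (verit) mult_right_mono norm_ge_zero)
    then show ?thesis by (auto simp: bounded_iff)
  qed
  {
    case 0
    then show ?case using bd by simp
  next
    case (Suc m)
    from Suc.prems obtain F' G' where FG:
      "\<forall>t\<in>I. (F has_vector_derivative F' t) (at t within I)" "bounded_smooth m F' I"
      "\<forall>t\<in>I. (G has_vector_derivative G' t) (at t within I)" "bounded_smooth m G' I" by auto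
    have "bounded_smooth m (\<lambda>t. p (F t) (G' t) + p (F' t) (G t)) I"
      using FG Suc.prems[THEN bounded_smooth_Suc_imp] by (intro bounded_smooth_add Suc.IH)
    moreover have "\<forall>t\<in>I. ((\<lambda>t. p (F t) (G t)) has_vector_derivative p (F t) (G' t) + p (F' t) (G t)) (at t within I)"
      using FG bounded_bilinear.has_vector_derivative[OF assms] by blast
    ultimately show ?case
      using bd Suc.prems by auto
  }
qed

lemma bounded_smooth_compose:
  assumes G: "\<And>t. t \<in> I \<Longrightarrow> (G has_derivative blinfun_apply (G' (u t))) (at (u t))"
    and "bounded ((\<lambda>t. G (u t)) ` I)" "bounded_smooth m (\<lambda>t. G' (u t)) I" "bounded_smooth (Suc m) u I"
  shows "bounded_smooth (Suc m) (\<lambda>t. G (u t)) I"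
proof -
  obtain u' where u': "\<And>t. t \<in> I \<Longrightarrow> (u has_vector_derivative u' t) (at t within I)" "bounded_smooth m u' I"
    using assms(4) by auto
  have "((\<lambda>t. G (u t)) has_vector_derivative blinfun_apply (G' (u t)) (u' t)) (at t within I)" if "t \<in> I" for t
    using has_derivative_compose[OF u'(1)[OF that, unfolded has_vector_derivative_def] G[OF that]]
    by (simp add: has_vector_derivative_def blinfun.scaleR_right)
  moreover have "bounded_smooth m (\<lambda>t. blinfun_apply (G' (u t)) (u' t)) I"
    using assms(3) u'(2) by (rule bounded_smooth_bilinear[OF bounded_bilinear_blinfun_apply])
  ultimately show ?thesis
    using assms(2) by (auto intro!: exI[of _ "\<lambda>t. blinfun_apply (G' (u t)) (u' t)"])
qed

text \<open>
  The derivatives of \<open>g\<close> are treated from the sixth down to the first: along \<open>u\<close>, the \<open>k\<close>-th one is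
  smooth of order \<open>6 - k\<close>, because its derivative is the next one applied to \<open>u'\<close>.  The six steps are
  written out since the derivatives have six different types.
\<close>

lemma bounded_smooth_compose_six:
  assumes g: "six_times_differentiable_bounded g X" and u: "bounded_smooth 6 u I"
    and uX: "\<And>t. t \<in> I \<Longrightarrow> u t \<in> X" and I: "compact I"
  shows "bounded_smooth 6 (\<lambda>t. g (u t)) I"
proof -
  from g obtain g1 g2 g3 g4 g5 g6 M where "\<forall>x\<in>X.
      (g has_derivative blinfun_apply (g1 x)) (at x) \<and> norm (g1 x) \<le> M \<and>
      (g1 has_derivative blinfun_apply (g2 x)) (at x) \<and> norm (g2 x) \<le> M \<and>
      (g2 has_derivative blinfun_apply (g3 x)) (at x) \<and> norm (g3 x) \<le> M \<and>
      (g3 has_derivative blinfun_apply (g4 x)) (at x) \<and> norm (g4 x) \<le> M \<and>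
      (g4 has_derivative blinfun_apply (g5 x)) (at x) \<and> norm (g5 x) \<le> M \<and>
      (g5 has_derivative blinfun_apply (g6 x)) (at x) \<and> norm (g6 x) \<le> M"
    unfolding six_times_differentiable_bounded_def by (elim exE) (rule that)
  note D = bspec[OF this]
  have d: "\<And>x. x \<in> X \<Longrightarrow> (g has_derivative blinfun_apply (g1 x)) (at x)"
    "\<And>x. x \<in> X \<Longrightarrow> (g1 has_derivative blinfun_apply (g2 x)) (at x)"
    "\<And>x. x \<in> X \<Longrightarrow> (g2 has_derivative blinfun_apply (g3 x)) (at x)"
    "\<And>x. x \<in> X \<Longrightarrow> (g3 has_derivative blinfun_apply (g4 x)) (at x)"
    "\<And>x. x \<in> X \<Longrightarrow> (g4 has_derivative blinfun_apply (g5 x)) (at x)"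
    "\<And>x. x \<in> X \<Longrightarrow> (g5 has_derivative blinfun_apply (g6 x)) (at x)"
    using D by (simp_all only: )
  have b: "\<And>x. x \<in> X \<Longrightarrow> norm (g1 x) \<le> M"
    "\<And>x. x \<in> X \<Longrightarrow> norm (g2 x) \<le> M"
    "\<And>x. x \<in> X \<Longrightarrow> norm (g3 x) \<le> M"
    "\<And>x. x \<in> X \<Longrightarrow> norm (g4 x) \<le> M"
    "\<And>x. x \<in> X \<Longrightarrow> norm (g5 x) \<le> M"
    "\<And>x. x \<in> X \<Longrightarrow> norm (g6 x) \<le> M"
    using D by (simp_all only: )
  have B: "bounded ((\<lambda>t. G (u t)) ` I)" if "\<And>x. x \<in> X \<Longrightarrow> norm (G x) \<le> M" for G :: "'a \<Rightarrow> 'z::real_normed_vector"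
    using that uX by (auto simp: bounded_iff)
  have six: "(6::nat) = Suc (Suc (Suc (Suc (Suc (Suc 0)))))" by simp
  have u6: "bounded_smooth (Suc (Suc (Suc (Suc (Suc (Suc 0)))))) u I"
    using u unfolding six .
  note u5 = bounded_smooth_Suc_imp[OF u6] note u4 = bounded_smooth_Suc_imp[OF u5]
  note u3 = bounded_smooth_Suc_imp[OF u4] note u2 = bounded_smooth_Suc_imp[OF u3]
  note u1 = bounded_smooth_Suc_imp[OF u2]
  have s6: "bounded_smooth 0 (\<lambda>t. g6 (u t)) I" using B[OF b(6)] by simp
  note s5 = bounded_smooth_compose[OF d(6)[OF uX] B[OF b(5)] s6 u1]
  note s4 = bounded_smooth_compose[OF d(5)[OF uX] B[OF b(4)] s5 u2]
  note s3 = bounded_smooth_compose[OF d(4)[OF uX] B[OF b(3)] s4 u3]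
  note s2 = bounded_smooth_compose[OF d(3)[OF uX] B[OF b(2)] s3 u4]
  note s1 = bounded_smooth_compose[OF d(2)[OF uX] B[OF b(1)] s2 u5]
  have "continuous_on I u"
    using u6 continuous_on_of_vector_derivative by (auto simp del: bounded_smooth.simps(1))
  moreover have "continuous_on X g"
    using d(1) has_derivative_continuous continuous_at_imp_continuous_on by blast
  ultimately have "continuous_on I (\<lambda>t. g (u t))"
    using uX continuous_on_compose2 by blast
  then have "bounded ((\<lambda>t. g (u t)) ` I)"
    using I compact_continuous_image compact_imp_bounded by blast
  from bounded_smooth_compose[OF d(1)[OF uX] this s1 u6] show ?thesis
    unfolding six .
qed

text \<open>
  The explicit counterpart of \<open>bounded_smooth\<close>, with named derivatives and a common bound.
\<close>

definition jet :: "nat \<Rightarrow> (nat \<Rightarrow> real \<Rightarrow> 'b::real_normed_vector) \<Rightarrow> real \<Rightarrow> real set \<Rightarrow> bool" where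
  "jet m d M I \<longleftrightarrow> (\<forall>k<m. \<forall>t\<in>I. (d k has_vector_derivative d (Suc k) t) (at t within I)) \<and>
     (\<forall>k\<le>m. \<forall>t\<in>I. norm (d k t) \<le> M)"

lemma jet_imp_bounded_smooth:
  assumes "jet m d M I"
  shows "bounded_smooth m (d 0) I"
proof -
  have "bounded_smooth (m - k) (d k) I" if "k \<le> m" for k
    using that
  proof (induction k rule: inc_induct)
    case base
    then show ?case using assms by (auto simp: jet_def bounded_iff intro!: exI[of _ M])
  next
    case (step k)
    then have "m - k = Suc (m - Suc k)" by simp
    then show ?case using assms step by (auto simp: jet_def bounded_iff intro!: exI[of _ M])
  qed
  from this[of 0] show ?thesis by simp
qed

lemma bounded_smooth_imp_jet:
  "bounded_smooth m F I \<Longrightarrow> \<exists>d M. d 0 = F \<and> jet m d M I"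
proof (induction m arbitrary: F)
  case 0
  then show ?case by (auto simp: jet_def bounded_iff intro: exI[of _ "\<lambda>_. F"])
next
  case (Suc m)
  then obtain F' b where F': "\<forall>t\<in>I. (F has_vector_derivative F' t) (at t within I)"
      "bounded_smooth m F' I" "\<forall>t\<in>I. norm (F t) \<le> b"
    by (auto simp: bounded_iff)
  from Suc.IH[OF F'(2)] obtain d M where d: "d 0 = F'" "jet m d M I" by blast
  define d' where "d' = case_nat F d"
  have "jet (Suc m) d' (max M b) I"
    unfolding jet_def
  proof (intro conjI allI impI ballI)
    fix k t assume k: "k < Suc m" and t: "t \<in> I"
    show "(d' k has_vector_derivative d' (Suc k) t) (at t within I)"
      using k t F' d by (cases k) (auto simp: d'_def jet_def)
  next
    fix k t assume k: "k \<le> Suc m" and t: "t \<in> I"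
    show "norm (d' k t) \<le> max M b"
      using k t F' d by (cases k) (auto simp: d'_def jet_def le_max_iff_disj)
  qed
  then show ?case by (intro exI[of _ d'] exI[of _ "max M b"]) (simp add: d'_def)
qed

lemma jet_subset: "jet m d M I \<Longrightarrow> J \<subseteq> I \<Longrightarrow> jet m d M J"
  unfolding jet_def by (auto intro: has_vector_derivative_within_subset)

lemma jet_mono: "jet m d M I \<Longrightarrow> M \<le> M' \<Longrightarrow> jet m d M' I"
  unfolding jet_def by force

lemma jet_taylor:
  fixes d :: "nat \<Rightarrow> real \<Rightarrow> 'b::banach"
  assumes d: "jet m d M {a..b}" and p: "p \<le> m" and ts: "t \<in> {a..b}" "t + s \<in> {a..b}" "0 \<le> s"
  shows "norm (d 0 (t + s) - (\<Sum>i<p. (s ^ i / fact i) *\<^sub>R d i t)) \<le> M * s ^ p"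
proof (cases p)
  case 0
  then show ?thesis using d ts by (auto simp: jet_def)
next
  case (Suc n)
  have sub: "jet m d M {t..t + s}" using d by (rule jet_subset) (use ts in auto)
  have "((\<lambda>x. ((t + s - x) ^ (p - 1) / fact (p - 1)) *\<^sub>R d p x) has_integral
      d 0 (t + s) - (\<Sum>i<p. (((t + s) - t) ^ i / fact i) *\<^sub>R d i t)) {t..t + s}"
    by (rule Taylor_has_integral) (use sub p Suc ts in \<open>auto simp: jet_def\<close>)
  then have int: "((\<lambda>x. ((t + s - x) ^ n / fact n) *\<^sub>R d p x) has_integral
      d 0 (t + s) - (\<Sum>i<p. (s ^ i / fact i) *\<^sub>R d i t)) {t..t + s}"
    by (simp add: Suc)
  have "norm (d 0 t) \<le> M" using d ts by (auto simp: jet_def)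
  then have M: "0 \<le> M" using norm_ge_zero order_trans by blast
  have bound: "norm (((t + s - x) ^ n / fact n) *\<^sub>R d p x) \<le> M * s ^ n" if x: "x \<in> {t..t + s}" for x
  proof -
    have "(t + s - x) ^ n / fact n \<le> s ^ n / 1"
      using x ts by (intro frac_le power_mono) (auto simp: fact_ge_1)
    moreover have "norm (d p x) \<le> M" using sub p x by (auto simp: jet_def)
    ultimately have "\<bar>(t + s - x) ^ n / fact n\<bar> * norm (d p x) \<le> s ^ n * M"
      using x ts by (intro mult_mono) auto
    then show ?thesis by (simp add: mult.commute)
  qed
  have "norm (d 0 (t + s) - (\<Sum>i<p. (s ^ i / fact i) *\<^sub>R d i t)) \<le> M * s ^ n * measure lborel {t..t + s}"
    by (rule has_integral_bound_real[OF _ finite.emptyI int]) (use M ts bound in auto)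
  then show ?thesis using ts by (simp add: Suc mult_ac)
qed

text \<open>
  Beyond \<open>b\<close> every derivative is replaced by its Taylor polynomial at \<open>b\<close>; the pieces match at \<open>b\<close>
  together with their derivatives of order up to \<open>m\<close>.
\<close>

lemma jet_extend:
  fixes d :: "nat \<Rightarrow> real \<Rightarrow> 'b::real_normed_vector"
  assumes d: "jet m d M {a..b}" and ab: "a \<le> b"
  shows "\<exists>e M. (\<forall>k. \<forall>t\<le>b. e k t = d k t) \<and> jet m e M {a..b + 1}"
proof -
  define P where "P k t = (\<Sum>q\<le>m - k. ((t - b) ^ q / fact q) *\<^sub>R d (k + q) b)" for k t
  define e where "e k t = (if t \<in> {..b} then d k t else P k t)" for k t
  have P_b: "P k b = d k b" for k
    by (simp add: P_def power_0_left if_distrib[of "\<lambda>x. x / _"] if_distrib[of "\<lambda>x. x *\<^sub>R _"] cong: if_cong)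
  have P_deriv: "(P k has_vector_derivative P (Suc k) t) (at t within A)" if km: "k < m" for k t A
  proof -
    obtain n where n: "m - k = Suc n" using km by (cases "m - k") auto
    have n': "m - Suc k = n" using n by simp
    have "P k = (\<lambda>t. d k b + (\<Sum>q\<le>n. ((t - b) ^ Suc q / fact (Suc q)) *\<^sub>R d (Suc k + q) b))"
      unfolding P_def n by (subst sum.atMost_Suc_shift) simp
    moreover have "((\<lambda>t. (t - b) ^ Suc q / fact (Suc q)) has_real_derivative (t - b) ^ q / fact q) (at t within A)" for q
    proof -
      have "((\<lambda>t. (t - b) ^ Suc q / fact (Suc q)) has_real_derivative (real (Suc q) * (t - b) ^ q) / fact (Suc q)) (at t within A)"
        by (rule DERIV_cdivide) (auto intro!: derivative_eq_intros simp del: power_Suc)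
      then show ?thesis by (simp del: of_nat_Suc)
    qed
    then have "((\<lambda>t. d k b + (\<Sum>q\<le>n. ((t - b) ^ Suc q / fact (Suc q)) *\<^sub>R d (Suc k + q) b)) has_vector_derivative
       0 + (\<Sum>q\<le>n. ((t - b) ^ q / fact q) *\<^sub>R d (Suc k + q) b)) (at t within A)"
      by (intro has_vector_derivative_add has_vector_derivative_const has_vector_derivative_sum
          has_vector_derivative_scaleR[where g' = 0, simplified])
    ultimately show ?thesis unfolding P_def[of "Suc k"] n' by simp
  qed
  have e_deriv: "(e k has_vector_derivative e (Suc k) t) (at t within {a..b + 1})"
    if k: "k < m" and t: "t \<in> {a..b + 1}" for k t
  proof -
    have cl: "closure {a..b} \<inter> closure {b<..b+1} = {b}" using ab by auto
    have "((\<lambda>x. if x \<in> {a..b} then d k x else P k x) has_vector_derivative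
      (if t \<in> {a..b} then d (Suc k) t else P (Suc k) t)) (at t within {a..b + 1})"
    proof (rule has_vector_derivative_If_within_closures[where T = "{b<..b+1}"])
      have "{a..b} \<union> {b} = {a..b}" using ab by auto
      then show "(d k has_vector_derivative d (Suc k) t) (at t within {a..b} \<union> closure {a..b} \<inter> closure {b<..b+1})"
        if "t \<in> {a..b} \<union> closure {a..b} \<inter> closure {b<..b+1}"
        unfolding cl using that d k unfolding cl jet_def by auto
      show "d k t = P k t" "d (Suc k) t = P (Suc k) t" if "t \<in> closure {a..b}" "t \<in> closure {b<..b+1}"
        using that P_b cl by auto
    qed (use t ab P_deriv[OF k] in auto)
    moreover have "(if t \<in> {a..b} then d (Suc k) t else P (Suc k) t) = e (Suc k) t"
      using t by (auto simp: e_def)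
    ultimately show ?thesis
      by (auto simp: e_def intro: has_vector_derivative_transform[OF t, rotated])
  qed
  have "\<exists>M. \<forall>k\<le>m. \<forall>t\<in>{a..b + 1}. norm (e k t) \<le> M"
  proof (intro exI allI impI ballI)
    fix k t assume k: "k \<le> m" and t: "t \<in> {a..b + 1}"
    have "norm (d 0 a) \<le> M" using d ab by (auto simp: jet_def)
    then have M: "0 \<le> M" using norm_ge_zero order_trans by blast
    have "norm (P k t) \<le> real (Suc m) * M" if tb: "b \<le> t"
    proof -
      have "norm (P k t) \<le> (\<Sum>q\<le>m - k. M)"
        unfolding P_def
      proof (rule sum_norm_le)
        fix q assume q: "q \<in> {..m - k}"
        have "(t - b) ^ q / fact q \<le> 1 / 1"
          using t tb by (intro frac_le power_le_one) (auto simp: fact_ge_1)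
        moreover have "norm (d (k + q) b) \<le> M" using d q k ab by (auto simp: jet_def)
        ultimately have "\<bar>(t - b) ^ q / fact q\<bar> * norm (d (k + q) b) \<le> 1 * M"
          using tb by (intro mult_mono) auto
        then show "norm (((t - b) ^ q / fact q) *\<^sub>R d (k + q) b) \<le> M" by simp
      qed
      also have "\<dots> \<le> real (Suc m) * M" using M by (auto intro!: mult_right_mono)
      finally show ?thesis .
    qed
    moreover have "norm (d k t) \<le> M" if "t \<le> b" using d k t that by (auto simp: jet_def)
    moreover have "M \<le> real (Suc m) * M" using M by (simp add: algebra_simps)
    ultimately show "norm (e k t) \<le> real (Suc m) * M" using M by (auto simp: e_def)
  qed
  then show ?thesis using e_deriv unfolding jet_def
    by (intro exI[of _ e]) (auto simp: e_def)
qed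

text \<open>
  Supplies the smooth curves \<open>d 0\<close> and \<open>e 0 = g \<circ> d 0\<close> on an interval reaching beyond \<open>t1\<close>, which serve
  as reference values for the stages.  The interval is so short that \<open>d 0\<close> stays within \<open>\<rho> / 2\<close> of
  the original curve.  Hence balls of radius \<open>\<rho> / 2\<close> around its points lie in the strip, where the
  first derivative bounds the increments of \<open>g\<close>.
\<close>

lemma extended_solution:
  fixes u :: "real \<Rightarrow> 'a::banach"
  assumes u: "smooth_bounded_curve 6 u t0 t1" and t: "t0 < t1" and \<rho>: "0 < \<rho>"
    and g: "six_times_differentiable_bounded g (strip u t0 t1 \<rho>)"
  obtains t2 d e M L where "t1 < t2" "\<And>t. t \<in> {t0..t1} \<Longrightarrow> d 0 t = u t"
    "jet 6 d M {t0..t2}" "jet 6 e M {t0..t2}" "\<And>t. t \<in> {t0..t2} \<Longrightarrow> e 0 t = g (d 0 t)"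
    "0 \<le> L" "\<And>t y. t \<in> {t0..t2} \<Longrightarrow> norm (y - d 0 t) < \<rho> / 2 \<Longrightarrow> norm (g y - e 0 t) \<le> L * norm (y - d 0 t)"
proof -
  obtain du M where du: "du 0 = u"
      "\<And>k t. k < 6 \<Longrightarrow> t \<in> {t0..t1} \<Longrightarrow> (du k has_vector_derivative du (Suc k) t) (at t within {t0..t1})"
      "\<And>k t. k \<in> {1..6} \<Longrightarrow> t \<in> {t0..t1} \<Longrightarrow> norm (du k t) \<le> M"
    using u unfolding smooth_bounded_curve_def by blast
  have "continuous_on {t0..t1} (du 0)"
    by (rule continuous_on_of_vector_derivative) (use du(2)[of 0] in simp)
  then have "bounded (du 0 ` {t0..t1})"
    using compact_continuous_image compact_imp_bounded by blast
  then obtain M0 where "\<forall>t\<in>{t0..t1}. norm (du 0 t) \<le> M0" by (auto simp: bounded_iff)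
  note M0 = bspec[OF this]
  have "jet 6 du (max M M0) {t0..t1}"
    unfolding jet_def
  proof (intro conjI allI impI ballI)
    show "norm (du k t) \<le> max M M0" if "k \<le> 6" "t \<in> {t0..t1}" for k t
      using M0[OF that(2)] du(3)[OF _ that(2), of k] that(1) by (cases "k = 0") auto
  qed (use du in auto)
  then obtain d M1 where d: "\<And>k t. t \<le> t1 \<Longrightarrow> d k t = du k t" and jd: "jet 6 d M1 {t0..t1 + 1}"
    using jet_extend t by (metis less_imp_le)
  have "continuous_on {t0..t1 + 1} (d 0)"
    by (rule continuous_on_of_vector_derivative[of _ _ "d 1"]) (use jd in \<open>simp add: jet_def\<close>)
  then obtain \<delta> where \<delta>: "\<delta> > 0" "\<And>t. t \<in> {t0..t1 + 1} \<Longrightarrow> dist t t1 < \<delta> \<Longrightarrow> dist (d 0 t) (d 0 t1) < \<rho> / 2"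
    unfolding continuous_on_iff using t \<rho> by (metis atLeastAtMost_iff add_increasing2 half_gt_zero less_imp_le zero_le_one order_refl)
  define t2 where "t2 = t1 + min 1 (\<delta> / 2)"
  have t2: "t1 < t2" "t2 \<le> t1 + 1" using \<delta> by (auto simp: t2_def)
  have strip: "ball (d 0 t) (\<rho> / 2) \<subseteq> strip u t0 t1 \<rho>" if t': "t \<in> {t0..t2}" for t
  proof (cases "t \<le> t1")
    case True
    then have "ball (d 0 t) (\<rho> / 2) \<subseteq> ball (u t) \<rho>" using d du(1) \<rho> by (simp add: subset_ball)
    then show ?thesis using True t' by (auto simp: strip_def)
  next
    case False
    then have near: "dist (d 0 t) (d 0 t1) < \<rho> / 2"
      using \<delta> t' t2 by (intro \<delta>(2)) (auto simp: t2_def dist_real_def)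
    have "x \<in> ball (u t1) \<rho>" if "x \<in> ball (d 0 t) (\<rho> / 2)" for x
    proof -
      have "dist (u t1) x \<le> dist (d 0 t) (u t1) + dist (d 0 t) x"
        by (metis dist_commute dist_triangle)
      then show ?thesis using that near d[of t1 0] du(1) by simp
    qed
    then show ?thesis using t unfolding strip_def by (intro subsetI UN_I[of t1]) auto
  qed
  have jd2: "jet 6 d M1 {t0..t2}" by (rule jet_subset[OF jd]) (use t2 in auto)
  have "bounded_smooth 6 (\<lambda>t. g (d 0 t)) {t0..t2}"
  proof (rule bounded_smooth_compose_six[OF g jet_imp_bounded_smooth[OF jd2]])
    show "d 0 t \<in> strip u t0 t1 \<rho>" if "t \<in> {t0..t2}" for t
      using strip[OF that] \<rho> by auto
  qed simp
  then obtain e M2 where e: "e 0 = (\<lambda>t. g (d 0 t))" "jet 6 e M2 {t0..t2}"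
    using bounded_smooth_imp_jet by blast
  from g obtain g1 :: "'a \<Rightarrow> 'a \<Rightarrow>\<^sub>L 'a" and L where g1:
      "\<forall>x\<in>strip u t0 t1 \<rho>. (g has_derivative blinfun_apply (g1 x)) (at x) \<and> norm (g1 x) \<le> L"
    unfolding six_times_differentiable_bounded_def
    by (elim exE) (rule that, rule ballI, drule (1) bspec, elim conjE, rule conjI)
  have lip: "norm (g y - e 0 t) \<le> max L 0 * norm (y - d 0 t)" if t': "t \<in> {t0..t2}" and y: "norm (y - d 0 t) < \<rho> / 2" for t y
  proof -
    have "norm (g y - g (d 0 t)) \<le> max L 0 * norm (y - d 0 t)"
    proof (rule differentiable_bound[of "ball (d 0 t) (\<rho> / 2)" g "\<lambda>x. blinfun_apply (g1 x)"])
      show "(g has_derivative blinfun_apply (g1 x)) (at x within ball (d 0 t) (\<rho> / 2))"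
        if "x \<in> ball (d 0 t) (\<rho> / 2)" for x
        using g1 strip[OF t'] that has_derivative_at_withinI by blast
      show "onorm (blinfun_apply (g1 x)) \<le> max L 0" if "x \<in> ball (d 0 t) (\<rho> / 2)" for x
      proof -
        have "norm (g1 x) \<le> L" using g1 strip[OF t'] that by blast
        then show ?thesis by (simp add: norm_blinfun.rep_eq)
      qed
    qed (use y \<rho> in \<open>auto simp: dist_norm norm_minus_commute\<close>)
    then show ?thesis by (simp add: e)
  qed
  show ?thesis
    by (rule that[of t2 d "max M1 M2" e "max L 0"])
       (use t2 d du(1) jd2 e lip in \<open>auto intro: jet_mono\<close>)
qed


section \<open>Local and global error\<close>

lemma norm_add3: "norm (a + b + c) \<le> norm a + norm b + norm (c :: 'b::real_normed_vector)"
  using norm_triangle_ineq[of "a + b" c] norm_triangle_ineq[of a b] by linarith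

context strongly_continuous_semigroup
begin

text \<open>
  The equation \<open>u' = A u + f\<close> may be differentiated in time: in integrated form,
  \<open>T s u - u = G s (u' - f)\<close>, it involves bounded operators only.
\<close>

lemma in_graph_derivatives:
  assumes t: "t0 < t1" and d: "jet 6 d M {t0..t1}" and e: "jet 6 e M {t0..t1}"
    and base: "\<And>t. t \<in> {t0..t1} \<Longrightarrow> in_graph (d 0 t) (d (Suc 0) t - e 0 t)"
  shows "q \<le> 5 \<Longrightarrow> t \<in> {t0..t1} \<Longrightarrow> in_graph (d q t) (d (Suc q) t - e q t)"
proof (induction q arbitrary: t)
  case 0
  then show ?case using base by simp
next
  case (Suc q)
  show ?case unfolding in_graph_def
  proof (intro allI impI)
    fix s :: real assume s: "0 \<le> s"
    have d': "(d k has_vector_derivative d (Suc k) t) (at t within {t0..t1})"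
      and e': "(e k has_vector_derivative e (Suc k) t) (at t within {t0..t1})" if "k < 6" for k
      using d e that Suc.prems by (auto simp: jet_def)
    have "((\<lambda>t. S s (d q t) - d q t) has_vector_derivative S s (d (Suc q) t) - d (Suc q) t) (at t within {t0..t1})"
      using Suc.prems
      by (intro has_vector_derivative_diff d' bounded_linear.has_vector_derivative[OF blinfun.bounded_linear_right]) auto
    moreover have "((\<lambda>t. S s (d q t) - d q t) has_vector_derivative
        G s (d (Suc (Suc q)) t - e (Suc q) t)) (at t within {t0..t1})"
    proof (rule has_vector_derivative_transform[OF Suc.prems(2)])
      show "((\<lambda>t. G s (d (Suc q) t - e q t)) has_vector_derivative
          G s (d (Suc (Suc q)) t - e (Suc q) t)) (at t within {t0..t1})"
        using Suc.prems
        by (intro bounded_linear.has_vector_derivative[OF bounded_linear_G] has_vector_derivative_diff d' e') auto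
      show "S s (d q t) - d q t = G s (d (Suc q) t - e q t)" if "t \<in> {t0..t1}" for t
        using Suc.IH[OF _ that] Suc.prems s by (simp add: in_graph_def)
    qed
    ultimately show "S s (d (Suc q) t) - d (Suc q) t = G s (d (Suc (Suc q)) t - e (Suc q) t)"
      using vector_derivative_unique_within_closed_interval[OF t] Suc.prems(2) by (simp add: cbox_interval) blast
  qed
qed

text \<open>
  For \<open>u' = A u + f\<close> with \<open>q\<close>-th derivatives \<open>d q\<close> of \<open>u\<close> and \<open>e q\<close> of \<open>f\<close>: substituting
  \<open>e q = d (q + 1) - A (d q)\<close> makes the recursion of the \<open>\<phi>\<close>-functions telescope, and the Taylor
  polynomial of \<open>u\<close> is left together with one term of order \<open>N\<close>.
\<close>

lemma taylor_telescope:
  assumes graph: "\<And>q. q < N \<Longrightarrow> in_graph (d q) (d (Suc q) - e q)" and \<tau>: "0 \<le> \<tau>"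
  shows "S \<tau> (d 0) + (\<Sum>q<N. \<tau> ^ Suc q *\<^sub>R blinfun_apply (phi (Suc q) \<tau>) (e q))
     = (\<Sum>q<N. (\<tau> ^ q / fact q) *\<^sub>R d q) + \<tau> ^ N *\<^sub>R blinfun_apply (phi0 N \<tau>) (d N)"
  using graph
proof (induction N)
  case 0
  then show ?case by (simp add: phi0_def)
next
  case (Suc N)
  have "\<tau> ^ N *\<^sub>R (\<tau> *\<^sub>R blinfun_apply (phi (Suc N) \<tau>) (d (Suc N) - e N))
      = \<tau> ^ N *\<^sub>R (blinfun_apply (phi0 N \<tau>) (d N) - d N /\<^sub>R fact N)"
    using phi_recursion[OF Suc.prems[of N] \<tau>] by simp
  then have "\<tau> ^ N *\<^sub>R blinfun_apply (phi0 N \<tau>) (d N) + \<tau> ^ Suc N *\<^sub>R blinfun_apply (phi (Suc N) \<tau>) (e N)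
      = (\<tau> ^ N / fact N) *\<^sub>R d N + \<tau> ^ Suc N *\<^sub>R blinfun_apply (phi (Suc N) \<tau>) (d (Suc N))"
    by (simp add: blinfun.diff_right scaleR_diff_right divide_inverse algebra_simps)
  moreover have "phi0 (Suc N) \<tau> = phi (Suc N) \<tau>" by (simp add: phi0_def)
  ultimately show ?case using Suc.IH Suc.prems by (simp add: add.assoc[symmetric])
qed

text \<open>
  The error is the sum of the propagated local errors, \<open>\<epsilon> n = \<Sum>k<n. T ((n - 1 - k) h) (D k)\<close>.  Propagating
  over several steps at once costs only one factor \<open>K\<close>.  The sharper bound \<open>\<eta> ((1 + q) ^ n - 1)\<close> is
  the one that survives induction, and \<open>\<delta>\<close> is the radius within which the local estimate is valid.
\<close>

lemma discrete_gronwall: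
  fixes \<epsilon> :: "nat \<Rightarrow> 'a"
  assumes K: "\<And>t. t \<in> {0..R} \<Longrightarrow> norm (T t) \<le> K" "1 \<le> K" and h: "0 < h" "real N * h \<le> R"
    and \<epsilon>0: "\<epsilon> 0 = 0" and \<kappa>: "0 \<le> \<kappa>" and \<eta>: "0 \<le> \<eta>"
    and step: "\<And>n. n < N \<Longrightarrow> norm (\<epsilon> n) \<le> \<delta> \<Longrightarrow> norm (\<epsilon> (Suc n) - S h (\<epsilon> n)) \<le> h * \<kappa> * (norm (\<epsilon> n) + \<eta>)"
    and \<delta>: "\<eta> * exp (K * \<kappa> * R) \<le> \<delta>"
  shows "n \<le> N \<Longrightarrow> norm (\<epsilon> n) \<le> \<eta> * exp (K * \<kappa> * R)"
proof -
  define q where "q = K * \<kappa> * h"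
  have q: "0 \<le> q" using K(2) \<kappa> h by (simp add: q_def)
  define D where "D k = \<epsilon> (Suc k) - S h (\<epsilon> k)" for k
  have rep: "\<epsilon> n = (\<Sum>k<n. S (real (n - Suc k) * h) (D k))" for n
  proof (induction n)
    case 0
    then show ?case by (simp add: \<epsilon>0)
  next
    case (Suc n)
    have "\<epsilon> (Suc n) = S h (\<epsilon> n) + D n" by (simp add: D_def)
    also have "S h (\<epsilon> n) = (\<Sum>k<n. S (real (Suc n - Suc k) * h) (D k))"
      unfolding Suc.IH blinfun.sum_right
    proof (rule sum.cong[OF refl])
      fix k assume "k \<in> {..<n}"
      then have "real (Suc n - Suc k) * h = h + real (n - Suc k) * h"
        by (simp add: of_nat_diff algebra_simps)
      moreover have "S (h + real (n - Suc k) * h) (D k) = S h (S (real (n - Suc k) * h) (D k))"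
        using h by (intro S_add) auto
      ultimately show "S h (S (real (n - Suc k) * h) (D k)) = S (real (Suc n - Suc k) * h) (D k)"
        by (simp only:)
    qed
    finally show ?case by simp
  qed
  have geo: "(\<Sum>k<n. q * (1 + q) ^ k) = (1 + q) ^ n - 1" for n
    by (induction n) (auto simp: algebra_simps)
  have exp_bound: "\<eta> * (1 + q) ^ n \<le> \<eta> * exp (K * \<kappa> * R)" if "n \<le> N" for n
  proof (rule mult_left_mono[OF _ \<eta>])
    have "(1 + q) ^ n \<le> exp q ^ n" using q by (intro power_mono exp_ge_add_one_self) auto
    also have "\<dots> = exp (real n * q)" by (simp add: exp_of_nat_mult)
    also have "real n * q \<le> K * \<kappa> * R"
    proof -
      have "real n * h \<le> R" by (rule order_trans[OF mult_right_mono h(2)]) (use h that in auto)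
      then have "K * \<kappa> * (real n * h) \<le> K * \<kappa> * R" using K(2) \<kappa> by (intro mult_left_mono) auto
      then show ?thesis by (simp add: q_def mult_ac)
    qed
    finally show "(1 + q) ^ n \<le> exp (K * \<kappa> * R)" by simp
  qed
  have main: "n \<le> N \<Longrightarrow> norm (\<epsilon> n) \<le> \<eta> * ((1 + q) ^ n - 1)" for n
  proof (induction n rule: less_induct)
    case (less n)
    have term_bound: "norm (S (real (n - Suc k) * h) (D k)) \<le> \<eta> * (q * (1 + q) ^ k)" if k: "k < n" for k
    proof -
      have \<epsilon>k: "norm (\<epsilon> k) \<le> \<eta> * ((1 + q) ^ k - 1)" using less k by simp
      also have "\<dots> \<le> \<eta> * (1 + q) ^ k" using \<eta> by (intro mult_left_mono) auto
      also have "\<dots> \<le> \<delta>" using exp_bound[of k] \<delta> k less.prems by simp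
      finally have "norm (D k) \<le> h * \<kappa> * (norm (\<epsilon> k) + \<eta>)"
        unfolding D_def using step k less.prems by simp
      also have "\<dots> \<le> h * \<kappa> * (\<eta> * (1 + q) ^ k)"
        using \<epsilon>k h \<kappa> by (intro mult_left_mono) (auto simp: algebra_simps)
      finally have D: "norm (D k) \<le> h * \<kappa> * (\<eta> * (1 + q) ^ k)" .
      have "real (n - Suc k) * h \<le> R"
        by (rule order_trans[OF mult_right_mono h(2)]) (use h less.prems in auto)
      then have "norm (T (real (n - Suc k) * h)) \<le> K" using h by (intro K) auto
      then have "norm (S (real (n - Suc k) * h) (D k)) \<le> K * (h * \<kappa> * (\<eta> * (1 + q) ^ k))"
        using D K(2) by (intro order_trans[OF norm_blinfun] mult_mono) auto
      then show ?thesis by (simp add: q_def mult_ac)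
    qed
    have "norm (\<epsilon> n) \<le> (\<Sum>k<n. \<eta> * (q * (1 + q) ^ k))"
      unfolding rep[of n] by (rule sum_norm_le) (use term_bound in auto)
    also have "\<dots> = \<eta> * ((1 + q) ^ n - 1)" unfolding geo[symmetric] by (simp add: sum_distrib_left)
    finally show ?case .
  qed
  assume n: "n \<le> N"
  have "norm (\<epsilon> n) \<le> \<eta> * ((1 + q) ^ n - 1)" using main[OF n] .
  also have "\<dots> \<le> \<eta> * (1 + q) ^ n" using \<eta> by (intro mult_left_mono) auto
  also have "\<dots> \<le> \<eta> * exp (K * \<kappa> * R)" using exp_bound[OF n] .
  finally show "norm (\<epsilon> n) \<le> \<eta> * exp (K * \<kappa> * R)" .
qed

end

text \<open>
  Here \<open>d q\<close> and \<open>e q\<close> are the \<open>q\<close>-th derivatives of the extended solution and of \<open>g\<close> along it.  The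
  differential equation is available up to \<open>t1\<close> only, the smoothness up to \<open>t2\<close>.
\<close>

locale ExpRK6s16_problem = strongly_continuous_semigroup T + ExpRK6s16_nodes c
  for T :: "real \<Rightarrow> 'a::banach \<Rightarrow>\<^sub>L 'a" and c :: "nat \<Rightarrow> real" +
  fixes g :: "'a \<Rightarrow> 'a" and d e :: "nat \<Rightarrow> real \<Rightarrow> 'a" and t0 t1 t2 M L r :: real
  assumes t01: "t0 < t1" and t12: "t1 < t2"
    and jet_d: "jet 6 d M {t0..t2}" and jet_e: "jet 6 e M {t0..t2}"
    and graph: "\<And>q t. q \<le> 5 \<Longrightarrow> t \<in> {t0..t1} \<Longrightarrow> in_graph (d q t) (d (Suc q) t - e q t)"
    and L: "0 \<le> L" and r: "0 < r"
    and lipschitz: "\<And>t y. t \<in> {t0..t2} \<Longrightarrow> norm (y - d 0 t) < r \<Longrightarrow> norm (g y - e 0 t) \<le> L * norm (y - d 0 t)"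
begin

text \<open>
  \<open>C\<close> dominates all nodes and the abscissa \<open>1\<close> of the update; \<open>R\<close> then covers every time at which the
  semigroup is evaluated when \<open>h \<le> 1\<close>, both within a step and in the propagation of errors, and \<open>K\<close>
  bounds the semigroup and the \<open>\<phi>\<close>-operators there.
\<close>

definition C :: real where "C = 1 + (\<Sum>i=2..16. c i)"

definition R :: real where "R = (t1 - t0) + C"

definition K :: real where "K = (SOME K. 1 \<le> K \<and> (\<forall>t\<in>{0..R}. norm (T t) \<le> K))"

lemma K: "1 \<le> K" "\<And>t. t \<in> {0..R} \<Longrightarrow> norm (T t) \<le> K"
  using someI_ex[of "\<lambda>K. 1 \<le> K \<and> (\<forall>t\<in>{0..R}. norm (T t) \<le> K)"] bounded_on_interval[of R]
  unfolding K_def by auto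

lemma C_ge_1: "1 \<le> C"
  using sum_nonneg[of "{2..16}" c] pos by (force simp: C_def)

lemma node_bounds:
  assumes "i \<in> {2..16}"
  shows "0 < c i" "c i \<le> C"
proof -
  have "c i \<le> (\<Sum>i=2..16. c i)"
    using assms pos by (intro member_le_sum) (auto intro: less_imp_le)
  then show "c i \<le> C" by (simp add: C_def)
qed (rule pos[OF assms])

lemma in_range: "0 \<le> \<gamma> \<Longrightarrow> \<gamma> \<le> C \<Longrightarrow> 0 \<le> h \<Longrightarrow> h \<le> 1 \<Longrightarrow> \<gamma> * h \<in> {0..R}"
  using t01 mult_mono[of \<gamma> C h 1] by (auto simp: R_def)

lemma norm_S_le: "\<tau> \<in> {0..R} \<Longrightarrow> norm (S \<tau> v) \<le> K * norm v"
  by (rule order_trans[OF norm_blinfun mult_right_mono[OF K(2)]]) auto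

lemma norm_phi_le: "\<tau> \<in> {0..R} \<Longrightarrow> norm (blinfun_apply (phi (Suc k) \<tau>) v) \<le> K * norm v"
  by (rule order_trans[OF norm_blinfun mult_right_mono[OF norm_phi[OF K(2)]]]) auto

lemma M_nonneg: "0 \<le> M"
proof -
  have "norm (d 0 t0) \<le> M" using jet_d t01 t12 by (auto simp: jet_def)
  then show ?thesis using norm_ge_zero order_trans by blast
qed

text \<open>
  What a stage (or the update, with \<open>\<gamma> = 1\<close>) makes of inexact data.  The difference \<open>g (U j) - g x\<close> is
  split into the Taylor polynomial of \<open>f\<close> at \<open>t\<close> without its constant term, which the moment
  conditions integrate exactly, and a rest \<open>w j\<close>, which consists of the errors of \<open>U j\<close> and \<open>x\<close>
  and of the Taylor remainder.
\<close>

lemma nonlinear_defect: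
  fixes \<alpha> :: "nat \<Rightarrow> 'a \<Rightarrow>\<^sub>L 'a"
  assumes \<gamma>: "0 \<le> \<gamma>" "\<gamma> \<le> C" and m: "1 \<le> m" "m \<le> 6" and h: "0 < h" "h \<le> 1" and t: "t \<in> {t0..t1}"
    and J: "finite J" "\<And>j. j \<in> J \<Longrightarrow> 0 \<le> c j \<and> c j \<le> C" "C * h \<le> t2 - t1"
    and order: "\<And>q v. 1 \<le> q \<Longrightarrow> q < m \<Longrightarrow>
      (\<Sum>j\<in>J. (c j ^ q / fact q) *\<^sub>R blinfun_apply (\<alpha> j) v) = \<gamma> ^ Suc q *\<^sub>R blinfun_apply (phi (Suc q) (\<gamma> * h)) v"
    and \<alpha>: "(\<Sum>j\<in>J. norm (\<alpha> j)) \<le> Ka"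
    and x: "norm (x - d 0 t) < r"
    and U: "\<And>j. j \<in> J \<Longrightarrow> norm (U j - d 0 (t + c j * h)) \<le> E" "E < r" "0 \<le> E"
  shows "norm ((\<gamma> * h) *\<^sub>R blinfun_apply (phi (Suc 0) (\<gamma> * h)) (g x) + h *\<^sub>R (\<Sum>j\<in>J. blinfun_apply (\<alpha> j) (g (U j) - g x))
      - (\<Sum>q<m. (\<gamma> * h) ^ Suc q *\<^sub>R blinfun_apply (phi (Suc q) (\<gamma> * h)) (e q t)))
    \<le> h * (C * K * L * norm (x - d 0 t) + Ka * (L * E + M * (C * h) ^ m + L * norm (x - d 0 t)))"
proof -
  define \<epsilon> where "\<epsilon> = norm (x - d 0 t)"
  define \<tau> where "\<tau> = \<gamma> * h"
  have \<tau>: "\<tau> \<in> {0..R}" unfolding \<tau>_def using \<gamma> h by (intro in_range) auto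
  have tt: "t \<in> {t0..t2}" using t t12 by auto
  have gx: "norm (g x - e 0 t) \<le> L * \<epsilon>" unfolding \<epsilon>_def by (rule lipschitz[OF tt x])
  obtain m' where m': "m = Suc m'" using m(1) not0_implies_Suc by force
  define w where "w j = g (U j) - g x - (\<Sum>q=1..m'. ((c j * h) ^ q / fact q) *\<^sub>R e q t)" for j
  have w: "norm (w j) \<le> L * E + M * (C * h) ^ m + L * \<epsilon>" if j: "j \<in> J" for j
  proof -
    have ch: "0 \<le> c j * h" "c j * h \<le> C * h" using J(2)[OF j] h by (auto intro: mult_right_mono)
    have t': "t + c j * h \<in> {t0..t2}" using t ch J(3) by auto
    have "norm (U j - d 0 (t + c j * h)) < r" using U(1)[OF j] U(2) by simp
    then have "norm (g (U j) - e 0 (t + c j * h)) \<le> L * norm (U j - d 0 (t + c j * h))"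
      by (rule lipschitz[OF t'])
    also have "\<dots> \<le> L * E" using U(1)[OF j] L by (intro mult_left_mono)
    finally have 1: "norm (g (U j) - e 0 (t + c j * h)) \<le> L * E" .
    have "norm (e 0 (t + c j * h) - (\<Sum>q<m. ((c j * h) ^ q / fact q) *\<^sub>R e q t)) \<le> M * (c j * h) ^ m"
      by (rule jet_taylor[OF jet_e m(2) tt t' ch(1)])
    also have "\<dots> \<le> M * (C * h) ^ m" using ch M_nonneg by (intro mult_left_mono power_mono) auto
    finally have 2: "norm (e 0 (t + c j * h) - (\<Sum>q<m. ((c j * h) ^ q / fact q) *\<^sub>R e q t)) \<le> M * (C * h) ^ m" .
    have "(\<Sum>q<m. ((c j * h) ^ q / fact q) *\<^sub>R e q t) = e 0 t + (\<Sum>q=1..m'. ((c j * h) ^ q / fact q) *\<^sub>R e q t)"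
      unfolding m' lessThan_Suc_atMost atMost_atLeast0 by (subst sum.atLeast_Suc_atMost) auto
    then have "w j = (g (U j) - e 0 (t + c j * h))
        + (e 0 (t + c j * h) - (\<Sum>q<m. ((c j * h) ^ q / fact q) *\<^sub>R e q t)) + (e 0 t - g x)"
      by (simp add: w_def)
    then have "norm (w j) \<le> norm (g (U j) - e 0 (t + c j * h))
        + norm (e 0 (t + c j * h) - (\<Sum>q<m. ((c j * h) ^ q / fact q) *\<^sub>R e q t)) + norm (e 0 t - g x)"
      by (simp only: norm_add3)
    then show ?thesis using 1 2 gx by (simp add: norm_minus_commute)
  qed
  have "(\<Sum>q<m. \<tau> ^ Suc q *\<^sub>R blinfun_apply (phi (Suc q) \<tau>) (e q t))
      = \<tau> *\<^sub>R blinfun_apply (phi (Suc 0) \<tau>) (e 0 t) + (\<Sum>q=1..m'. \<tau> ^ Suc q *\<^sub>R blinfun_apply (phi (Suc q) \<tau>) (e q t))"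
    unfolding m' lessThan_Suc_atMost atMost_atLeast0 by (subst sum.atLeast_Suc_atMost) auto
  moreover have "(\<Sum>q=1..m'. \<tau> ^ Suc q *\<^sub>R blinfun_apply (phi (Suc q) \<tau>) (e q t))
      = h *\<^sub>R (\<Sum>j\<in>J. blinfun_apply (\<alpha> j) (\<Sum>q=1..m'. ((c j * h) ^ q / fact q) *\<^sub>R e q t))"
  proof -
    have "\<tau> ^ Suc q *\<^sub>R blinfun_apply (phi (Suc q) \<tau>) (e q t)
        = h *\<^sub>R (\<Sum>j\<in>J. ((c j * h) ^ q / fact q) *\<^sub>R blinfun_apply (\<alpha> j) (e q t))" if "q \<in> {1..m'}" for q
    proof -
      have "\<tau> ^ Suc q *\<^sub>R blinfun_apply (phi (Suc q) \<tau>) (e q t)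
          = h ^ Suc q *\<^sub>R (\<gamma> ^ Suc q *\<^sub>R blinfun_apply (phi (Suc q) (\<gamma> * h)) (e q t))"
        by (simp add: \<tau>_def power_mult_distrib mult_ac)
      also have "\<dots> = h ^ Suc q *\<^sub>R (\<Sum>j\<in>J. (c j ^ q / fact q) *\<^sub>R blinfun_apply (\<alpha> j) (e q t))"
        using order[of q "e q t"] that m' by simp
      finally show ?thesis
        by (simp add: scaleR_sum_right power_mult_distrib mult_ac)
    qed
    then have "(\<Sum>q=1..m'. \<tau> ^ Suc q *\<^sub>R blinfun_apply (phi (Suc q) \<tau>) (e q t))
        = h *\<^sub>R (\<Sum>q=1..m'. \<Sum>j\<in>J. ((c j * h) ^ q / fact q) *\<^sub>R blinfun_apply (\<alpha> j) (e q t))"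
      by (simp add: scaleR_sum_right)
    also have "\<dots> = h *\<^sub>R (\<Sum>j\<in>J. blinfun_apply (\<alpha> j) (\<Sum>q=1..m'. ((c j * h) ^ q / fact q) *\<^sub>R e q t))"
      by (subst sum.swap) (simp add: blinfun.sum_right blinfun.scaleR_right)
    finally show ?thesis .
  qed
  ultimately have eq: "\<tau> *\<^sub>R blinfun_apply (phi (Suc 0) \<tau>) (g x) + h *\<^sub>R (\<Sum>j\<in>J. blinfun_apply (\<alpha> j) (g (U j) - g x))
      - (\<Sum>q<m. \<tau> ^ Suc q *\<^sub>R blinfun_apply (phi (Suc q) \<tau>) (e q t))
      = \<tau> *\<^sub>R blinfun_apply (phi (Suc 0) \<tau>) (g x - e 0 t) + h *\<^sub>R (\<Sum>j\<in>J. blinfun_apply (\<alpha> j) (w j))"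
    by (simp add: w_def blinfun.diff_right scaleR_diff_right sum_subtractf)
  have "norm (\<tau> *\<^sub>R blinfun_apply (phi (Suc 0) \<tau>) (g x - e 0 t)) \<le> (C * h) * (K * (L * \<epsilon>))"
  proof -
    have "norm (blinfun_apply (phi (Suc 0) \<tau>) (g x - e 0 t)) \<le> K * norm (g x - e 0 t)"
      by (rule norm_phi_le[OF \<tau>])
    also have "\<dots> \<le> K * (L * \<epsilon>)" using gx K(1) by (intro mult_left_mono) auto
    finally have "\<bar>\<tau>\<bar> * norm (blinfun_apply (phi (Suc 0) \<tau>) (g x - e 0 t)) \<le> (C * h) * (K * (L * \<epsilon>))"
      using \<tau> \<gamma> h C_ge_1 by (intro mult_mono) (auto simp: \<tau>_def intro!: mult_right_mono)
    then show ?thesis by simp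
  qed
  moreover have "norm (\<Sum>j\<in>J. blinfun_apply (\<alpha> j) (w j)) \<le> Ka * (L * E + M * (C * h) ^ m + L * \<epsilon>)"
  proof -
    have nonneg: "0 \<le> L * E + M * (C * h) ^ m + L * \<epsilon>"
      using L U(3) M_nonneg h C_ge_1 by (simp add: \<epsilon>_def)
    have "norm (\<Sum>j\<in>J. blinfun_apply (\<alpha> j) (w j)) \<le> (\<Sum>j\<in>J. norm (\<alpha> j) * (L * E + M * (C * h) ^ m + L * \<epsilon>))"
      by (rule sum_norm_le) (meson w mult_left_mono norm_blinfun norm_ge_zero order_trans)
    also have "\<dots> = (\<Sum>j\<in>J. norm (\<alpha> j)) * (L * E + M * (C * h) ^ m + L * \<epsilon>)"
      by (simp add: sum_distrib_right)
    also have "\<dots> \<le> Ka * (L * E + M * (C * h) ^ m + L * \<epsilon>)"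
      using \<alpha> nonneg by (rule mult_right_mono)
    finally show ?thesis .
  qed
  then have "norm (h *\<^sub>R (\<Sum>j\<in>J. blinfun_apply (\<alpha> j) (w j))) \<le> h * (Ka * (L * E + M * (C * h) ^ m + L * \<epsilon>))"
    using h by simp
  ultimately show ?thesis
    unfolding \<tau>_def[symmetric] \<epsilon>_def[symmetric] eq
    by (intro order_trans[OF norm_triangle_ineq]) (simp add: algebra_simps)
qed

text \<open>
  The target \<open>d 0 (t + \<tau>)\<close> may lie beyond \<open>t1\<close>, where the differential equation is lost.  It is
  compared with the Taylor polynomial of \<open>d 0\<close> at \<open>t\<close>, to which the telescoping identity leads.  This
  argument ends at order 6, the number of derivatives of \<open>d 0\<close>.
\<close>

lemma stage_defect:
  assumes \<tau>: "\<tau> \<in> {0..R}" "t \<in> {t0..t1}" "t + \<tau> \<le> t2" and m: "m \<le> 5"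
  shows "norm (S \<tau> (d 0 t) + (\<Sum>q<m. \<tau> ^ Suc q *\<^sub>R blinfun_apply (phi (Suc q) \<tau>) (e q t)) - d 0 (t + \<tau>))
     \<le> 3 * K * M * \<tau> ^ Suc m"
proof -
  have tt: "t \<in> {t0..t2}" "t + \<tau> \<in> {t0..t2}" using \<tau> t12 by auto
  have bd: "norm (d (Suc m) t) \<le> M" "norm (e m t) \<le> M"
    using jet_d jet_e tt m by (auto simp: jet_def)
  have tel: "S \<tau> (d 0 t) + (\<Sum>q<Suc m. \<tau> ^ Suc q *\<^sub>R blinfun_apply (phi (Suc q) \<tau>) (e q t))
     = (\<Sum>q<Suc m. (\<tau> ^ q / fact q) *\<^sub>R d q t) + \<tau> ^ Suc m *\<^sub>R blinfun_apply (phi0 (Suc m) \<tau>) (d (Suc m) t)"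
    by (rule taylor_telescope[where d = "\<lambda>q. d q t" and e = "\<lambda>q. e q t"]) (use graph \<tau> m in auto)
  have "S \<tau> (d 0 t) + (\<Sum>q<m. \<tau> ^ Suc q *\<^sub>R blinfun_apply (phi (Suc q) \<tau>) (e q t)) - d 0 (t + \<tau>)
     = - (d 0 (t + \<tau>) - (\<Sum>q<Suc m. (\<tau> ^ q / fact q) *\<^sub>R d q t))
       + \<tau> ^ Suc m *\<^sub>R blinfun_apply (phi (Suc m) \<tau>) (d (Suc m) t)
       - \<tau> ^ Suc m *\<^sub>R blinfun_apply (phi (Suc m) \<tau>) (e m t)"
    using tel by (simp add: phi0_def algebra_simps)
  moreover have "norm (d 0 (t + \<tau>) - (\<Sum>q<Suc m. (\<tau> ^ q / fact q) *\<^sub>R d q t)) \<le> M * \<tau> ^ Suc m"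
    by (rule jet_taylor[OF jet_d _ tt]) (use m \<tau> in auto)
  moreover have "M * \<tau> ^ Suc m \<le> K * M * \<tau> ^ Suc m"
    using K(1) M_nonneg \<tau> mult_right_mono[of 1 K "M * \<tau> ^ Suc m"] by (simp add: mult.assoc)
  moreover have P: "norm (\<tau> ^ Suc m *\<^sub>R blinfun_apply (phi (Suc m) \<tau>) v) \<le> K * M * \<tau> ^ Suc m" if "norm v \<le> M" for v
  proof -
    have "norm (blinfun_apply (phi (Suc m) \<tau>) v) \<le> K * M"
      using norm_phi_le[OF \<tau>(1), of m v] that K(1) mult_left_mono[of "norm v" M K] by linarith
    then have "\<tau> ^ Suc m * norm (blinfun_apply (phi (Suc m) \<tau>) v) \<le> \<tau> ^ Suc m * (K * M)"
      using \<tau> by (intro mult_left_mono) auto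
    then show ?thesis using \<tau> by (simp add: mult_ac)
  qed
  ultimately show ?thesis
    using P[OF bd(1)] P[OF bd(2)]
    using norm_add3[of "- (d 0 (t + \<tau>) - (\<Sum>q<Suc m. (\<tau> ^ q / fact q) *\<^sub>R d q t))"
        "\<tau> ^ Suc m *\<^sub>R blinfun_apply (phi (Suc m) \<tau>) (d (Suc m) t)"
        "- (\<tau> ^ Suc m *\<^sub>R blinfun_apply (phi (Suc m) \<tau>) (e m t))"]
    by (simp only: norm_minus_cancel diff_conv_add_uminus[symmetric])
qed

text \<open>
  At the end of a step one order more is needed than the derivatives of \<open>d 0\<close> provide.  Since
  \<open>t + h \<le> t1\<close>, Duhamel's formula applies, and the integration gains the missing power of \<open>h\<close> from
  six derivatives of \<open>f\<close>.
\<close>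

lemma final_defect:
  assumes h: "0 < h" "h \<le> 1" and t: "t0 \<le> t" "t + h \<le> t1"
  shows "norm (S h (d 0 t) + (\<Sum>q<6. h ^ Suc q *\<^sub>R blinfun_apply (phi (Suc q) h) (e q t)) - d 0 (t + h)) \<le> K * M * h ^ 7"
proof -
  have hR: "h \<in> {0..R}" using in_range[of 1 h] h C_ge_1 by simp
  let ?P = "\<lambda>\<theta>. \<Sum>q<6. ((\<theta> * h) ^ q / fact q) *\<^sub>R e q t"
  have I1: "((\<lambda>\<theta>. h *\<^sub>R S ((1 - \<theta>) * h) (e 0 (t + \<theta> * h))) has_integral d 0 (t + h) - S h (d 0 t)) {0..1}"
  proof (rule variation_of_constants[where y = "\<lambda>s. d (Suc 0) s - e 0 s"])
    fix s assume s: "s \<in> {t..t + h}"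
    then show "in_graph (d 0 s) (d (Suc 0) s - e 0 s)" using t by (intro graph) auto
    have "(d 0 has_vector_derivative d (Suc 0) s) (at s within {t0..t2})"
      using jet_d s t t12 by (auto simp: jet_def)
    then show "(d 0 has_vector_derivative d (Suc 0) s - e 0 s + e 0 s) (at s within {t..t + h})"
      using t t12 by (auto intro: has_vector_derivative_within_subset)
  qed (use h in auto)
  have I2: "((\<lambda>\<theta>. h *\<^sub>R S ((1 - \<theta>) * h) (?P \<theta>)) has_integral
      (\<Sum>q<6. h ^ Suc q *\<^sub>R blinfun_apply (phi (Suc q) h) (e q t))) {0..1}"
  proof -
    have "((\<lambda>\<theta>. \<Sum>q<6. h ^ Suc q *\<^sub>R ((\<theta> ^ q / fact q) *\<^sub>R S ((1 - \<theta>) * h) (e q t))) has_integral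
        (\<Sum>q<6. h ^ Suc q *\<^sub>R blinfun_apply (phi (Suc q) h) (e q t))) {0..1}"
      unfolding phi_apply[OF less_imp_le[OF h(1)]]
      by (intro has_integral_sum has_integral_cmul integrable_integral phi_integrand_integrable) (use h in auto)
    moreover have "(\<Sum>q<6. h ^ Suc q *\<^sub>R ((\<theta> ^ q / fact q) *\<^sub>R S ((1 - \<theta>) * h) (e q t)))
        = h *\<^sub>R S ((1 - \<theta>) * h) (?P \<theta>)" for \<theta>
      by (simp add: blinfun.sum_right blinfun.scaleR_right scaleR_sum_right power_mult_distrib mult_ac)
    ultimately show ?thesis by (simp only:)
  qed
  have "norm ((d 0 (t + h) - S h (d 0 t)) - (\<Sum>q<6. h ^ Suc q *\<^sub>R blinfun_apply (phi (Suc q) h) (e q t)))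
      \<le> K * M * h ^ 7 * measure lborel {0..1::real}"
  proof (rule has_integral_bound_real[OF _ finite.emptyI has_integral_diff[OF I1 I2]])
    fix \<theta> :: real assume "\<theta> \<in> {0..1} - {}"
    then have \<theta>: "0 \<le> \<theta>" "\<theta> \<le> 1" by auto
    have th: "0 \<le> \<theta> * h" "\<theta> * h \<le> h" using \<theta> h by (auto simp: mult_left_le_one_le)
    have "norm (e 0 (t + \<theta> * h) - ?P \<theta>) \<le> M * (\<theta> * h) ^ 6"
      by (rule jet_taylor[OF jet_e]) (use t th t12 in auto)
    also have "\<dots> \<le> M * h ^ 6" using th M_nonneg by (intro mult_left_mono power_mono) auto
    finally have 1: "norm (e 0 (t + \<theta> * h) - ?P \<theta>) \<le> M * h ^ 6" .
    have "(1 - \<theta>) * h \<in> {0..R}" using \<theta> h C_ge_1 by (intro in_range) auto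
    then have "norm (S ((1 - \<theta>) * h) (e 0 (t + \<theta> * h) - ?P \<theta>)) \<le> K * norm (e 0 (t + \<theta> * h) - ?P \<theta>)"
      by (rule norm_S_le)
    also have "\<dots> \<le> K * (M * h ^ 6)" using 1 K(1) by (intro mult_left_mono) auto
    finally have "h * norm (S ((1 - \<theta>) * h) (e 0 (t + \<theta> * h) - ?P \<theta>)) \<le> h * (K * (M * h ^ 6))"
      using h by (intro mult_left_mono) auto
    also have "\<dots> = K * M * h ^ 7" by (simp add: eval_nat_numeral)
    finally show "norm (h *\<^sub>R S ((1 - \<theta>) * h) (e 0 (t + \<theta> * h)) - h *\<^sub>R S ((1 - \<theta>) * h) (?P \<theta>)) \<le> K * M * h ^ 7"
      using h by (simp add: blinfun.diff_right scaleR_diff_right[symmetric])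
  qed (use K(1) M_nonneg h in auto)
  then show ?thesis by (simp add: norm_minus_commute algebra_simps)
qed

definition stage_equations :: "real \<Rightarrow> 'a \<Rightarrow> (nat \<Rightarrow> 'a) \<Rightarrow> bool" where
  "stage_equations h x U \<longleftrightarrow> (\<forall>i\<in>{2..16}. U i = S (c i * h) x
     + (c i * h) *\<^sub>R blinfun_apply (phi (Suc 0) (c i * h)) (g x)
     + h *\<^sub>R (\<Sum>j\<in>sources i. blinfun_apply (ExpRK6s16_a c (\<lambda>q t. phi q (t * h)) i j) (g (U j) - g x)))"

text \<open>
  Accuracy of order \<open>m\<close>, up to a multiple of the error of the initial value \<open>x\<close> of the step, uniformly in
  all steps.
\<close>

definition stages_accurate :: "nat set \<Rightarrow> nat \<Rightarrow> bool" where
  "stages_accurate I m \<longleftrightarrow> (\<exists>\<kappa> \<delta>. 0 \<le> \<kappa> \<and> 0 < \<delta> \<and> (\<forall>h t x U i. i \<in> I \<and> 0 < h \<and> h \<le> \<delta> \<and> t \<in> {t0..t1} \<and>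
     norm (x - d 0 t) \<le> \<delta> \<and> stage_equations h x U \<longrightarrow>
     norm (U i - d 0 (t + c i * h)) \<le> \<kappa> * (norm (x - d 0 t) + h ^ m)))"

lemma stages_accurate_insert:
  assumes "stages_accurate {i} m" "stages_accurate I m"
  shows "stages_accurate (insert i I) m"
proof -
  obtain \<kappa>1 \<delta>1 where 1: "0 \<le> \<kappa>1" "0 < \<delta>1" "\<And>h t x U. 0 < h \<Longrightarrow> h \<le> \<delta>1 \<Longrightarrow> t \<in> {t0..t1} \<Longrightarrow>
      norm (x - d 0 t) \<le> \<delta>1 \<Longrightarrow> stage_equations h x U \<Longrightarrow>
      norm (U i - d 0 (t + c i * h)) \<le> \<kappa>1 * (norm (x - d 0 t) + h ^ m)"
    using assms(1) unfolding stages_accurate_def by blast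
  obtain \<kappa>2 \<delta>2 where 2: "0 \<le> \<kappa>2" "0 < \<delta>2" "\<And>h t x U j. j \<in> I \<Longrightarrow> 0 < h \<Longrightarrow> h \<le> \<delta>2 \<Longrightarrow> t \<in> {t0..t1} \<Longrightarrow>
      norm (x - d 0 t) \<le> \<delta>2 \<Longrightarrow> stage_equations h x U \<Longrightarrow>
      norm (U j - d 0 (t + c j * h)) \<le> \<kappa>2 * (norm (x - d 0 t) + h ^ m)"
    using assms(2) unfolding stages_accurate_def by blast
  have mono: "b \<le> (\<kappa>1 + \<kappa>2) * (norm y + h ^ m)"
    if "b \<le> \<kappa> * (norm y + h ^ m)" "\<kappa> = \<kappa>1 \<or> \<kappa> = \<kappa>2" "0 < h" for b \<kappa> h :: real and y :: 'a
  proof -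
    have "\<kappa> * (norm y + h ^ m) \<le> (\<kappa>1 + \<kappa>2) * (norm y + h ^ m)"
      using that(2,3) 1(1) 2(1) by (intro mult_right_mono) auto
    then show ?thesis using that(1) by linarith
  qed
  show ?thesis unfolding stages_accurate_def
  proof (rule exI[of _ "\<kappa>1 + \<kappa>2"], rule exI[of _ "min \<delta>1 \<delta>2"], intro conjI allI impI; (elim conjE)?)
    fix h t x U j
    assume *: "j \<in> insert i I" "0 < h" "h \<le> min \<delta>1 \<delta>2" "t \<in> {t0..t1}" "norm (x - d 0 t) \<le> min \<delta>1 \<delta>2"
      "stage_equations h x U"
    show "norm (U j - d 0 (t + c j * h)) \<le> (\<kappa>1 + \<kappa>2) * (norm (x - d 0 t) + h ^ m)"
    proof (cases "j = i")
      case True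
      have "norm (U i - d 0 (t + c i * h)) \<le> \<kappa>1 * (norm (x - d 0 t) + h ^ m)"
        by (rule 1(3)) (use * in auto)
      then show ?thesis using True mono *(2) by blast
    next
      case False
      have "norm (U j - d 0 (t + c j * h)) \<le> \<kappa>2 * (norm (x - d 0 t) + h ^ m)"
        by (rule 2(3)) (use * False in auto)
      then show ?thesis using mono *(2) by blast
    qed
  qed (use 1 2 in auto)
qed

lemma stages_accurate_empty: "stages_accurate {} m"
  unfolding stages_accurate_def by (rule exI[of _ 0], rule exI[of _ 1]) auto

lemma stages_accurate_finite:
  "finite I \<Longrightarrow> (\<And>i. i \<in> I \<Longrightarrow> stages_accurate {i} m) \<Longrightarrow> stages_accurate I m"
  by (induction I rule: finite_induct) (auto intro: stages_accurate_insert stages_accurate_empty)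

lemma norm_lagrange_combination:
  assumes "\<gamma> * h \<in> {0..R}"
  shows "norm (\<Sum>q<n. w q *\<^sub>R phi (q + 2) (\<gamma> * h)) \<le> (\<Sum>q<n. \<bar>w q\<bar> * K)"
proof (rule sum_norm_le)
  fix q
  have "norm (phi (q + 2) (\<gamma> * h)) \<le> K"
    using norm_phi[OF K(2) assms, of "Suc q"] by simp
  then show "norm (w q *\<^sub>R phi (q + 2) (\<gamma> * h)) \<le> \<bar>w q\<bar> * K" by (simp add: mult_left_mono)
qed

lemma sum_a_bounded:
  assumes i: "i \<in> {2..16}"
  shows "\<exists>Ka. \<forall>h. 0 < h \<and> h \<le> 1 \<longrightarrow>
    (\<Sum>j\<in>sources i. norm (ExpRK6s16_a c (\<lambda>q t. phi q (t * h)) i j)) \<le> Ka"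
proof (cases "i = 2")
  case True
  then have "sources i = {}" by (simp add: sources_def)
  then show ?thesis by auto
next
  case False
  then have i3: "i \<in> {3..16}" using i by auto
  let ?w = "\<lambda>j q. fact (Suc q) * lagrange_weight c (sources i) j q * c i ^ (q + 2)"
  have "(\<Sum>j\<in>sources i. norm (ExpRK6s16_a c (\<lambda>q t. phi q (t * h)) i j))
      \<le> (\<Sum>j\<in>sources i. \<Sum>q<card (sources i). \<bar>?w j q\<bar> * K)" if h: "0 < h" "h \<le> 1" for h
  proof (rule sum_mono)
    fix j assume j: "j \<in> sources i"
    have "c i * h \<in> {0..R}" using node_bounds[OF i] h by (intro in_range) auto
    then show "norm (ExpRK6s16_a c (\<lambda>q t. phi q (t * h)) i j) \<le> (\<Sum>q<card (sources i). \<bar>?w j q\<bar> * K)"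
      unfolding ExpRK6s16_a_eq_lagrange[OF i3 j] scaleR_scaleR by (rule norm_lagrange_combination)
  qed
  then show ?thesis by blast
qed

lemma sum_b_bounded:
  "\<exists>Ka. \<forall>h. 0 < h \<and> h \<le> 1 \<longrightarrow> (\<Sum>i=12..16. norm (ExpRK6s16_b c (\<lambda>q t. phi q (t * h)) i)) \<le> Ka"
proof -
  let ?w = "\<lambda>j q. fact (Suc q) * lagrange_weight c {12..16} j q"
  have "(\<Sum>i=12..16. norm (ExpRK6s16_b c (\<lambda>q t. phi q (t * h)) i))
      \<le> (\<Sum>i=12..16. \<Sum>q<5. \<bar>?w i q\<bar> * K)" if h: "0 < h" "h \<le> 1" for h
  proof (rule sum_mono)
    fix i :: nat assume i: "i \<in> {12..16}"
    have "1 * h \<in> {0..R}" using C_ge_1 h by (intro in_range) auto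
    then show "norm (ExpRK6s16_b c (\<lambda>q t. phi q (t * h)) i) \<le> (\<Sum>q<5. \<bar>?w i q\<bar> * K)"
      unfolding ExpRK6s16_b_eq_lagrange[OF i] by (rule norm_lagrange_combination)
  qed
  then show ?thesis by blast
qed

text \<open>
  A step size and an initial error below \<open>\<delta>\<close> keep all arguments of \<open>g\<close> within distance \<open>r\<close> of the
  extended solution and all times below \<open>t2\<close>.
\<close>

lemma small_step:
  assumes "0 \<le> \<kappa>" "0 < \<delta>'"
  obtains \<delta> where "0 < \<delta>" "\<delta> \<le> \<delta>'" "\<delta> \<le> 1" "\<delta> < r" "\<kappa> * (2 * \<delta>) < r" "C * \<delta> \<le> t2 - t1"
proof -
  \<comment> \<open>The denominator exceeds \<open>2 * \<kappa>\<close> and is at least 2, which gives both bounds by \<open>r\<close>.\<close>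
  define s where "s = r / (2 * \<kappa> + 2)"
  define \<delta> where "\<delta> = min (min \<delta>' 1) (min s ((t2 - t1) / C))"
  have s: "0 < s" "s * (2 * \<kappa> + 2) = r" using r assms(1) by (auto simp: s_def field_simps)
  have "\<delta> \<le> s" by (simp add: \<delta>_def)
  moreover have \<delta>: "0 < \<delta>" "\<delta> \<le> \<delta>'" "\<delta> \<le> 1" "\<delta> \<le> (t2 - t1) / C"
    using s assms(2) t12 C_ge_1 by (auto simp: \<delta>_def)
  moreover have "\<kappa> * \<delta> \<le> \<kappa> * s" using \<open>\<delta> \<le> s\<close> assms(1) by (rule mult_left_mono)
  moreover have "0 \<le> \<kappa> * s" using s assms(1) by simp
  moreover have "C * \<delta> \<le> t2 - t1" using \<delta>(4) C_ge_1 by (simp add: field_simps)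
  ultimately show ?thesis using s by (intro that[of \<delta>]) (auto simp: algebra_simps)
qed

lemma defect_arithmetic:
  fixes A Ka \<kappa> Mm \<epsilon> h hm :: real
  assumes "0 \<le> A" "0 \<le> Ka" "0 \<le> \<kappa>" "0 \<le> Mm" "0 \<le> \<epsilon>" "0 \<le> h" "h \<le> 1" "0 \<le> hm" "0 \<le> l"
  shows "A * \<epsilon> + Ka * (l * (\<kappa> * (\<epsilon> + hm)) + Mm * hm + l * \<epsilon>) \<le> (A + Ka * (l * \<kappa> + Mm + l)) * (\<epsilon> + hm)"
proof -
  have "0 \<le> A * hm + Ka * (Mm * \<epsilon> + l * hm)" using assms by simp
  then show ?thesis by (simp add: algebra_simps)
qed

text \<open>
  One layer gains one order.  The error of the stage consists of the propagated initial error, the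
  defect caused by the inexact arguments of \<open>g\<close>, and the defect of the exact data.
\<close>

lemma stage_step:
  assumes i: "i \<in> {2..16}" and acc: "stages_accurate (sources i) (Suc (card (sources i)))"
  shows "stages_accurate {i} (Suc (Suc (card (sources i))))"
proof -
  define m where "m = Suc (card (sources i))"
  have card: "card (sources i) \<le> 4" by (auto simp: sources_def)
  then have m: "1 \<le> m" "m \<le> 5" by (auto simp: m_def)
  obtain \<kappa> \<delta>' where \<kappa>: "0 \<le> \<kappa>" "0 < \<delta>'" "\<And>h t x U j. j \<in> sources i \<Longrightarrow> 0 < h \<Longrightarrow> h \<le> \<delta>' \<Longrightarrow> t \<in> {t0..t1} \<Longrightarrow>
      norm (x - d 0 t) \<le> \<delta>' \<Longrightarrow> stage_equations h x U \<Longrightarrow>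
      norm (U j - d 0 (t + c j * h)) \<le> \<kappa> * (norm (x - d 0 t) + h ^ m)"
    using acc unfolding stages_accurate_def m_def by blast
  obtain Ka where Ka: "\<And>h. 0 < h \<Longrightarrow> h \<le> 1 \<Longrightarrow>
      (\<Sum>j\<in>sources i. norm (ExpRK6s16_a c (\<lambda>q t. phi q (t * h)) i j)) \<le> Ka"
    using sum_a_bounded[OF i] by blast
  have Ka0: "0 \<le> Ka" using Ka[of 1] sum_nonneg[of "sources i" "\<lambda>j. norm (ExpRK6s16_a c (\<lambda>q t. phi q (t * 1)) i j)"]
    by fastforce
  obtain \<delta> where \<delta>: "0 < \<delta>" "\<delta> \<le> \<delta>'" "\<delta> \<le> 1" "\<delta> < r" "\<kappa> * (2 * \<delta>) < r" "C * \<delta> \<le> t2 - t1"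
    using small_step[OF \<kappa>(1,2)] by blast
  define \<kappa>' where "\<kappa>' = K + (C * K * L + Ka * (L * \<kappa> + M * C ^ m + L)) + 3 * K * M * C ^ Suc m"
  have CKL: "0 \<le> C * K * L" "0 \<le> M * C ^ m" "0 \<le> 3 * K * M * C ^ Suc m"
    using C_ge_1 K(1) L M_nonneg by auto
  have "norm (U i - d 0 (t + c i * h)) \<le> \<kappa>' * (norm (x - d 0 t) + h ^ Suc m)"
    if h: "0 < h" "h \<le> \<delta>" and t: "t \<in> {t0..t1}" and x: "norm (x - d 0 t) \<le> \<delta>" and U: "stage_equations h x U"
    for h t x U
  proof -
    define \<epsilon> where "\<epsilon> = norm (x - d 0 t)"
    define \<tau> where "\<tau> = c i * h"
    have \<epsilon>: "0 \<le> \<epsilon>" by (simp add: \<epsilon>_def)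
    have h1: "h \<le> 1" using h \<delta> by simp
    have Ch: "C * h \<le> t2 - t1" using h \<delta>(6) C_ge_1 mult_left_mono[of h \<delta> C] by linarith
    have \<tau>: "\<tau> \<in> {0..R}" unfolding \<tau>_def using node_bounds[OF i] h h1 by (intro in_range) auto
    have \<tau>C: "\<tau> \<le> C * h" unfolding \<tau>_def using node_bounds[OF i] h by (intro mult_right_mono) auto
    have hm: "h ^ m \<le> h" using power_decreasing[of 1 m h] m h h1 by simp
    have E: "\<kappa> * (\<epsilon> + h ^ m) < r"
    proof -
      have "\<kappa> * (\<epsilon> + h ^ m) \<le> \<kappa> * (2 * \<delta>)" using hm h x \<kappa>(1) by (intro mult_left_mono) (auto simp: \<epsilon>_def)
      then show ?thesis using \<delta>(5) by simp
    qed
    let ?N = "\<tau> *\<^sub>R blinfun_apply (phi (Suc 0) \<tau>) (g x)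
      + h *\<^sub>R (\<Sum>j\<in>sources i. blinfun_apply (ExpRK6s16_a c (\<lambda>q t. phi q (t * h)) i j) (g (U j) - g x))"
    let ?Q = "\<Sum>q<m. \<tau> ^ Suc q *\<^sub>R blinfun_apply (phi (Suc q) \<tau>) (e q t)"
    have "norm (?N - ?Q)
      \<le> h * (C * K * L * norm (x - d 0 t) + Ka * (L * (\<kappa> * (\<epsilon> + h ^ m)) + M * (C * h) ^ m + L * norm (x - d 0 t)))"
      unfolding \<tau>_def
    proof (rule nonlinear_defect)
      show "0 \<le> c j \<and> c j \<le> C" if "j \<in> sources i" for j
        using node_bounds[of j] that sources_subset[of i] i by fastforce
      show "(\<Sum>j\<in>sources i. (c j ^ q / fact q) *\<^sub>R blinfun_apply (ExpRK6s16_a c (\<lambda>q t. phi q (t * h)) i j) v)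
          = c i ^ Suc q *\<^sub>R blinfun_apply (phi (Suc q) (c i * h)) v" if q: "1 \<le> q" "q < m" for q v
      proof -
        have "sources i \<noteq> {}" using q by (auto simp: m_def)
        then have "i \<in> {3..16}" by (auto simp: sources_def split: if_splits)
        from sum_a_order[OF this q(1), of "\<lambda>q t. phi q (t * h)"] q(2)
        have "blinfun_apply (\<Sum>j\<in>sources i. (c j ^ q / fact q) *\<^sub>R ExpRK6s16_a c (\<lambda>q t. phi q (t * h)) i j) v
          = blinfun_apply (c i ^ Suc q *\<^sub>R phi (Suc q) (c i * h)) v" by (simp add: m_def)
        then show ?thesis by (simp add: blinfun.sum_left blinfun.scaleR_left)
      qed
      show "norm (U j - d 0 (t + c j * h)) \<le> \<kappa> * (\<epsilon> + h ^ m)" if "j \<in> sources i" for j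
        unfolding \<epsilon>_def by (rule \<kappa>(3)[OF that]) (use h \<delta> t x U in auto)
      show "finite (sources i)" by (simp add: sources_def)
      show "norm (x - d 0 t) < r" using x \<delta>(4) by simp
      show "0 \<le> \<kappa> * (\<epsilon> + h ^ m)" using \<kappa>(1) \<epsilon> h by simp
    qed (use node_bounds[OF i] m h h1 t Ch Ka E in auto)
    also have "\<dots> = h * (C * K * L * \<epsilon> + Ka * (L * (\<kappa> * (\<epsilon> + h ^ m)) + M * C ^ m * h ^ m + L * \<epsilon>))"
      by (simp add: \<epsilon>_def power_mult_distrib mult_ac)
    also have "\<dots> \<le> h * ((C * K * L + Ka * (L * \<kappa> + M * C ^ m + L)) * (\<epsilon> + h ^ m))"
      using h h1 CKL Ka0 \<kappa>(1) \<epsilon> L by (intro mult_left_mono defect_arithmetic[where h = h]) auto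
    also have "\<dots> = (C * K * L + Ka * (L * \<kappa> + M * C ^ m + L)) * (h * \<epsilon> + h ^ Suc m)"
      by (simp add: algebra_simps)
    also have "\<dots> \<le> (C * K * L + Ka * (L * \<kappa> + M * C ^ m + L)) * (\<epsilon> + h ^ Suc m)"
      using CKL Ka0 \<kappa>(1) L h h1 \<epsilon> by (intro mult_left_mono) (auto simp: mult_left_le_one_le)
    finally have 1: "norm (?N - ?Q) \<le> (C * K * L + Ka * (L * \<kappa> + M * C ^ m + L)) * (\<epsilon> + h ^ Suc m)" .
    have "norm (S \<tau> (d 0 t) + ?Q - d 0 (t + \<tau>)) \<le> 3 * K * M * \<tau> ^ Suc m"
      by (rule stage_defect) (use \<tau> t Ch \<tau>C m in auto)
    also have "\<dots> \<le> 3 * K * M * (C * h) ^ Suc m"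
      using \<tau> \<tau>C K(1) M_nonneg by (intro mult_left_mono power_mono) auto
    also have "\<dots> = 3 * K * M * C ^ Suc m * h ^ Suc m" by (simp add: power_mult_distrib mult_ac)
    also have "\<dots> \<le> 3 * K * M * C ^ Suc m * (\<epsilon> + h ^ Suc m)"
      using \<epsilon> CKL by (intro mult_left_mono) auto
    finally have 2: "norm (S \<tau> (d 0 t) + ?Q - d 0 (t + \<tau>)) \<le> 3 * K * M * C ^ Suc m * (\<epsilon> + h ^ Suc m)" .
    have "norm (S \<tau> (x - d 0 t)) \<le> K * \<epsilon>" unfolding \<epsilon>_def by (rule norm_S_le[OF \<tau>])
    also have "\<dots> \<le> K * (\<epsilon> + h ^ Suc m)" using K(1) h by (intro mult_left_mono) auto
    finally have 3: "norm (S \<tau> (x - d 0 t)) \<le> K * (\<epsilon> + h ^ Suc m)" .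
    have "U i = S \<tau> x + ?N" using U i by (simp add: stage_equations_def \<tau>_def add.assoc)
    then have "U i - d 0 (t + \<tau>) = S \<tau> (x - d 0 t) + (?N - ?Q) + (S \<tau> (d 0 t) + ?Q - d 0 (t + \<tau>))"
      by (simp add: blinfun.diff_right)
    then have "norm (U i - d 0 (t + \<tau>)) \<le> norm (S \<tau> (x - d 0 t)) + norm (?N - ?Q) + norm (S \<tau> (d 0 t) + ?Q - d 0 (t + \<tau>))"
      by (simp only: norm_add3)
    also have "\<dots> \<le> \<kappa>' * (\<epsilon> + h ^ Suc m)"
      using 1 2 3 by (simp add: \<kappa>'_def distrib_right)
    finally show ?thesis by (simp only: \<epsilon>_def \<tau>_def)
  qed
  moreover have "0 \<le> \<kappa>'" using CKL K(1) Ka0 L \<kappa>(1) by (simp add: \<kappa>'_def)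
  ultimately show ?thesis
    unfolding stages_accurate_def m_def[symmetric] using \<delta>(1) by blast
qed

lemma stages_accurate_final: "stages_accurate {12..16} 6"
proof -
  have step: "stages_accurate I (Suc (Suc n))"
    if "\<And>i. i \<in> I \<Longrightarrow> i \<in> {2..16} \<and> sources i = J \<and> card J = n" "stages_accurate J (Suc n)" "finite I" for I J n
  proof (rule stages_accurate_finite[OF that(3)])
    fix i assume "i \<in> I"
    from that(1)[OF this] stage_step[of i] that(2) show "stages_accurate {i} (Suc (Suc n))" by simp
  qed
  have "stages_accurate {2} (Suc (Suc 0))"
    by (rule step[of _ "{}"]) (auto simp: sources_def stages_accurate_empty)
  then have "stages_accurate {3, 4} (Suc (Suc 1))"
    by (intro step[of _ "{2}"]) (auto simp: sources_def)
  then have "stages_accurate {5, 6, 7} (Suc (Suc 2))"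
    by (intro step[of _ "{3, 4}"]) (auto simp: sources_def numeral_2_eq_2)
  then have "stages_accurate {8..11} (Suc (Suc 3))"
    by (intro step[of _ "{5, 6, 7}"]) (auto simp: sources_def numeral_2_eq_2 numeral_3_eq_3)
  then have "stages_accurate {12..16} (Suc (Suc 4))"
    by (intro step[of _ "{8..11}"]) (auto simp: sources_def eval_nat_numeral)
  then show ?thesis by simp
qed

text \<open>
  The local error in the form required by the Gronwall argument: the difference to \<open>T h\<close> applied to the
  initial error carries a factor \<open>h\<close>.
\<close>

lemma step_defect:
  "\<exists>\<kappa> \<delta>. 0 \<le> \<kappa> \<and> 0 < \<delta> \<and> \<delta> \<le> 1 \<and> (\<forall>h t x U. 0 < h \<and> h \<le> \<delta> \<and> t0 \<le> t \<and> t + h \<le> t1 \<and>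
     norm (x - d 0 t) \<le> \<delta> \<and> stage_equations h x U \<longrightarrow>
     norm (S h x + h *\<^sub>R blinfun_apply (phi (Suc 0) h) (g x)
       + h *\<^sub>R (\<Sum>i=12..16. blinfun_apply (ExpRK6s16_b c (\<lambda>q t. phi q (t * h)) i) (g (U i) - g x))
       - d 0 (t + h) - S h (x - d 0 t)) \<le> h * \<kappa> * (norm (x - d 0 t) + h ^ 6))"
proof -
  obtain \<kappa> \<delta>' where \<kappa>: "0 \<le> \<kappa>" "0 < \<delta>'" "\<And>h t x U j. j \<in> {12..16} \<Longrightarrow> 0 < h \<Longrightarrow> h \<le> \<delta>' \<Longrightarrow> t \<in> {t0..t1} \<Longrightarrow>
      norm (x - d 0 t) \<le> \<delta>' \<Longrightarrow> stage_equations h x U \<Longrightarrow>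
      norm (U j - d 0 (t + c j * h)) \<le> \<kappa> * (norm (x - d 0 t) + h ^ 6)"
    using stages_accurate_final unfolding stages_accurate_def by blast
  obtain Ka where Ka: "\<And>h. 0 < h \<Longrightarrow> h \<le> 1 \<Longrightarrow>
      (\<Sum>i=12..16. norm (ExpRK6s16_b c (\<lambda>q t. phi q (t * h)) i)) \<le> Ka"
    using sum_b_bounded by blast
  have Ka0: "0 \<le> Ka" using Ka[of 1] sum_nonneg[of "{12..16}" "\<lambda>i. norm (ExpRK6s16_b c (\<lambda>q t. phi q (t * 1)) i)"]
    by fastforce
  obtain \<delta> where \<delta>: "0 < \<delta>" "\<delta> \<le> \<delta>'" "\<delta> \<le> 1" "\<delta> < r" "\<kappa> * (2 * \<delta>) < r" "C * \<delta> \<le> t2 - t1"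
    using small_step[OF \<kappa>(1,2)] by blast
  define \<kappa>' where "\<kappa>' = C * K * L + Ka * (L * \<kappa> + M * C ^ 6 + L) + K * M"
  have CKL: "0 \<le> C * K * L" "0 \<le> M * C ^ 6" "0 \<le> K * M"
    using C_ge_1 K(1) L M_nonneg by auto
  have "norm (S h x + h *\<^sub>R blinfun_apply (phi (Suc 0) h) (g x)
       + h *\<^sub>R (\<Sum>i=12..16. blinfun_apply (ExpRK6s16_b c (\<lambda>q t. phi q (t * h)) i) (g (U i) - g x))
       - d 0 (t + h) - S h (x - d 0 t)) \<le> h * \<kappa>' * (norm (x - d 0 t) + h ^ 6)"
    if h: "0 < h" "h \<le> \<delta>" and t: "t0 \<le> t" "t + h \<le> t1" and x: "norm (x - d 0 t) \<le> \<delta>" and U: "stage_equations h x U"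
    for h t x U
  proof -
    define \<epsilon> where "\<epsilon> = norm (x - d 0 t)"
    have \<epsilon>: "0 \<le> \<epsilon>" by (simp add: \<epsilon>_def)
    have h1: "h \<le> 1" using h \<delta> by simp
    have tt: "t \<in> {t0..t1}" using t h by auto
    have Ch: "C * h \<le> t2 - t1" using h \<delta>(6) C_ge_1 mult_left_mono[of h \<delta> C] by linarith
    have hm: "h ^ 6 \<le> h" using power_decreasing[of 1 6 h] h h1 by simp
    have E: "\<kappa> * (\<epsilon> + h ^ 6) < r"
    proof -
      have "\<kappa> * (\<epsilon> + h ^ 6) \<le> \<kappa> * (2 * \<delta>)" using hm h x \<kappa>(1) by (intro mult_left_mono) (auto simp: \<epsilon>_def)
      then show ?thesis using \<delta>(5) by simp
    qed
    let ?N = "h *\<^sub>R blinfun_apply (phi (Suc 0) h) (g x)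
      + h *\<^sub>R (\<Sum>i=12..16. blinfun_apply (ExpRK6s16_b c (\<lambda>q t. phi q (t * h)) i) (g (U i) - g x))"
    let ?Q = "\<Sum>q<6. h ^ Suc q *\<^sub>R blinfun_apply (phi (Suc q) h) (e q t)"
    have "norm ((1 * h) *\<^sub>R blinfun_apply (phi (Suc 0) (1 * h)) (g x)
      + h *\<^sub>R (\<Sum>i=12..16. blinfun_apply (ExpRK6s16_b c (\<lambda>q t. phi q (t * h)) i) (g (U i) - g x))
      - (\<Sum>q<6. (1 * h) ^ Suc q *\<^sub>R blinfun_apply (phi (Suc q) (1 * h)) (e q t)))
      \<le> h * (C * K * L * norm (x - d 0 t) + Ka * (L * (\<kappa> * (\<epsilon> + h ^ 6)) + M * (C * h) ^ 6 + L * norm (x - d 0 t)))"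
    proof (rule nonlinear_defect)
      show "0 \<le> c j \<and> c j \<le> C" if "j \<in> {12..16}" for j
        using node_bounds[of j] that by fastforce
      show "(\<Sum>j=12..16. (c j ^ q / fact q) *\<^sub>R blinfun_apply (ExpRK6s16_b c (\<lambda>q t. phi q (t * h)) j) v)
          = 1 ^ Suc q *\<^sub>R blinfun_apply (phi (Suc q) (1 * h)) v" if q: "1 \<le> q" "q < 6" for q v
      proof -
        have "blinfun_apply (\<Sum>j=12..16. (c j ^ q / fact q) *\<^sub>R ExpRK6s16_b c (\<lambda>q t. phi q (t * h)) j) v
          = blinfun_apply (phi (Suc q) (1 * h)) v"
          using sum_b_order[OF q(1), of "\<lambda>q t. phi q (t * h)"] q(2) by simp
        then show ?thesis by (simp add: blinfun.sum_left blinfun.scaleR_left)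
      qed
      show "norm (U j - d 0 (t + c j * h)) \<le> \<kappa> * (\<epsilon> + h ^ 6)" if "j \<in> {12..16}" for j
        unfolding \<epsilon>_def by (rule \<kappa>(3)[OF that]) (use h \<delta> tt x U in auto)
      show "norm (x - d 0 t) < r" using x \<delta>(4) by simp
      show "0 \<le> \<kappa> * (\<epsilon> + h ^ 6)" using \<kappa>(1) \<epsilon> h by simp
    qed (use C_ge_1 h h1 tt Ch Ka E in auto)
    then have "norm (?N - ?Q)
      \<le> h * (C * K * L * norm (x - d 0 t) + Ka * (L * (\<kappa> * (\<epsilon> + h ^ 6)) + M * (C * h) ^ 6 + L * norm (x - d 0 t)))"
      by simp
    also have "\<dots> = h * (C * K * L * \<epsilon> + Ka * (L * (\<kappa> * (\<epsilon> + h ^ 6)) + M * C ^ 6 * h ^ 6 + L * \<epsilon>))"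
      by (simp add: \<epsilon>_def power_mult_distrib mult_ac)
    also have "\<dots> \<le> h * ((C * K * L + Ka * (L * \<kappa> + M * C ^ 6 + L)) * (\<epsilon> + h ^ 6))"
      using h h1 CKL Ka0 \<kappa>(1) \<epsilon> L by (intro mult_left_mono defect_arithmetic[where h = h]) auto
    finally have 1: "norm (?N - ?Q) \<le> h * ((C * K * L + Ka * (L * \<kappa> + M * C ^ 6 + L)) * (\<epsilon> + h ^ 6))" .
    have "norm (S h (d 0 t) + ?Q - d 0 (t + h)) \<le> K * M * h ^ 7"
      by (rule final_defect) (use h h1 t in auto)
    also have "\<dots> = h * (K * M * h ^ 6)" by (simp add: eval_nat_numeral)
    also have "\<dots> \<le> h * (K * M * (\<epsilon> + h ^ 6))"
      using h \<epsilon> CKL by (intro mult_left_mono) auto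
    finally have 2: "norm (S h (d 0 t) + ?Q - d 0 (t + h)) \<le> h * (K * M * (\<epsilon> + h ^ 6))" .
    have split: "h * \<kappa>' * (\<epsilon> + h ^ 6)
        = h * ((C * K * L + Ka * (L * \<kappa> + M * C ^ 6 + L)) * (\<epsilon> + h ^ 6)) + h * (K * M * (\<epsilon> + h ^ 6))"
      unfolding \<kappa>'_def by (simp only: distrib_right[of _ _ "\<epsilon> + h ^ 6"] distrib_left[of h] mult.assoc[of h])
    have "S h x + h *\<^sub>R blinfun_apply (phi (Suc 0) h) (g x)
       + h *\<^sub>R (\<Sum>i=12..16. blinfun_apply (ExpRK6s16_b c (\<lambda>q t. phi q (t * h)) i) (g (U i) - g x))
       - d 0 (t + h) - S h (x - d 0 t) = (?N - ?Q) + (S h (d 0 t) + ?Q - d 0 (t + h))"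
      by (simp add: blinfun.diff_right)
    then show ?thesis
      unfolding \<epsilon>_def[symmetric] split
      using order_trans[OF norm_triangle_ineq add_mono[OF 1 2]] by (simp only:)
  qed
  moreover have "0 \<le> \<kappa>'" using CKL Ka0 L \<kappa>(1) by (simp add: \<kappa>'_def)
  ultimately show ?thesis using \<delta>(1,3) by blast
qed

theorem sixth_order_convergence:
  "\<exists>B h0. 0 < h0 \<and> (\<forall>h un U. 0 < h \<and> h \<le> h0 \<and> un 0 = d 0 t0 \<and>
     (\<forall>n. stage_equations h (un n) (U n) \<and> un (Suc n) = S h (un n) + h *\<^sub>R blinfun_apply (phi (Suc 0) h) (g (un n))
        + h *\<^sub>R (\<Sum>i=12..16. blinfun_apply (ExpRK6s16_b c (\<lambda>q t. phi q (t * h)) i) (g (U n i) - g (un n)))) \<longrightarrow>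
     (\<forall>n. t0 + real n * h \<le> t1 \<longrightarrow> norm (un n - d 0 (t0 + real n * h)) \<le> B * h ^ 6))"
proof -
  obtain \<kappa> \<delta> where \<kappa>: "0 \<le> \<kappa>" "0 < \<delta>" "\<delta> \<le> 1" and step: "\<And>h t x U. 0 < h \<Longrightarrow> h \<le> \<delta> \<Longrightarrow> t0 \<le> t \<Longrightarrow> t + h \<le> t1 \<Longrightarrow>
     norm (x - d 0 t) \<le> \<delta> \<Longrightarrow> stage_equations h x U \<Longrightarrow>
     norm (S h x + h *\<^sub>R blinfun_apply (phi (Suc 0) h) (g x)
       + h *\<^sub>R (\<Sum>i=12..16. blinfun_apply (ExpRK6s16_b c (\<lambda>q t. phi q (t * h)) i) (g (U i) - g x))
       - d 0 (t + h) - S h (x - d 0 t)) \<le> h * \<kappa> * (norm (x - d 0 t) + h ^ 6)"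
    using step_defect by blast
  define B where "B = exp (K * \<kappa> * R)"
  \<comment> \<open>The step size bound makes the final error bound smaller than \<open>\<delta>\<close>, so that the local estimate never fails.\<close>
  define h0 where "h0 = min \<delta> (\<delta> / B)"
  have B: "0 < B" by (simp add: B_def)
  have h0: "0 < h0" using \<kappa> B by (simp add: h0_def)
  have "norm (un n - d 0 (t0 + real n * h)) \<le> B * h ^ 6"
    if h: "0 < h" "h \<le> h0" and init: "un 0 = d 0 t0"
      and eqs: "\<And>n. stage_equations h (un n) (U n)"
        "\<And>n. un (Suc n) = S h (un n) + h *\<^sub>R blinfun_apply (phi (Suc 0) h) (g (un n))
        + h *\<^sub>R (\<Sum>i=12..16. blinfun_apply (ExpRK6s16_b c (\<lambda>q t. phi q (t * h)) i) (g (U n i) - g (un n)))"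
      and N: "t0 + real n * h \<le> t1"
    for h un U n
  proof -
    define \<epsilon> where "\<epsilon> n = un n - d 0 (t0 + real n * h)" for n
    have h\<delta>: "h \<le> \<delta>" "h \<le> \<delta> / B" using h by (auto simp: h0_def)
    have "norm (\<epsilon> n) \<le> h ^ 6 * exp (K * \<kappa> * R)"
    proof (rule discrete_gronwall[where N = n and h = h and \<delta> = \<delta> and R = R])
      show "real n * h \<le> R" using N C_ge_1 by (simp add: R_def)
      show "\<epsilon> 0 = 0" using init by (simp add: \<epsilon>_def)
      have "h ^ 6 \<le> h" using power_decreasing[of 1 6 h] h h\<delta> \<kappa> by simp
      then have "h ^ 6 * B \<le> h * B" using B by (intro mult_right_mono) auto
      also have "\<dots> \<le> \<delta>" using h\<delta>(2) B by (simp add: field_simps)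
      finally show "h ^ 6 * exp (K * \<kappa> * R) \<le> \<delta>" by (simp add: B_def)
      fix k assume k: "k < n" "norm (\<epsilon> k) \<le> \<delta>"
      have "real (Suc k) * h \<le> real n * h" using k h by (intro mult_right_mono) auto
      then have "t0 + real k * h + h \<le> t1" using N by (simp add: algebra_simps)
      then have "norm (S h (un k) + h *\<^sub>R blinfun_apply (phi (Suc 0) h) (g (un k))
       + h *\<^sub>R (\<Sum>i=12..16. blinfun_apply (ExpRK6s16_b c (\<lambda>q t. phi q (t * h)) i) (g (U k i) - g (un k)))
       - d 0 (t0 + real k * h + h) - S h (un k - d 0 (t0 + real k * h))) \<le> h * \<kappa> * (norm (un k - d 0 (t0 + real k * h)) + h ^ 6)"
        by (intro step) (use h h\<delta> k eqs in \<open>auto simp: \<epsilon>_def\<close>)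
      moreover have "t0 + real (Suc k) * h = t0 + real k * h + h" by (simp add: algebra_simps)
      ultimately show "norm (\<epsilon> (Suc k) - S h (\<epsilon> k)) \<le> h * \<kappa> * (norm (\<epsilon> k) + h ^ 6)"
        unfolding \<epsilon>_def eqs(2) by (simp only:)
    qed (use K h \<kappa> in auto)
    then show ?thesis by (simp add: \<epsilon>_def B_def mult.commute)
  qed
  then show ?thesis using h0 by blast
qed

end


section \<open>From the scheme to its form without the generator\<close>

context strongly_continuous_semigroup
begin

definition in_domain :: "'a \<Rightarrow> bool" where "in_domain x \<longleftrightarrow> (\<exists>y. in_graph x y)"

lemma in_domain_0: "in_domain 0"
  using in_graph_0 by (auto simp: in_domain_def)

lemma in_domain_add: "in_domain x \<Longrightarrow> in_domain x' \<Longrightarrow> in_domain (x + x')"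
  using in_graph_add by (fastforce simp: in_domain_def)

lemma in_domain_scaleR: "in_domain x \<Longrightarrow> in_domain (a *\<^sub>R x)"
  using in_graph_scaleR by (fastforce simp: in_domain_def)

lemma in_domain_S: "0 \<le> s \<Longrightarrow> in_domain x \<Longrightarrow> in_domain (S s x)"
  using in_graph_S by (fastforce simp: in_domain_def)

lemma in_domain_phi: "0 < \<tau> \<Longrightarrow> in_domain (blinfun_apply (phi (Suc k) \<tau>) v)"
  unfolding in_domain_def by (rule exI, rule in_graph_phi)

lemma in_domain_sum: "(\<And>i. i \<in> I \<Longrightarrow> in_domain (f i)) \<Longrightarrow> in_domain (\<Sum>i\<in>I. f i)"
  by (induction I rule: infinite_finite_induct) (simp_all add: in_domain_0 in_domain_add)

text \<open>
  On the domain, \<open>x + \<tau> \<phi>\<^sub>1(\<tau>A) A x = exp (\<tau>A) x\<close>, which removes the generator from the scheme.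
\<close>

lemma exponential_Euler_step:
  assumes "in_graph x y" "0 \<le> \<tau>"
  shows "x + \<tau> *\<^sub>R blinfun_apply (phi (Suc 0) \<tau>) (y + v) = S \<tau> x + \<tau> *\<^sub>R blinfun_apply (phi (Suc 0) \<tau>) v"
  using phi_recursion[OF assms, of 0]
  by (simp add: phi0_def blinfun.add_right scaleR_add_right)

text \<open>
  The numerical solution remains in the domain, because \<open>T h\<close> preserves the domain and all
  \<open>\<phi>\<^sub>k(hA)\<close> with \<open>k \<ge> 1\<close> map into it.  Hence the arbitrary values of \<open>A\<close> elsewhere are never used.
\<close>

lemma ExpRK6s16_semigroup_form:
  assumes gen: "generator D A T" and x0: "u 0 \<in> D" and h: "0 < h"
    and c: "\<And>i. i \<in> {2..16} \<Longrightarrow> 0 < c i"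
    and seq: "exp_RK_sequence 16 c (\<lambda>t. phi (Suc 0) (t * h)) (ExpRK6s16_a c (\<lambda>q t. phi q (t * h)))
      (ExpRK6s16_b c (\<lambda>q t. phi q (t * h))) A g h u U"
  shows "i \<in> {2..16} \<Longrightarrow> U n i = S (c i * h) (u n) + (c i * h) *\<^sub>R blinfun_apply (phi (Suc 0) (c i * h)) (g (u n))
      + h *\<^sub>R (\<Sum>j\<in>sources i. blinfun_apply (ExpRK6s16_a c (\<lambda>q t. phi q (t * h)) i j) (g (U n j) - g (u n)))"
    and "u (Suc n) = S h (u n) + h *\<^sub>R blinfun_apply (phi (Suc 0) h) (g (u n))
      + h *\<^sub>R (\<Sum>i=12..16. blinfun_apply (ExpRK6s16_b c (\<lambda>q t. phi q (t * h)) i) (g (U n i) - g (u n)))"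
proof -
  let ?a = "ExpRK6s16_a c (\<lambda>q t. phi q (t * h))" and ?b = "ExpRK6s16_b c (\<lambda>q t. phi q (t * h))"
  have stage: "U n i = u n + (c i * h) *\<^sub>R blinfun_apply (phi (Suc 0) (c i * h)) (A (u n) + g (u n))
      + h *\<^sub>R (\<Sum>j\<in>sources i. blinfun_apply (?a i j) (g (U n j) - g (u n)))" if "i \<in> {2..16}" for n i
  proof -
    have "(\<Sum>j=2..<i. blinfun_apply (?a i j) (g (U n j) - g (u n)))
        = (\<Sum>j\<in>sources i. blinfun_apply (?a i j) (g (U n j) - g (u n)))"
      using sources_subset by (intro sum.mono_neutral_right) (auto simp: ExpRK6s16_a_eq_0)
    then show ?thesis using seq that by (simp add: exp_RK_sequence_def)
  qed
  have update: "u (Suc n) = u n + h *\<^sub>R blinfun_apply (phi (Suc 0) h) (A (u n) + g (u n))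
      + h *\<^sub>R (\<Sum>i=12..16. blinfun_apply (?b i) (g (U n i) - g (u n)))" for n
  proof -
    have "(\<Sum>i=2..16. blinfun_apply (?b i) (g (U n i) - g (u n)))
        = (\<Sum>i=12..16. blinfun_apply (?b i) (g (U n i) - g (u n)))"
      by (intro sum.mono_neutral_right) (auto simp: ExpRK6s16_b_eq_0)
    then show ?thesis using seq by (simp add: exp_RK_sequence_def)
  qed
  have graph: "in_graph x (A x)" if "in_domain x" for x
    using that in_graph_imp_generator[OF gen] by (auto simp: in_domain_def)
  have b: "in_domain (blinfun_apply (?b i) v)" if "i \<in> {12..16}" for i v
    unfolding ExpRK6s16_b_eq_lagrange[OF that] blinfun.sum_left blinfun.scaleR_left
    using in_domain_phi[OF h, of "Suc _"] by (intro in_domain_sum in_domain_scaleR) simp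
  have dom: "in_domain (u n)" for n
  proof (induction n)
    case 0
    then show ?case using generator_imp_in_graph[OF gen x0] by (auto simp: in_domain_def)
  next
    case (Suc n)
    have "in_domain (S h (u n) + h *\<^sub>R blinfun_apply (phi (Suc 0) h) (g (u n))
      + h *\<^sub>R (\<Sum>i=12..16. blinfun_apply (?b i) (g (U n i) - g (u n))))"
      using h Suc by (intro in_domain_add in_domain_scaleR in_domain_sum in_domain_S in_domain_phi b) auto
    then show ?case
      using update[of n] exponential_Euler_step[OF graph[OF Suc], of h "g (u n)"] h by simp
  qed
  show "U n i = S (c i * h) (u n) + (c i * h) *\<^sub>R blinfun_apply (phi (Suc 0) (c i * h)) (g (u n))
      + h *\<^sub>R (\<Sum>j\<in>sources i. blinfun_apply (?a i j) (g (U n j) - g (u n)))" if "i \<in> {2..16}"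
    using stage[OF that, of n] exponential_Euler_step[OF graph[OF dom[of n]], of "c i * h" "g (u n)"] c[OF that] h
    by simp
  show "u (Suc n) = S h (u n) + h *\<^sub>R blinfun_apply (phi (Suc 0) h) (g (u n))
      + h *\<^sub>R (\<Sum>i=12..16. blinfun_apply (?b i) (g (U n i) - g (u n)))"
    using update[of n] exponential_Euler_step[OF graph[OF dom[of n]], of h "g (u n)"] h by simp
qed

end

lemma (in ExpRK6s16_nodes) ExpRK6s16_convergence:
  fixes T :: "real \<Rightarrow> 'a::banach \<Rightarrow>\<^sub>L 'a"
  assumes C0: "C0_semigroup T" and gen: "generator D A T" and t: "t0 < t1"
    and sol: "solves D A g u t0 t1" and u: "smooth_bounded_curve 6 u t0 t1" and \<rho>: "0 < \<rho>"
    and g: "six_times_differentiable_bounded g (strip u t0 t1 \<rho>)"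
  shows "\<exists>B h0. 0 < h0 \<and> (\<forall>h un U. 0 < h \<and> h \<le> h0 \<and> un 0 = u t0 \<and>
     exp_RK_sequence 16 c (\<lambda>t. phi_semigroup T 1 (t * h)) (ExpRK6s16_a c (\<lambda>q t. phi_semigroup T q (t * h)))
       (ExpRK6s16_b c (\<lambda>q t. phi_semigroup T q (t * h))) A g h un U \<longrightarrow>
     (\<forall>n. t0 + real n * h \<le> t1 \<longrightarrow> norm (un n - u (t0 + real n * h)) \<le> B * h ^ 6))"
proof -
  interpret strongly_continuous_semigroup T by unfold_locales (rule C0)
  obtain t2 d e M L where ext: "t1 < t2" "\<And>t. t \<in> {t0..t1} \<Longrightarrow> d 0 t = u t"
    "jet 6 d M {t0..t2}" "jet 6 e M {t0..t2}" "\<And>t. t \<in> {t0..t2} \<Longrightarrow> e 0 t = g (d 0 t)"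
    "0 \<le> L" "\<And>t y. t \<in> {t0..t2} \<Longrightarrow> norm (y - d 0 t) < \<rho> / 2 \<Longrightarrow> norm (g y - e 0 t) \<le> L * norm (y - d 0 t)"
    by (rule extended_solution[OF u t \<rho> g], rule that)
  have sub: "{t0..t1} \<subseteq> {t0..t2}" using ext(1) by auto
  have jets: "jet 6 d M {t0..t1}" "jet 6 e M {t0..t1}"
    using jet_subset[OF ext(3) sub] jet_subset[OF ext(4) sub] by auto
  have graph0: "in_graph (d 0 s) (d (Suc 0) s - e 0 s)" if s: "s \<in> {t0..t1}" for s
  proof -
    have us: "u s \<in> D" "(u has_vector_derivative A (u s) + g (u s)) (at s within {t0..t1})"
      using sol s by (auto simp: solves_def)
    have "(d 0 has_vector_derivative d (Suc 0) s) (at s within {t0..t1})"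
      using jets(1) s by (auto simp: jet_def)
    then have "(u has_vector_derivative d (Suc 0) s) (at s within {t0..t1})"
      by (rule has_vector_derivative_transform[OF s, rotated]) (simp add: ext(2))
    then have "d (Suc 0) s = A (u s) + g (u s)"
      using us(2) vector_derivative_unique_within_closed_interval[OF t] s by (simp add: cbox_interval) blast
    moreover have "e 0 s = g (u s)" using ext(2)[OF s] ext(5)[of s] s sub by auto
    ultimately show ?thesis using generator_imp_in_graph[OF gen us(1)] ext(2)[OF s] by simp
  qed
  interpret ExpRK6s16_problem T c g d e t0 t1 t2 M L "\<rho> / 2"
  proof unfold_locales
    show "in_graph (d q s) (d (Suc q) s - e q s)" if "q \<le> 5" "s \<in> {t0..t1}" for q s
      by (rule in_graph_derivatives[OF t jets graph0 that])
  qed (use t ext \<rho> in auto)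
  obtain B h0 where h0: "0 < h0" and B: "\<forall>h un U. 0 < h \<and> h \<le> h0 \<and> un 0 = d 0 t0 \<and>
     (\<forall>n. stage_equations h (un n) (U n) \<and> un (Suc n) = S h (un n) + h *\<^sub>R blinfun_apply (phi (Suc 0) h) (g (un n))
        + h *\<^sub>R (\<Sum>i=12..16. blinfun_apply (ExpRK6s16_b c (\<lambda>q t. phi q (t * h)) i) (g (U n i) - g (un n)))) \<longrightarrow>
     (\<forall>n. t0 + real n * h \<le> t1 \<longrightarrow> norm (un n - d 0 (t0 + real n * h)) \<le> B * h ^ 6)"
    using sixth_order_convergence by (elim exE conjE) (rule that)
  have "norm (un n - u (t0 + real n * h)) \<le> B * h ^ 6"
    if h: "0 < h" "h \<le> h0" and init: "un 0 = u t0"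
      and seq: "exp_RK_sequence 16 c (\<lambda>t. phi 1 (t * h)) (ExpRK6s16_a c (\<lambda>q t. phi q (t * h)))
       (ExpRK6s16_b c (\<lambda>q t. phi q (t * h))) A g h un U"
      and n: "t0 + real n * h \<le> t1" for h un U n
  proof -
    have x0: "un 0 \<in> D" using sol t init by (auto simp: solves_def)
    note form = ExpRK6s16_semigroup_form[OF gen x0 h(1) pos seq[unfolded One_nat_def]]
    have "un 0 = d 0 t0" using init ext(2)[of t0] t by simp
    moreover have "\<forall>n. stage_equations h (un n) (U n) \<and> un (Suc n) = S h (un n) + h *\<^sub>R blinfun_apply (phi (Suc 0) h) (g (un n))
        + h *\<^sub>R (\<Sum>i=12..16. blinfun_apply (ExpRK6s16_b c (\<lambda>q t. phi q (t * h)) i) (g (U n i) - g (un n)))"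
      unfolding stage_equations_def by (intro allI conjI ballI form)
    ultimately have "\<forall>n. t0 + real n * h \<le> t1 \<longrightarrow> norm (un n - d 0 (t0 + real n * h)) \<le> B * h ^ 6"
      by (intro B[THEN spec, THEN spec, THEN spec, THEN mp] conjI h)
    then have "norm (un n - d 0 (t0 + real n * h)) \<le> B * h ^ 6" using n by blast
    moreover have "d 0 (t0 + real n * h) = u (t0 + real n * h)" using n h by (intro ext(2)) auto
    ultimately show ?thesis by simp
  qed
  then show ?thesis using h0 by blast
qed

theorem mainTheorem4:
  fixes c :: "nat \<Rightarrow> real"
  assumes pos: "\<forall>i\<in>{2..16}. 0 < c i"
    and "c 3 \<noteq> c 4"
    and "inj_on c {5, 6, 7}"
    and "inj_on c {8..11}"
    and "inj_on c {12..16}"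
  shows
    "(\<forall>(Z :: 'f::{real_normed_field,banach} ^ 'n ^ 'n) J K L (B :: 'f ^ 'n \<Rightarrow> 'f ^ 'n \<Rightarrow> 'f ^ 'n).
        bilinear B \<longrightarrow>
        (let \<phi> = (\<lambda>q t. phi_matrix q (t *\<^sub>R Z)) in
          stiff_order_conditions 16 c
            (\<lambda>q t v. \<phi> q t *v v)
            (\<lambda>i j v. ExpRK6s16_a c \<phi> i j *v v)
            (\<lambda>i v. ExpRK6s16_b c \<phi> i *v v)
            (\<lambda>v. J *v v) (\<lambda>v. K *v v) (\<lambda>v. L *v v) B))
     \<and>
     (\<forall>D A (T :: real \<Rightarrow> 'a::banach \<Rightarrow>\<^sub>L 'a) h (J :: 'a \<Rightarrow>\<^sub>L 'a) (K :: 'a \<Rightarrow>\<^sub>L 'a) (L :: 'a \<Rightarrow>\<^sub>L 'a)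
        (B :: 'a \<Rightarrow> 'a \<Rightarrow> 'a).
        generates_analytic_semigroup D A T \<and> 0 < h \<and> bounded_bilinear B \<longrightarrow>
        (let \<phi> = (\<lambda>q t. phi_semigroup T q (t * h)) in
          stiff_order_conditions 16 c
            (\<lambda>q t. blinfun_apply (\<phi> q t))
            (\<lambda>i j. blinfun_apply (ExpRK6s16_a c \<phi> i j))
            (\<lambda>i. blinfun_apply (ExpRK6s16_b c \<phi> i))
            (blinfun_apply J) (blinfun_apply K) (blinfun_apply L) B))
     \<and>
     (\<forall>D A (T :: real \<Rightarrow> 'a::banach \<Rightarrow>\<^sub>L 'a) g u t0 t_end \<rho>.
        generates_analytic_semigroup D A T \<and> t0 < t_end \<and>
        solves D A g u t0 t_end \<and>
        smooth_bounded_curve 6 u t0 t_end \<and>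
        0 < \<rho> \<and> six_times_differentiable_bounded g (strip u t0 t_end \<rho>) \<longrightarrow>
        (\<exists>C h0. 0 < h0 \<and>
          (\<forall>h un U. 0 < h \<and> h \<le> h0 \<and> un 0 = u t0 \<and>
             (let \<phi> = (\<lambda>q t. phi_semigroup T q (t * h)) in
               exp_RK_sequence 16 c (\<phi> 1) (ExpRK6s16_a c \<phi>) (ExpRK6s16_b c \<phi>) A g h un U) \<longrightarrow>
             (\<forall>n. t0 + real n * h \<le> t_end \<longrightarrow>
                norm (un n - u (t0 + real n * h)) \<le> C * h ^ 6))))
     \<and>
     (\<forall>G \<in> {{3, 4}, {5, 6, 7}, {8..11}, {12..16}}.
        (\<forall>z. independent_stages (ExpRK6s16_a c (\<lambda>r t. phi_scalar r (complex_of_real t * z))) G) \<and>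
        (\<forall>D A (T :: real \<Rightarrow> 'a \<Rightarrow>\<^sub>L 'a) h. generates_analytic_semigroup D A T \<and> 0 < h \<longrightarrow>
           independent_stages (ExpRK6s16_a c (\<lambda>r t. phi_semigroup T r (t * h))) G))"
proof -
  interpret ExpRK6s16_nodes c
  proof unfold_locales
    show "0 < c i" if "i \<in> {2..16}" for i using pos that by blast
  qed (fact assms)+
  show ?thesis
  proof (intro conjI)
    show "\<forall>(Z :: 'f ^ 'n ^ 'n) J K L (B :: 'f ^ 'n \<Rightarrow> 'f ^ 'n \<Rightarrow> 'f ^ 'n).
        bilinear B \<longrightarrow>
        (let \<phi> = (\<lambda>q t. phi_matrix q (t *\<^sub>R Z)) in
          stiff_order_conditions 16 c
            (\<lambda>q t v. \<phi> q t *v v)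
            (\<lambda>i j v. ExpRK6s16_a c \<phi> i j *v v)
            (\<lambda>i v. ExpRK6s16_b c \<phi> i *v v)
            (\<lambda>v. J *v v) (\<lambda>v. K *v v) (\<lambda>v. L *v v) B)"
      unfolding Let_def
      by (intro allI impI stiff_order_conditions_ExpRK6s16 bilinear_matrix_vector_mult)
         (auto simp: bilinear_lzero bilinear_rzero)
  next
    show "\<forall>D A (T :: real \<Rightarrow> 'a \<Rightarrow>\<^sub>L 'a) h (J :: 'a \<Rightarrow>\<^sub>L 'a) (K :: 'a \<Rightarrow>\<^sub>L 'a) (L :: 'a \<Rightarrow>\<^sub>L 'a)
        (B :: 'a \<Rightarrow> 'a \<Rightarrow> 'a).
        generates_analytic_semigroup D A T \<and> 0 < h \<and> bounded_bilinear B \<longrightarrow>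
        (let \<phi> = (\<lambda>q t. phi_semigroup T q (t * h)) in
          stiff_order_conditions 16 c
            (\<lambda>q t. blinfun_apply (\<phi> q t))
            (\<lambda>i j. blinfun_apply (ExpRK6s16_a c \<phi> i j))
            (\<lambda>i. blinfun_apply (ExpRK6s16_b c \<phi> i))
            (blinfun_apply J) (blinfun_apply K) (blinfun_apply L) B)"
      unfolding Let_def
      by (intro allI impI stiff_order_conditions_ExpRK6s16 bilinear_blinfun_apply)
         (auto simp: bounded_bilinear.zero_left bounded_bilinear.zero_right)
  next
    show "\<forall>D A (T :: real \<Rightarrow> 'a \<Rightarrow>\<^sub>L 'a) g u t0 t_end \<rho>.
        generates_analytic_semigroup D A T \<and> t0 < t_end \<and>
        solves D A g u t0 t_end \<and>
        smooth_bounded_curve 6 u t0 t_end \<and>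
        0 < \<rho> \<and> six_times_differentiable_bounded g (strip u t0 t_end \<rho>) \<longrightarrow>
        (\<exists>C h0. 0 < h0 \<and>
          (\<forall>h un U. 0 < h \<and> h \<le> h0 \<and> un 0 = u t0 \<and>
             (let \<phi> = (\<lambda>q t. phi_semigroup T q (t * h)) in
               exp_RK_sequence 16 c (\<phi> 1) (ExpRK6s16_a c \<phi>) (ExpRK6s16_b c \<phi>) A g h un U) \<longrightarrow>
             (\<forall>n. t0 + real n * h \<le> t_end \<longrightarrow>
                norm (un n - u (t0 + real n * h)) \<le> C * h ^ 6)))"
      unfolding Let_def generates_analytic_semigroup_def analytic_semigroup_def
      by (intro allI impI, elim conjE) (rule ExpRK6s16_convergence; assumption)
  next
    show "\<forall>G \<in> {{3, 4}, {5, 6, 7}, {8..11}, {12..16}}.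
        (\<forall>z. independent_stages (ExpRK6s16_a c (\<lambda>r t. phi_scalar r (complex_of_real t * z))) G) \<and>
        (\<forall>D A (T :: real \<Rightarrow> 'a \<Rightarrow>\<^sub>L 'a) h. generates_analytic_semigroup D A T \<and> 0 < h \<longrightarrow>
           independent_stages (ExpRK6s16_a c (\<lambda>r t. phi_semigroup T r (t * h))) G)"
      by (auto simp: independent_stages_def sources_def intro!: ExpRK6s16_a_eq_0)
  qed
qed

end
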